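(* Let $s,t\in\mathbb N$ with $st\ge2$. Then $p(K_{s,t},\cdot)$ is perfectly stable, $i(K_{s,t})=\binom{s+t}{s}M_{s,t}$, and there is a unique maximiser $(\alpha,1-\alpha,0,0,0,\ldots)$, where $\alpha\in[\frac12,1]$ maximises $f_{s,t}(\alpha)=\alpha^s(1-\alpha)^t+\alpha^t(1-\alpha)^s$, and where $M_{s,t}=\max_{x\in[\frac12,1]}f_{s,t}(x)$ for $s\ne t$ and $M_{s,s}=\frac12\max_{x\in[\frac12,1]}f_{s,s}(x)$.
   Context: For graphs $F,G$ with $v(F)\le v(G)$, $P(F,G)$ is the number of $v(F)$-subsets of $V(G)$ inducing a copy of $F$, and $p(F,G)=P(F,G)/\binom{v(G)}{v(F)}$. $i(F,n)=\max\{P(F,G):v(G)=n\}$ and $i(F)=\lim_{n\to\infty}i(F,n)/\binom{n}{v(F)}$. $K_{s,t}$ is the complete bipartite graph with parts of sizes $s,t$. Write $\lambda=p(F,\cdot)$ with $F=K_{s,t}$, $\lambda(n)=\max\{\lambda(G):v(G)=n\}$, $\lambda_{\max}=\lim_n\lambda(n)$. A graph is complete partite if its vertex set is partitioned into independent sets (parts) with all edges between distinct parts. For $n$-vertex graphs $G,H$, $\hat\delta_1(G,H)=\frac2{n^2}\min_\sigma|E(H)\triangle E(\sigma(G))|$ over bijections $\sigma:V(G)\to V(H)$. $\lambda$ is perfectly stable if there is $C>0$ such that every graph $G$ of order $n\ge C$ admits a complete partite $H$ of order $n$ with $\hat\delta_1(G,H)\le C(\lambda(n)-\lambda(G))$.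 A maximiser is a sequence $\mathbf x=(x_1,x_2,\ldots)$ with $x_1\ge x_2\ge\cdots\ge0$, $\sum x_i\le1$, for which there are complete partite graphs $H_n$ with $v(H_n)\to\infty$, $\lambda(H_n)\to\lambda_{\max}$, and the $i$-th largest part of $H_n$ having $(x_i+o(1))v(H_n)$ vertices for every $i\ge1$. "Unique maximiser" means the set of maximisers consists of exactly this sequence. *)

theory Defs
  imports Complex_Main "HOL-Library.Multiset" "HOL-Library.Disjoint_Sets"
begin

text \<open>A graph is a pair of a vertex set and a set of two-element subsets of it. Quantification over
  all finite graphs is rendered by quantification over graphs whose vertices are natural numbers
  (with an arbitrary finite vertex set), which covers every finite graph up to isomorphism.\<close>

type_synonym ugraph = "nat set \<times> nat set set"

abbreviation verts :: "ugraph \<Rightarrow> nat set" where "verts \<equiv> fst"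
abbreviation edges :: "ugraph \<Rightarrow> nat set set" where "edges \<equiv> snd"

abbreviation order :: "ugraph \<Rightarrow> nat" where "order G \<equiv> card (verts G)"

definition simple_graph :: "ugraph \<Rightarrow> bool" where
  "simple_graph G \<longleftrightarrow> finite (verts G) \<and> (\<forall>e\<in>edges G. e \<subseteq> verts G \<and> card e = 2)"

definition isomorphic :: "ugraph \<Rightarrow> ugraph \<Rightarrow> bool" where
  "isomorphic F G \<longleftrightarrow> (\<exists>\<sigma>. bij_betw \<sigma> (verts F) (verts G) \<and> (\<lambda>e. \<sigma> ` e) ` edges F = edges G)"

definition induced_subgraph :: "ugraph \<Rightarrow> nat set \<Rightarrow> ugraph" where
  "induced_subgraph G S = (S, {e \<in> edges G. e \<subseteq> S})"

definition complete_bipartite :: "nat \<Rightarrow> nat \<Rightarrow> ugraph" where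
  "complete_bipartite s t = ({..<s + t}, {{i, j} |i j. i < s \<and> s \<le> j \<and> j < s + t})"

definition induced_count :: "ugraph \<Rightarrow> ugraph \<Rightarrow> nat" where
  "induced_count F G =
     card {S. S \<subseteq> verts G \<and> card S = order F \<and> isomorphic F (induced_subgraph G S)}"

text \<open>Only meaningful when the order of \<open>F\<close> is at most that of \<open>G\<close>; otherwise the value is \<open>0\<close>.\<close>

definition induced_density :: "ugraph \<Rightarrow> ugraph \<Rightarrow> real" where
  "induced_density F G = real (induced_count F G) / real (order G choose order F)"

definition max_count :: "ugraph \<Rightarrow> nat \<Rightarrow> nat" where
  "max_count F n = Max {induced_count F G |G. simple_graph G \<and> order G = n}"

definition inducibility :: "ugraph \<Rightarrow> real" where
  "inducibility F = lim (\<lambda>n. real (max_count F n) / real (n choose order F))"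

text \<open>The remaining notions concern a graph parameter \<open>L\<close>, intended to be \<open>induced_density F\<close>, which
  takes finitely many values on the graphs of each order.\<close>

definition max_value :: "(ugraph \<Rightarrow> real) \<Rightarrow> nat \<Rightarrow> real" where
  "max_value L n = Max {L G |G. simple_graph G \<and> order G = n}"

definition limit_max :: "(ugraph \<Rightarrow> real) \<Rightarrow> real" where
  "limit_max L = lim (max_value L)"

text \<open>The partition \<open>P\<close> into parts (all nonempty by \<^const>\<open>partition_on\<close>) is determined by \<open>G\<close>.\<close>

definition complete_partite_with :: "ugraph \<Rightarrow> nat set set \<Rightarrow> bool" where
  "complete_partite_with G P \<longleftrightarrow> simple_graph G \<and> partition_on (verts G) P \<and>
     edges G = {{u, v} |u v. \<exists>A\<in>P. \<exists>B\<in>P. A \<noteq> B \<and> u \<in> A \<and> v \<in> B}"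

definition complete_partite :: "ugraph \<Rightarrow> bool" where
  "complete_partite G \<longleftrightarrow> (\<exists>P. complete_partite_with G P)"

text \<open>Parts are indexed from \<open>0\<close>; absent parts count as having size \<open>0\<close>.\<close>

definition nth_largest_part :: "nat set set \<Rightarrow> nat \<Rightarrow> nat" where
  "nth_largest_part P i =
     (let sizes = rev (sorted_list_of_multiset (image_mset card (mset_set P)))
      in if i < length sizes then sizes ! i else 0)"

text \<open>The distance is only meaningful for graphs of equal order.\<close>

definition edit_distance :: "ugraph \<Rightarrow> ugraph \<Rightarrow> real" where
  "edit_distance G H = 2 / (real (order G))\<^sup>2 *
     real (Min {card ((edges H - (\<lambda>e. \<sigma> ` e) ` edges G) \<union> ((\<lambda>e. \<sigma> ` e) ` edges G - edges H)) |\<sigma>.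
                  bij_betw \<sigma> (verts G) (verts H)})"

definition perfectly_stable :: "(ugraph \<Rightarrow> real) \<Rightarrow> bool" where
  "perfectly_stable L \<longleftrightarrow>
     (\<exists>C::real. C > 0 \<and>
        (\<forall>G. simple_graph G \<and> real (order G) \<ge> C \<longrightarrow>
           (\<exists>H. complete_partite H \<and> order H = order G \<and>
                edit_distance G H \<le> C * (max_value L (order G) - L G))))"

text \<open>The sequence \<open>(x\<^sub>1, x\<^sub>2, \<dots>)\<close> is rendered as the function with \<open>x 0 = x\<^sub>1\<close>, \<open>x 1 = x\<^sub>2\<close>, etc.\<close>

definition maximiser :: "(ugraph \<Rightarrow> real) \<Rightarrow> (nat \<Rightarrow> real) \<Rightarrow> bool" where
  "maximiser L x \<longleftrightarrow>
     decseq x \<and> (\<forall>i. x i \<ge> 0) \<and> summable x \<and> suminf x \<le> 1 \<and>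
     (\<exists>H P. (\<forall>n. complete_partite_with (H n) (P n)) \<and>
        filterlim (\<lambda>n. order (H n)) at_top sequentially \<and>
        (\<lambda>n. L (H n)) \<longlonglongrightarrow> limit_max L \<and>
        (\<forall>i. (\<lambda>n. real (nth_largest_part (P n) i) / real (order (H n))) \<longlonglongrightarrow> x i))"

definition f_st :: "nat \<Rightarrow> nat \<Rightarrow> real \<Rightarrow> real" where
  "f_st s t x = x ^ s * (1 - x) ^ t + x ^ t * (1 - x) ^ s"

text \<open>By continuity and compactness the supremum is an attained maximum. The factor \<open>1 / 2\<close> accounts
  for the two summands of \<open>f_st s s\<close> counting the same embeddings.\<close>

definition M_st :: "nat \<Rightarrow> nat \<Rightarrow> real" where
  "M_st s t = (if s = t then 1 / 2 else 1) * (SUP x\<in>{1/2..1}. f_st s t x)"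

definition two_part_seq :: "real \<Rightarrow> nat \<Rightarrow> real" where
  "two_part_seq \<alpha> i = (if i = 0 then \<alpha> else if i = 1 then 1 - \<alpha> else 0)"

end

theory Submission
  imports Defs
begin

text \<open>Zykov symmetrisation (replacing a vertex \<open>u\<close> by a clone of a vertex \<open>v\<close> not adjacent to it)
  does not decrease the number of copies of \<open>K\<^sub>s\<^sub>,\<^sub>t\<close> for one of the two choices, because two
  non-adjacent vertices of a copy are twins in it. So the extremal graphs may be taken to be complete
  multipartite, and there the count is governed by
  \<open>\<Sum>\<^sub>i\<^sub>\<noteq>\<^sub>j x\<^sub>i\<^sup>s x\<^sub>j\<^sup>t \<le> max f\<close>,
  with a loss unless two parts cover almost everything. The critical points of \<open>f\<close> in
  \<open>(1/2, 1)\<close> are the zeros of a sparse polynomial, of which there is at most one by Rolle's theorem.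

  For stability, take a near-optimal graph that is close to a complete bipartite graph, with the cut
  chosen to minimise the number of wrong pairs. If some vertex has linearly many wrong pairs,
  attaching it correctly gains order \<open>n\<^bsup>s+t-1\<^esup>\<close> copies; otherwise correcting any single wrong
  pair gains order \<open>n\<^bsup>s+t-2\<^esup>\<close>. Hence the loss is linear in the number of wrong pairs. A graph far from
  every cut is symmetrised one vertex at a time: it changes by \<open>O(n)\<close> pairs per step, so it is
  eventually at an intermediate distance, where the local result already forces a loss of constant
  proportion.\<close>

subsection \<open>The function \<open>f\<^sub>s\<^sub>,\<^sub>t\<close> and its maximum\<close>

text \<open>The loss has to be measured against the exact maximum over the graphs of order n: the
  asymptotic bound M n^k is off by order n^(k-1), which would hide the loss of a single wrong pair.
  So every correction compares a graph with another graph on the same vertices, and the bound m in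
  the stability statements is any number that no such graph exceeds. Correcting a vertex pays
  because of two facts about the optimum \<alpha>. The derivatives \<open>deriv_L\<close> and
  \<open>deriv_R\<close> agree there, so both sides offer a vertex the same number of copies. And a
  vertex adjacent to both sides gets strictly less, while one adjacent to neither gets nothing of
  leading order. The strict inequality is immediate for s >= 2 and follows from stationarity for
  stars. Counts are of ordered pairs of sides for a relation on an arbitrary vertex set, multiplied
  by s! t! so that they can be compared with powers; graphs in the sense of the statement and the
  factor two for s = t return only at the end.\<close>

lemma Rolle_has_deriv:
  fixes g g' :: "real \<Rightarrow> real"
  assumes "a < b" "g a = g b" and D: "\<And>x. (g has_real_derivative g' x) (at x)"
  obtains z where "a < z" "z < b" "g' z = 0"
proof -
  have "continuous_on {a..b} g"
    using D by (intro DERIV_continuous_on[of _ g g']) (auto intro: has_field_derivative_at_within)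
  then obtain z where "a < z" "z < b" "DERIV g z :> 0"
    using Rolle[of a b g] assms real_differentiable_def by metis
  with D that show ?thesis by (metis DERIV_unique)
qed

text \<open>K_{s,t} and K_{t,s} are isomorphic, so s <= t costs nothing, and then s t >= 2 amounts
  to t >= 2 together with s >= 1.\<close>

locale biclique_params =
  fixes s t :: nat
  assumes s_pos: "1 \<le> s" and s_le_t: "s \<le> t" and t_ge2: "2 \<le> t"
begin

abbreviation f :: "real \<Rightarrow> real" where "f \<equiv> f_st s t"

text \<open>The two partial derivatives of \<open>a\<^sup>s b\<^sup>t + a\<^sup>t b\<^sup>s\<close> at \<open>b = 1 - a\<close>: the normalised numbers of copies
  through a vertex of either part. \<open>both_L\<close> is the same for a vertex adjacent to both parts, which
  lies in copies only if \<open>K\<^sub>s\<^sub>,\<^sub>t\<close> is a star.\<close>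

definition deriv_L :: "real \<Rightarrow> real" where
  "deriv_L a = real s * a ^ (s - 1) * (1 - a) ^ t + real t * a ^ (t - 1) * (1 - a) ^ s"

definition deriv_R :: "real \<Rightarrow> real" where
  "deriv_R a = real s * (1 - a) ^ (s - 1) * a ^ t + real t * (1 - a) ^ (t - 1) * a ^ s"

definition both_L :: "real \<Rightarrow> real" where
  "both_L a = (if s = 1 then a ^ t + (1 - a) ^ t else 0)"

text \<open>Without the factor \<open>1 / 2\<close> of \<^const>\<open>M_st\<close> for \<open>s = t\<close>, since below the copies are counted as
  ordered pairs of sides.\<close>

definition M :: real where "M = (SUP x\<in>{1/2..1}. f x)"

lemma deriv_R_mirror: "deriv_R (1 - a) = deriv_L a"
  by (simp add: deriv_L_def deriv_R_def)

lemma both_L_mirror: "both_L (1 - a) = both_L a"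
  by (simp add: both_L_def)

lemma f_mirror: "f (1 - x) = f x"
  by (simp add: f_st_def)

lemma continuous_f: "continuous_on S f"
  unfolding f_st_def by (intro continuous_intros)

lemma DERIV_f: "(f has_real_derivative (deriv_L x - deriv_R x)) (at x)"
  unfolding f_st_def deriv_L_def deriv_R_def
  by (auto intro!: derivative_eq_intros simp: algebra_simps)

text \<open>Up to a positive factor, the derivative of \<open>f\<close> at \<open>x\<close> in terms of \<open>z = x / (1 - x)\<close>.\<close>

definition crit :: "real \<Rightarrow> real" where
  "crit z = real s + real t * z ^ (t - s) - real t * z - real s * z ^ (t - s + 1)"

lemma crit_of_deriv:
  assumes x: "1/2 < x" "x < 1" and eq: "deriv_L x = deriv_R x"
  shows "crit (x / (1 - x)) = 0"
proof -
  define z where "z = x / (1 - x)"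
  have xz: "x = z * (1 - x)" using x by (simp add: z_def)
  have z: "z > 0" using x by (simp add: z_def)
  define y where "y = 1 - x"
  have y: "y > 0" "1 - x = y" "x = z * y" using x xz by (auto simp: y_def)
  obtain s' where s': "s = Suc s'" using s_pos by (cases s) auto
  obtain d where d: "t = s + d" using s_le_t le_Suc_ex by blast
  \<comment> \<open>Substituting x = z y makes everything homogeneous of degree s + t - 1 in y;
    splitting off z^(s-1) leaves a polynomial with four terms.\<close>
  have "deriv_L x - deriv_R x = y ^ (s + t - 1) * z ^ (s - 1) * crit z"
    unfolding deriv_L_def deriv_R_def crit_def y(2) unfolding y(3)
    unfolding d unfolding s'
    by (simp add: power_add algebra_simps)
  with eq y(1) z show ?thesis by (simp flip: z_def)
qed

text \<open>Since \<open>crit 1 = 0\<close>, two zeros above \<open>1\<close> give by Rolle two zeros of the derivative and one of the second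
  derivative. But the second derivative changes sign only once, from plus to minus, and at \<open>1\<close> it is a
  multiple of the first.\<close>

lemma crit_at_most_one_zero:
  assumes "1 < p" "p < q" "crit p = 0" "crit q = 0"
  shows False
proof -
  define d where "d = t - s"
  have crit: "crit z = real s + real t * z ^ d - real t * z - real s * z ^ (d + 1)" for z
    by (simp add: crit_def d_def)
  show False
  proof (cases "d = 0")
    case True
    then have "t = s" using s_le_t by (simp add: d_def)
    then have "crit p = 2 * real s * (1 - p)" unfolding crit True by (simp add: algebra_simps)
    with assms(1,3) s_pos show False by simp
  next
    case False
    then obtain e where e: "d = Suc e" by (cases d) auto
    then have e': "d - Suc 0 = e" by simp
    define c1 where "c1 z = real t * (d * z ^ e) - real t - real s * ((d + 1) * z ^ d)" for z :: real
    define c2 where "c2 z = real t * (d * (e * z ^ (e - 1))) - real s * ((d + 1) * (d * z ^ e))" for z :: real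
    have D1: "(crit has_real_derivative c1 z) (at z)" for z
      unfolding crit c1_def by (auto intro!: derivative_eq_intros simp: e' algebra_simps) (simp add: e)
    have D2: "(c1 has_real_derivative c2 z) (at z)" for z
      unfolding c1_def c2_def by (auto intro!: derivative_eq_intros simp: e' algebra_simps)
    \<comment> \<open>Multiplying by z avoids the exponent e - 1, which is truncated at e = 0, and
      exhibits the only possible positive zero as that of a linear factor.\<close>
    have c2: "z * c2 z = d * z ^ e * (real t * e - real s * (d + 1) * z)" for z :: real
    proof -
      have eq: "real e * (z * z ^ (e - 1)) = real e * z ^ e" by (cases e) auto
      have "z * c2 z = real t * (d * (real e * (z * z ^ (e - 1)))) - real s * ((d + 1) * (d * (z * z ^ e)))"
        unfolding c2_def by (simp only: right_diff_distrib mult_ac)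
      then show ?thesis unfolding eq by (simp add: algebra_simps)
    qed
    have crit1: "crit 1 = 0" by (simp add: crit)
    obtain u where u: "1 < u" "u < p" "c1 u = 0"
      using Rolle_has_deriv[of 1 p crit c1] assms crit1 D1 by metis
    obtain v where v: "p < v" "v < q" "c1 v = 0"
      using Rolle_has_deriv[of p q crit c1] assms crit1 D1 by metis
    obtain w where w: "u < w" "w < v" "c2 w = 0"
      using Rolle_has_deriv[of u v c1 c2] u v D2 by (metis order.strict_trans)
    have weq: "real t * e = real s * (d + 1) * w"
    proof -
      have "d * w ^ e * (real t * e - real s * (d + 1) * w) = 0" using c2[of w] w by simp
      moreover have "d * w ^ e \<noteq> 0" using w u False by simp
      ultimately show ?thesis by auto
    qed
    have "c1 1 = real t * e - real s * (d + 1)" by (simp add: c1_def e algebra_simps)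
    also have "\<dots> = real s * (d + 1) * (w - 1)" unfolding weq by (simp add: algebra_simps)
    also have "\<dots> > 0" using s_pos w u by simp
    finally have c11: "c1 1 > 0" .
    \<comment> \<open>\<open>c1\<close> falls from a positive value at 1 to 0 at u, so
      \<open>c2\<close> is negative somewhere before u; but it is positive on all of (0, w), and u <
      w.\<close>
    obtain \<xi> where \<xi>: "1 < \<xi>" "\<xi> < u" "c1 u - c1 1 = (u - 1) * c2 \<xi>"
      using MVT2[of 1 u c1 c2] u D2 by auto
    have "c2 \<xi> < 0" using \<xi> c11 u by (smt (verit) mult_nonneg_nonneg)
    moreover have "\<xi> * c2 \<xi> = d * \<xi> ^ e * (real s * (d + 1) * (w - \<xi>))"
      using c2[of \<xi>] unfolding weq by (simp add: algebra_simps)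
    moreover have "d * \<xi> ^ e * (real s * (d + 1) * (w - \<xi>)) > 0"
      using s_pos w u \<xi> False by simp
    ultimately show False using \<xi> by (smt (verit) mult_pos_neg)
  qed
qed

section \<open>Uniqueness of the maximum and strictness near it\<close>

lemma f_one: "f 1 = 0" using s_pos t_ge2 by (simp add: f_st_def zero_power)

lemma f_half: "f (1/2) = 2 * (1/2) ^ (s + t)"
  by (simp add: f_st_def power_add)

lemma f_half_pos: "f (1/2) > 0" by (simp add: f_half)

lemma max_exists: "\<exists>\<alpha>\<in>{1/2..1}. f \<alpha> = M \<and> (\<forall>x\<in>{1/2..1}. f x \<le> M)"
proof -
  obtain \<alpha> where \<alpha>: "\<alpha> \<in> {1/2..1}" "\<forall>x\<in>{1/2..1}. f x \<le> f \<alpha>"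
    using continuous_attains_sup[of "{1/2..1::real}" f] continuous_f by auto
  have "M = f \<alpha>" unfolding M_def
    by (rule cSup_eq_maximum) (use \<alpha> in auto)
  with \<alpha> show ?thesis by auto
qed

definition \<alpha> :: real where "\<alpha> = (SOME a. a \<in> {1/2..1} \<and> f a = M)"

lemma \<alpha>: "\<alpha> \<in> {1/2..1}" "f \<alpha> = M"
  using someI_ex[of "\<lambda>a. a \<in> {1/2..1} \<and> f a = M"] max_exists unfolding \<alpha>_def by blast+

lemma f_le_M:
  assumes "0 \<le> x" "x \<le> 1"
  shows "f x \<le> M"
proof (cases "x \<ge> 1/2")
  case False
  then have "f (1 - x) \<le> M" using assms max_exists by auto
  then show ?thesis by (simp add: f_mirror)
qed (use assms max_exists in auto)

lemma M_ge: "M \<ge> 2 * (1/2) ^ (s + t)"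
  using f_le_M[of "1/2"] f_half by simp

lemma M_pos: "M > 0"
  using f_le_M[of "1/2"] f_half_pos by simp

lemma \<alpha>_less_1: "\<alpha> < 1"
  using \<alpha> M_pos f_one by (metis atLeastAtMost_iff less_eq_real_def less_irrefl)

lemma critical_of_max:
  assumes "0 < x" "x < 1" "f x = M"
  shows "deriv_L x = deriv_R x"
proof -
  have "deriv_L x - deriv_R x = 0"
  proof (rule DERIV_local_max[OF DERIV_f, of "min x (1 - x)"])
    show "\<forall>y. \<bar>x - y\<bar> < min x (1 - x) \<longrightarrow> f y \<le> f x"
      using f_le_M assms by (auto simp: abs_if split: if_splits)
  qed (use assms in auto)
  then show ?thesis by simp
qed

text \<open>The larger point is critical as an interior maximum, and Rolle gives a second critical
  point strictly between the two. The latter replaces x because x may be 1/2, where z = 1 is a zero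
  of \<open>crit\<close> anyway.\<close>

lemma argmax_unique_aux:
  assumes "1/2 \<le> x" "x < y" "y \<le> 1" "f x = M" "f y = M"
  shows False
proof -
  have y1: "y < 1" using assms f_one M_pos by (metis less_eq_real_def less_irrefl)
  obtain z where z: "x < z" "z < y" "deriv_L z = deriv_R z"
    using Rolle_has_deriv[of x y f "\<lambda>z. deriv_L z - deriv_R z"] assms DERIV_f by (metis eq_iff_diff_eq_0)
  have "crit (z / (1 - z)) = 0" using crit_of_deriv z assms y1 by auto
  moreover have "crit (y / (1 - y)) = 0"
    using crit_of_deriv critical_of_max assms y1 by auto
  moreover have "1 < z / (1 - z)" "z / (1 - z) < y / (1 - y)"
    using z assms y1 by (auto simp: field_simps)
  ultimately show False using crit_at_most_one_zero by blast
qed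

lemma argmax_unique:
  assumes "1/2 \<le> x" "x \<le> 1" "f x = M"
  shows "x = \<alpha>"
  using argmax_unique_aux[of x \<alpha>] argmax_unique_aux[of \<alpha> x] assms \<alpha> by force

text \<open>Compactness: away from \<alpha> the maximum over [1/2, 1] is strictly below M. The
  second alternative is the mirror image, since x may be the proportion of either side.\<close>

lemma near_argmax:
  assumes "\<eta> > 0"
  shows "\<exists>\<epsilon>>0. \<forall>x. 0 \<le> x \<and> x \<le> 1 \<and> f x \<ge> M - \<epsilon> \<longrightarrow> \<bar>x - \<alpha>\<bar> < \<eta> \<or> \<bar>1 - x - \<alpha>\<bar> < \<eta>"
proof -
  define C where "C = {1/2..1} \<inter> {x. \<bar>x - \<alpha>\<bar> \<ge> \<eta>}"
  have "closed {x. \<bar>x - \<alpha>\<bar> \<ge> \<eta>}" by (intro closed_Collect_le continuous_intros)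
  then have C: "compact C" unfolding C_def by (intro compact_Int_closed) auto
  obtain \<epsilon> where \<epsilon>: "\<epsilon> > 0" "\<forall>x\<in>C. f x < M - \<epsilon>"
  proof (cases "C = {}")
    case True
    then show ?thesis by (intro that[of 1]) auto
  next
    case False
    then obtain m where m: "m \<in> C" "\<forall>x\<in>C. f x \<le> f m"
      using continuous_attains_sup[OF C] continuous_f by blast
    have "f m < M" using m argmax_unique[of m] f_le_M[of m] assms by (force simp: C_def)
    with m show ?thesis by (intro that[of "(M - f m) / 2"]) (auto simp: field_simps intro: le_less_trans)
  qed
  have "\<bar>x - \<alpha>\<bar> < \<eta> \<or> \<bar>1 - x - \<alpha>\<bar> < \<eta>" if "0 \<le> x" "x \<le> 1" "f x \<ge> M - \<epsilon>" for x
  proof (cases "x \<ge> 1/2")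
    case True
    with \<epsilon> that have "x \<notin> C" by force
    with True that show ?thesis by (auto simp: C_def)
  next
    case False
    have "1 - x \<notin> C" using \<epsilon> that f_mirror[of x] by force
    with False that show ?thesis by (auto simp: C_def)
  qed
  with \<epsilon>(1) show ?thesis by blast
qed

text \<open>For s = 1 the difference is \<alpha>^(t-1) (t b - \<alpha>) with b = 1 - \<alpha>.
  Stationarity of f at \<alpha> equates it with b^(t-1) (t \<alpha> - b), which is positive as t >=
  2 and \<alpha> >= b.\<close>

lemma both_less_deriv: "both_L \<alpha> < deriv_L \<alpha>"
proof (cases "s = 1")
  case False
  have "deriv_L \<alpha> > 0" unfolding deriv_L_def
    using \<alpha>(1) \<alpha>_less_1 s_pos t_ge2 by (intro add_pos_pos mult_pos_pos) auto
  with False show ?thesis by (simp add: both_L_def)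
next
  case True
  define b where "b = 1 - \<alpha>"
  obtain r where r: "t = Suc (Suc r)" using t_ge2 by (metis Suc_le_D numeral_2_eq_2 Suc_le_mono)
  have ab: "b > 0" "\<alpha> \<ge> b" "\<alpha> > 0" using \<alpha>(1) \<alpha>_less_1 by (auto simp: b_def)
  have "deriv_L \<alpha> = deriv_R \<alpha>" using critical_of_max ab \<alpha> \<alpha>_less_1 by simp
  then have "\<alpha> ^ (t - 1) * (t * b - \<alpha>) = b ^ (t - 1) * (t * \<alpha> - b)"
    unfolding deriv_L_def deriv_R_def b_def[symmetric] unfolding True unfolding r by (simp add: algebra_simps)
  moreover have "t * \<alpha> - b > 0"
  proof -
    have "2 * \<alpha> \<le> t * \<alpha>" using t_ge2 ab by (intro mult_right_mono) auto
    with ab show ?thesis by linarith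
  qed
  ultimately have "\<alpha> ^ (t - 1) * (t * b - \<alpha>) > 0" using ab by simp
  then have "t * b - \<alpha> > 0" using ab by (simp add: zero_less_mult_iff)
  then have "\<alpha> ^ (t - 1) * \<alpha> < \<alpha> ^ (t - 1) * (t * b)" using ab by simp
  then show ?thesis unfolding both_L_def deriv_L_def b_def[symmetric] unfolding True unfolding r
    by (simp add: algebra_simps)
qed

text \<open>The relations between the derivatives and \<open>both_L\<close> at \<alpha> persist
  nearby by continuity. The bounds \<open>c\<^sub>0\<close> and \<open>a\<^sub>0\<close> come before
  \<eta>, so that \<eta> can later be taken small compared with them. Bounds for the left side only
  lose nothing, as x may be close to \<alpha> or to 1 - \<alpha>.\<close>

lemma stability_constants:
  obtains c\<^sub>0 a\<^sub>0 where "c\<^sub>0 > 0" "a\<^sub>0 > 0"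
    "\<And>\<eta>. \<eta> > 0 \<Longrightarrow> \<exists>\<epsilon>>0. \<forall>x. 0 \<le> x \<and> x \<le> 1 \<and> f x \<ge> M - \<epsilon> \<longrightarrow>
       \<bar>deriv_L x - deriv_R x\<bar> < \<eta> \<and> deriv_L x \<ge> c\<^sub>0 \<and> deriv_L x - both_L x \<ge> c\<^sub>0 \<and> a\<^sub>0 \<le> x \<and> a\<^sub>0 \<le> 1 - x"
proof
  \<comment> \<open>Half of the gap at \<alpha>, and below half of the smaller proportion, so that
    both survive in a neighbourhood.\<close>
  define c where "c = (deriv_L \<alpha> - both_L \<alpha>) / 2"
  define a where "a = (1 - \<alpha>) / 2"
  have b0: "both_L x \<ge> 0" if "0 \<le> x" "x \<le> 1" for x using that by (simp add: both_L_def)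
  show c: "c > 0" using both_less_deriv by (simp add: c_def)
  show a: "a > 0" using \<alpha>_less_1 by (simp add: a_def)
  have conts: "isCont deriv_L \<alpha>" "isCont deriv_R \<alpha>" "isCont both_L \<alpha>"
    unfolding deriv_L_def deriv_R_def both_L_def by (cases "s = 1"; simp)+
  have eq: "deriv_L \<alpha> = deriv_R \<alpha>" using critical_of_max \<alpha> \<alpha>_less_1 by simp
  fix \<eta> :: real assume \<eta>: "\<eta> > 0"
  have "((\<lambda>x. \<bar>deriv_L x - deriv_R x\<bar>) \<longlongrightarrow> \<bar>deriv_L \<alpha> - deriv_R \<alpha>\<bar>) (nhds \<alpha>)"
    "((\<lambda>x. deriv_L x - both_L x) \<longlongrightarrow> deriv_L \<alpha> - both_L \<alpha>) (nhds \<alpha>)"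
    "((\<lambda>x. deriv_R x - both_L x) \<longlongrightarrow> deriv_R \<alpha> - both_L \<alpha>) (nhds \<alpha>)"
    using conts unfolding isCont_def tendsto_at_iff_tendsto_nhds by (intro tendsto_intros; simp)+
  then have ev: "\<forall>\<^sub>F x in nhds \<alpha>. \<bar>deriv_L x - deriv_R x\<bar> < \<eta> \<and> deriv_L x - both_L x > c \<and> deriv_R x - both_L x > c"
    using both_less_deriv eq \<eta> c
    by (intro eventually_conj; elim order_tendstoD) (auto simp: c_def)
  then obtain e where e: "e > 0" "\<And>x. \<bar>x - \<alpha>\<bar> < e \<Longrightarrow>
      \<bar>deriv_L x - deriv_R x\<bar> < \<eta> \<and> deriv_L x - both_L x > c \<and> deriv_R x - both_L x > c"
    unfolding eventually_nhds_metric dist_real_def by blast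
  obtain \<epsilon> where \<epsilon>: "\<epsilon> > 0" "\<And>x. 0 \<le> x \<Longrightarrow> x \<le> 1 \<Longrightarrow> f x \<ge> M - \<epsilon> \<Longrightarrow> \<bar>x - \<alpha>\<bar> < min e a \<or> \<bar>1 - x - \<alpha>\<bar> < min e a"
    using near_argmax[of "min e a"] e(1) a by auto
  have "\<bar>deriv_L x - deriv_R x\<bar> < \<eta> \<and> deriv_L x \<ge> c \<and> deriv_L x - both_L x \<ge> c \<and> a \<le> x \<and> a \<le> 1 - x"
    if x: "0 \<le> x" "x \<le> 1" "f x \<ge> M - \<epsilon>" for x
  proof -
    have aa: "a \<le> \<alpha> - a" "a \<le> 1 - \<alpha> - a" using \<alpha>(1) by (simp_all add: a_def field_simps)
    from \<epsilon>(2)[OF x] show ?thesis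
    proof
      assume "\<bar>x - \<alpha>\<bar> < min e a"
      then show ?thesis using e(2)[of x] b0[OF x(1,2)] aa by (auto simp: abs_less_iff)
    next
      assume "\<bar>1 - x - \<alpha>\<bar> < min e a"
      then show ?thesis using e(2)[of "1 - x"] b0[OF x(1,2)] aa deriv_R_mirror[of x] deriv_R_mirror[of "1 - x"] both_L_mirror[of x]
        by (auto simp: abs_less_iff)
    qed
  qed
  with \<epsilon>(1) show "\<exists>\<epsilon>>0. \<forall>x. 0 \<le> x \<and> x \<le> 1 \<and> f x \<ge> M - \<epsilon> \<longrightarrow>
       \<bar>deriv_L x - deriv_R x\<bar> < \<eta> \<and> deriv_L x \<ge> c \<and> deriv_L x - both_L x \<ge> c \<and> a \<le> x \<and> a \<le> 1 - x"
    by blast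
qed

text \<open>The left-hand side counts, up to normalisation, the copies through a vertex adjacent to a proportion
  \<open>x\<close> of the first and \<open>y\<close> of the second part of a complete bipartite graph.\<close>

lemma vertex_type_bound:
  assumes "0 \<le> x" "x \<le> 1" "0 \<le> y" "y \<le> 1" "0 \<le> a" "a \<le> 1"
  shows "real s * (((1 - x) * a) ^ (s - 1) * (y * (1 - a)) ^ t + ((1 - y) * (1 - a)) ^ (s - 1) * (x * a) ^ t)
       + real t * (((1 - x) * a) ^ (t - 1) * (y * (1 - a)) ^ s + ((1 - y) * (1 - a)) ^ (t - 1) * (x * a) ^ s)
      \<le> (1 - x) * y * deriv_L a + x * (1 - y) * deriv_R a + x * y * both_L a"
proof -
  define b where "b = 1 - a"
  have b: "b \<ge> 0" using assms by (simp add: b_def)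
  have pw: "z ^ i \<le> z" if "0 \<le> z" "z \<le> 1" "i \<ge> 1" for z :: real and i
    using power_decreasing[of 1 i z] that by simp
  \<comment> \<open>All exponents involved are at least 1, so one factor u and one factor v are kept
    and the others dropped.\<close>
  have pp: "u ^ i * v ^ j \<le> u * v" if "0 \<le> u" "u \<le> 1" "i \<ge> 1" "0 \<le> v" "v \<le> 1" "j \<ge> 1" for u v :: real and i j
    using pw that by (intro mult_mono) auto
  have T: "((1 - x) * a) ^ (t - 1) * (y * b) ^ s \<le> (1 - x) * y * (a ^ (t - 1) * b ^ s)"
    "((1 - y) * b) ^ (t - 1) * (x * a) ^ s \<le> x * (1 - y) * (b ^ (t - 1) * a ^ s)"
    using mult_right_mono[OF pp[of "1 - x" "t - 1" y s], of "a ^ (t - 1) * b ^ s"]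
      mult_right_mono[OF pp[of "1 - y" "t - 1" x s], of "b ^ (t - 1) * a ^ s"] assms b s_pos t_ge2
    by (simp_all add: power_mult_distrib mult_ac)
  show ?thesis
  proof (cases "s = 1")
    case True
    \<comment> \<open>Stars centred at the vertex put no condition on its non-neighbours, so only a
      factor y (or x) remains. Writing y as (1 - x) y + x y, the second summand is what
      \<open>both_L\<close> accounts for.\<close>
    have "(y * b) ^ t \<le> y * b ^ t" "(x * a) ^ t \<le> x * a ^ t"
      using mult_right_mono[OF pw[of y t], of "b ^ t"] mult_right_mono[OF pw[of x t], of "a ^ t"] assms b t_ge2
      by (simp_all add: power_mult_distrib)
    moreover have "real t * (((1 - x) * a) ^ (t - 1) * (y * b) ^ s + ((1 - y) * b) ^ (t - 1) * (x * a) ^ s)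
      \<le> real t * ((1 - x) * y * (a ^ (t - 1) * b ^ s) + x * (1 - y) * (b ^ (t - 1) * a ^ s))"
      using T by (intro mult_left_mono add_mono) auto
    ultimately show ?thesis
      unfolding deriv_L_def deriv_R_def both_L_def b_def[symmetric] using True
      by (simp add: algebra_simps)
  next
    case False
    then have s2: "s - 1 \<ge> 1" using s_pos by simp
    have S: "((1 - x) * a) ^ (s - 1) * (y * b) ^ t \<le> (1 - x) * y * (a ^ (s - 1) * b ^ t)"
      "((1 - y) * b) ^ (s - 1) * (x * a) ^ t \<le> x * (1 - y) * (b ^ (s - 1) * a ^ t)"
      using mult_right_mono[OF pp[of "1 - x" "s - 1" y t], of "a ^ (s - 1) * b ^ t"]
        mult_right_mono[OF pp[of "1 - y" "s - 1" x t], of "b ^ (s - 1) * a ^ t"] assms b s2 t_ge2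
      by (simp_all add: power_mult_distrib mult_ac)
    have "real s * (((1 - x) * a) ^ (s - 1) * (y * b) ^ t + ((1 - y) * b) ^ (s - 1) * (x * a) ^ t)
       + real t * (((1 - x) * a) ^ (t - 1) * (y * b) ^ s + ((1 - y) * b) ^ (t - 1) * (x * a) ^ s)
      \<le> real s * ((1 - x) * y * (a ^ (s - 1) * b ^ t) + x * (1 - y) * (b ^ (s - 1) * a ^ t))
       + real t * ((1 - x) * y * (a ^ (t - 1) * b ^ s) + x * (1 - y) * (b ^ (t - 1) * a ^ s))"
      using S T by (intro mult_left_mono add_mono) auto
    then show ?thesis
      unfolding deriv_L_def deriv_R_def both_L_def b_def[symmetric] using False
      by (simp add: algebra_simps)
  qed
qed

end

subsection \<open>An inequality for complete multipartite graphs\<close>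

context biclique_params
begin

text \<open>The limit of the normalised number of copies when the parts have proportions x_i; with
  two parts of total 1 it is f.\<close>

definition pair_sum :: "('i \<Rightarrow> real) \<Rightarrow> 'i set \<Rightarrow> real" where
  "pair_sum x P = (\<Sum>i\<in>P. \<Sum>j\<in>P - {i}. x i ^ s * x j ^ t)"

text \<open>Each x_i^(m-2) is at most the same power of the total. This allows replacing all parts
  but one by a single part of the same total size.\<close>

lemma power_sum_ge:
  fixes x :: "'i \<Rightarrow> real"
  assumes P: "finite P" "\<And>i. i \<in> P \<Longrightarrow> 0 \<le> x i" and m: "m \<ge> 2"
  shows "(\<Sum>i\<in>P. x i) * (\<Sum>i\<in>P. x i ^ (m - 1)) \<le> (\<Sum>i\<in>P. x i) ^ m"
proof -
  obtain r where r: "m = Suc (Suc r)" using m by (metis Suc_le_D numeral_2_eq_2 Suc_le_mono)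
  have "(\<Sum>i\<in>P. x i ^ (m - 1)) \<le> (\<Sum>i\<in>P. x i * (\<Sum>i\<in>P. x i) ^ (m - 2))"
  proof (intro sum_mono)
    fix i assume i: "i \<in> P"
    have "x i \<le> (\<Sum>i\<in>P. x i)" using P i by (intro member_le_sum) auto
    moreover have "x i ^ (m - 1) = x i * x i ^ (m - 2)" by (simp add: r)
    ultimately show "x i ^ (m - 1) \<le> x i * (\<Sum>i\<in>P. x i) ^ (m - 2)"
      using P i by (auto intro!: mult_left_mono power_mono)
  qed
  also have "\<dots> = (\<Sum>i\<in>P. x i) ^ (m - 1)"
    by (simp add: r flip: sum_distrib_right)
  finally have "(\<Sum>i\<in>P. x i) * (\<Sum>i\<in>P. x i ^ (m - 1)) \<le> (\<Sum>i\<in>P. x i) * (\<Sum>i\<in>P. x i) ^ (m - 1)"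
    using P by (intro mult_left_mono sum_nonneg) auto
  also have "\<dots> = (\<Sum>i\<in>P. x i) ^ m" by (simp add: r)
  finally show ?thesis .
qed

text \<open>The left-hand side is at most the weighted average \<open>\<Sum> x\<^sub>i f(x\<^sub>i)\<close>. Termwise this comes down to
  \<open>a b \<le> a\<^sup>2 (1 - a) + b\<^sup>2 (1 - b)\<close> for \<open>a + b \<le> 1\<close>.\<close>

lemma pair_sum_le_s2:
  fixes x :: "'i \<Rightarrow> real"
  assumes s2: "s \<ge> 2" and P: "finite P" "\<And>i. i \<in> P \<Longrightarrow> 0 \<le> x i" "(\<Sum>i\<in>P. x i) = 1"
    and \<eta>: "0 \<le> \<eta>" "\<And>i j. i \<in> P \<Longrightarrow> j \<in> P \<Longrightarrow> i \<noteq> j \<Longrightarrow> x i + x j \<le> 1 - \<eta>"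
  shows "pair_sum x P * (1 + \<eta>) \<le> M"
proof -
  have x1: "x i \<le> 1" if "i \<in> P" for i
    using member_le_sum[of i P x] P that by auto
  have rest: "(\<Sum>j\<in>P - {i}. x j) = 1 - x i" if "i \<in> P" for i
    using P that by (simp add: sum_diff1)
  have "pair_sum x P * (1 + \<eta>) = (\<Sum>i\<in>P. \<Sum>j\<in>P - {i}. x i ^ s * x j ^ t * (1 + \<eta>))"
    by (simp add: pair_sum_def sum_distrib_right)
  also have "\<dots> \<le> (\<Sum>i\<in>P. \<Sum>j\<in>P - {i}. x i ^ (s - 1) * x j ^ (t - 1) * ((x i)^2 * (1 - x i) + (x j)^2 * (1 - x j)))"
  proof (intro sum_mono)
    fix i j assume ij: "i \<in> P" "j \<in> P - {i}"
    define a b where "a = x i" and "b = x j"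
    have ab: "0 \<le> a" "0 \<le> b" "a + b \<le> 1 - \<eta>" using ij P \<eta> by (auto simp: a_def b_def)
    \<comment> \<open>The surplus of a^2 (1 - a) + b^2 (1 - b) over a b is exactly (1 - (a + b))
      (a^2 - a b + b^2).\<close>
    have "\<eta> * (a * b) \<le> (1 - (a + b)) * (a^2 - a * b + b^2)"
    proof (intro mult_mono)
      have "0 \<le> (a - b)^2" by simp
      then show "a * b \<le> a^2 - a * b + b^2" by (simp add: power2_eq_square algebra_simps)
    qed (use ab \<eta> in auto)
    then have "a * b * (1 + \<eta>) \<le> a^2 * (1 - a) + b^2 * (1 - b)"
      by (simp add: power2_eq_square algebra_simps)
    then have "a ^ (s - 1) * b ^ (t - 1) * (a * b * (1 + \<eta>)) \<le> a ^ (s - 1) * b ^ (t - 1) * (a^2 * (1 - a) + b^2 * (1 - b))"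
      using ab by (intro mult_left_mono) auto
    moreover have "a ^ s = a ^ (s - 1) * a" "b ^ t = b ^ (t - 1) * b"
      using s2 t_ge2 by (simp_all flip: power_Suc2)
    ultimately show "x i ^ s * x j ^ t * (1 + \<eta>) \<le>
        x i ^ (s - 1) * x j ^ (t - 1) * ((x i)^2 * (1 - x i) + (x j)^2 * (1 - x j))"
      by (simp add: a_def b_def mult_ac)
  qed
  also have "\<dots> = (\<Sum>i\<in>P. \<Sum>j\<in>P - {i}. x i ^ (s - 1) * x j ^ (t - 1) * ((x i)^2 * (1 - x i)))
     + (\<Sum>i\<in>P. \<Sum>j\<in>P - {i}. x i ^ (s - 1) * x j ^ (t - 1) * ((x j)^2 * (1 - x j)))"
    by (simp add: distrib_left sum.distrib)
  \<comment> \<open>Exchanging i and j collects both sums at the part whose square was split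
    off.\<close>
  also have "(\<Sum>i\<in>P. \<Sum>j\<in>P - {i}. x i ^ (s - 1) * x j ^ (t - 1) * ((x j)^2 * (1 - x j)))
     = (\<Sum>i\<in>P. \<Sum>j\<in>P - {i}. x j ^ (s - 1) * x i ^ (t - 1) * ((x i)^2 * (1 - x i)))"
    using P(1)
    by (subst (1 2) sum.Sigma) (auto intro!: sum.reindex_bij_witness[of _ prod.swap prod.swap])
  also have "(\<Sum>i\<in>P. \<Sum>j\<in>P - {i}. x i ^ (s - 1) * x j ^ (t - 1) * ((x i)^2 * (1 - x i))) + \<dots>
    = (\<Sum>i\<in>P. x i * (x i ^ s * ((\<Sum>j\<in>P - {i}. x j) * (\<Sum>j\<in>P - {i}. x j ^ (t - 1)))
           + x i ^ t * ((\<Sum>j\<in>P - {i}. x j) * (\<Sum>j\<in>P - {i}. x j ^ (s - 1)))))"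
  proof (rule trans[OF sum.distrib[symmetric]], rule sum.cong[OF refl])
    fix i assume i: "i \<in> P"
    have pow: "x i ^ s = x i ^ (s - 1) * x i" "x i ^ t = x i ^ (t - 1) * x i"
      using s2 t_ge2 by (simp_all flip: power_Suc2)
    have "(\<Sum>j\<in>P - {i}. x i ^ (s - 1) * x j ^ (t - 1) * ((x i)\<^sup>2 * (1 - x i)))
        = x i ^ (s - 1) * ((x i)\<^sup>2 * (1 - x i)) * (\<Sum>j\<in>P - {i}. x j ^ (t - 1))"
      by (simp add: sum_distrib_left mult_ac)
    moreover have "(\<Sum>j\<in>P - {i}. x j ^ (s - 1) * x i ^ (t - 1) * ((x i)\<^sup>2 * (1 - x i)))
        = x i ^ (t - 1) * ((x i)\<^sup>2 * (1 - x i)) * (\<Sum>j\<in>P - {i}. x j ^ (s - 1))"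
      by (simp add: sum_distrib_left mult_ac)
    ultimately show "(\<Sum>j\<in>P - {i}. x i ^ (s - 1) * x j ^ (t - 1) * ((x i)\<^sup>2 * (1 - x i))) +
         (\<Sum>j\<in>P - {i}. x j ^ (s - 1) * x i ^ (t - 1) * ((x i)\<^sup>2 * (1 - x i))) =
         x i * (x i ^ s * ((\<Sum>j\<in>P - {i}. x j) * (\<Sum>j\<in>P - {i}. x j ^ (t - 1)))
           + x i ^ t * ((\<Sum>j\<in>P - {i}. x j) * (\<Sum>j\<in>P - {i}. x j ^ (s - 1))))"
      unfolding rest[OF i] pow by (simp only: power2_eq_square distrib_left mult_ac)
  qed
  \<comment> \<open>The bound with exponent s requires s >= 2: for s = 1 the sum of x_j^(s-1) would
    count the parts. Hence the separate argument for stars.\<close>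
  also have "\<dots> \<le> (\<Sum>i\<in>P. x i * (x i ^ s * (1 - x i) ^ t + x i ^ t * (1 - x i) ^ s))"
  proof (intro sum_mono)
    fix i assume i: "i \<in> P"
    show "x i * (x i ^ s * ((\<Sum>j\<in>P - {i}. x j) * (\<Sum>j\<in>P - {i}. x j ^ (t - 1)))
           + x i ^ t * ((\<Sum>j\<in>P - {i}. x j) * (\<Sum>j\<in>P - {i}. x j ^ (s - 1))))
       \<le> x i * (x i ^ s * (1 - x i) ^ t + x i ^ t * (1 - x i) ^ s)"
      using power_sum_ge[of "P - {i}" x t] power_sum_ge[of "P - {i}" x s] P i s2 t_ge2
      unfolding rest[OF i] by (intro mult_left_mono add_mono) auto
  qed
  also have "\<dots> = (\<Sum>i\<in>P. x i * f (x i))" by (simp add: f_st_def)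
  also have "\<dots> \<le> (\<Sum>i\<in>P. x i * M)"
    using P x1 f_le_M by (intro sum_mono mult_left_mono) auto
  also have "\<dots> = M" using P(3) by (simp flip: sum_distrib_right)
  finally show ?thesis .
qed

text \<open>A quantitative form of the monotonicity of y^(t-1) (1 - y) on [0, 1/2]. With t = r + 2
  the powers of degree r are bounded by u^r, and y (1 - y) + (u - y)^2 = u (1 - u) - (u - y) (1 - 2
  u).\<close>

lemma power_step_ge:
  assumes "0 \<le> y" "y \<le> u" "u \<le> 1/2"
  shows "y ^ (t - 1) * (1 - y) + (u - y) ^ t \<le> u ^ (t - 1) * (1 - u :: real)"
proof -
  obtain r where r: "t = Suc (Suc r)" using t_ge2 by (metis Suc_le_D numeral_2_eq_2 Suc_le_mono)
  have "y ^ r \<le> u ^ r" "(u - y) ^ r \<le> u ^ r" using assms by (auto intro: power_mono)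
  then have "y ^ r * (y * (1 - y)) + (u - y) ^ r * (u - y)^2 \<le> u ^ r * (y * (1 - y)) + u ^ r * (u - y)^2"
    using assms by (intro add_mono mult_right_mono) auto
  also have "\<dots> = u ^ r * (u * (1 - u)) - u ^ r * ((u - y) * (1 - 2 * u))"
    by (simp add: power2_eq_square algebra_simps)
  also have "\<dots> \<le> u ^ r * (u * (1 - u))" using assms by simp
  finally show ?thesis by (simp add: r power2_eq_square mult_ac)
qed

text \<open>For stars the sum is \<open>\<Sum> x\<^sub>i \<psi>(x\<^sub>i)\<close> with \<open>\<psi>(y) = y\<^bsup>t-1\<^esup> (1 - y)\<close> increasing on \<open>[0, 1/2]\<close>, and the parts other than
  the largest have size at most \<open>1 - b\<close>.\<close>

lemma pair_sum_le_s1: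
  fixes x :: "'i \<Rightarrow> real"
  assumes s1: "s = 1" and P: "finite P" "\<And>i. i \<in> P \<Longrightarrow> 0 \<le> x i" "(\<Sum>i\<in>P. x i) = 1"
    and \<eta>: "0 \<le> \<eta>" "\<eta> \<le> 1" "\<And>i j. i \<in> P \<Longrightarrow> j \<in> P \<Longrightarrow> i \<noteq> j \<Longrightarrow> x i + x j \<le> 1 - \<eta>"
  shows "pair_sum x P \<le> M - (\<eta> / 2) ^ (t + 1)"
proof -
  define \<psi> where "\<psi> y = y ^ (t - 1) * (1 - y)" for y :: real
  have \<psi>: "\<psi> y \<le> \<psi> u - (u - y) ^ t" if "0 \<le> y" "y \<le> u" "u \<le> 1/2" for y u
    using power_step_ge[of y u] that by (simp add: \<psi>_def)
  have rest: "(\<Sum>j\<in>P - {i}. x j) = 1 - x i" if "i \<in> P" for i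
    using P that by (simp add: sum_diff1)
  have "pair_sum x P = (\<Sum>i\<in>P. \<Sum>j\<in>P - {i}. x i ^ t * x j)"
    unfolding pair_sum_def using P(1) s1
    by (subst (1 2) sum.Sigma) (auto intro!: sum.reindex_bij_witness[of _ prod.swap prod.swap])
  also have "\<dots> = (\<Sum>i\<in>P. x i * \<psi> (x i))"
  proof (rule sum.cong[OF refl])
    fix i assume i: "i \<in> P"
    have "x i ^ t = x i * x i ^ (t - 1)" using t_ge2 by (simp flip: power_Suc)
    then show "(\<Sum>j\<in>P - {i}. x i ^ t * x j) = x i * \<psi> (x i)"
      by (simp add: rest[OF i] \<psi>_def flip: sum_distrib_left)
  qed
  finally have F: "pair_sum x P = (\<Sum>i\<in>P. x i * \<psi> (x i))" .
  have "P \<noteq> {}" using P(3) by auto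
  then obtain m where m: "m \<in> P" "\<And>i. i \<in> P \<Longrightarrow> x i \<le> x m"
    using obtains_MAX[OF P(1), of x] P(1) by (metis Max_ge finite_imageI imageI)
  define b where "b = x m"
  have b: "0 \<le> b" "b \<le> 1" using P m member_le_sum[of m P x] by (auto simp: b_def)
  have Fm: "pair_sum x P = b * \<psi> b + (\<Sum>i\<in>P - {m}. x i * \<psi> (x i))"
    using F P(1) m(1) by (simp add: b_def sum.remove)
  have eh: "(\<eta> / 2) ^ t \<le> (1/2) ^ t" using \<eta> by (intro power_mono) auto
  have f1: "f z = z * (1 - z) ^ t + z ^ t * (1 - z)" for z by (simp add: f_st_def s1)
  have fh: "\<psi> (1/2) \<le> M"
  proof -
    have "\<psi> (1/2) = (1/2) ^ t" using t_ge2 by (cases t) (auto simp: \<psi>_def)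
    with M_ge s1 show ?thesis by simp
  qed
  show ?thesis
  proof (cases "b \<ge> 1/2")
    case False
    \<comment> \<open>All parts are below 1/2, so each is compared with 1/2, where \<psi> is at most
      M. The parts other than the largest have total more than 1/2, and each is at most 1/2 -
      \<eta>/2 as it is not larger than the part m; this gives the loss.\<close>
    have "(\<Sum>i\<in>P - {m}. x i * \<psi> (x i)) \<le> (\<Sum>i\<in>P - {m}. x i * (\<psi> (1/2) - (\<eta> / 2) ^ t))"
    proof (intro sum_mono mult_left_mono)
      fix i assume i: "i \<in> P - {m}"
      then have "x i \<le> 1/2 - \<eta>/2" using \<eta>(3)[of i m] m by (force simp: field_simps)
      moreover have "0 \<le> x i" using P i by auto
      moreover have "(\<eta> / 2) ^ t \<le> (1/2 - x i) ^ t" using calculation \<eta> by (intro power_mono) auto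
      ultimately show "\<psi> (x i) \<le> \<psi> (1/2) - (\<eta> / 2) ^ t" using \<psi>[of "x i" "1/2"] \<eta> by simp
    qed (use P in auto)
    also have "\<dots> = (1 - b) * (\<psi> (1/2) - (\<eta> / 2) ^ t)"
      using rest[OF m(1)] by (simp add: b_def flip: sum_distrib_right)
    finally have "pair_sum x P \<le> b * \<psi> b + (1 - b) * (\<psi> (1/2) - (\<eta> / 2) ^ t)" using Fm by simp
    also have "b * \<psi> b \<le> b * \<psi> (1/2)"
    proof (rule mult_left_mono[OF _ b(1)])
      have "0 \<le> (1/2 - b) ^ t" using False by (intro zero_le_power) simp
      then show "\<psi> b \<le> \<psi> (1/2)" using \<psi>[of b "1/2"] b False by linarith
    qed
    also have "b * \<psi> (1/2) + (1 - b) * (\<psi> (1/2) - (\<eta> / 2) ^ t) = \<psi> (1/2) - (1 - b) * (\<eta> / 2) ^ t"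
      by (simp add: algebra_simps)
    also have "\<dots> \<le> M - (\<eta> / 2) * (\<eta> / 2) ^ t"
      using False \<eta> fh by (intro diff_mono mult_right_mono) auto
    finally show ?thesis by simp
  next
    case True
    show ?thesis
    proof (cases "P = {m}")
      case True
      then have "b = 1" using P(3) by (simp add: b_def)
      \<comment> \<open>A single part contains no copies, and the claim reduces to M being at least
        (1/2)^(t+1).\<close>
      then have "pair_sum x P = 0" using Fm True by (simp add: \<psi>_def)
      moreover have "(\<eta> / 2) ^ (t + 1) \<le> (1/2) ^ (t + 1)" using \<eta> by (intro power_mono) auto
      moreover have "2 * (1/2 :: real) ^ (s + t) = (1/2) ^ t" using s1 by simp
      then have "(1/2) ^ (t + 1) \<le> M" using M_ge M_pos by simp
      ultimately show ?thesis by linarith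
    next
      case False
      then obtain i where i: "i \<in> P" "i \<noteq> m" using m by auto
      \<comment> \<open>Any second part, however small, forces b <= 1 - \<eta>, so the loss is taken
        over a total of at least \<eta>.\<close>
      have b\<eta>: "\<eta> \<le> 1 - b" using \<eta>(3)[of i m] i m P(2)[of i] by (simp add: b_def)
      have "(\<Sum>i\<in>P - {m}. x i * \<psi> (x i)) \<le> (\<Sum>i\<in>P - {m}. x i * (\<psi> (1 - b) - \<eta> ^ t))"
      proof (intro sum_mono mult_left_mono)
        fix i assume i: "i \<in> P - {m}"
        then have "x i \<le> 1 - b - \<eta>" using \<eta>(3)[of i m] m by (auto simp: b_def)
        moreover have "0 \<le> x i" using P i by auto
        moreover have "\<eta> ^ t \<le> (1 - b - x i) ^ t" using calculation \<eta> by (intro power_mono) auto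
        ultimately show "\<psi> (x i) \<le> \<psi> (1 - b) - \<eta> ^ t" using \<psi>[of "x i" "1 - b"] \<eta> True by simp
      qed (use P in auto)
      also have "\<dots> = (1 - b) * (\<psi> (1 - b) - \<eta> ^ t)"
        using rest[OF m(1)] by (simp add: b_def flip: sum_distrib_right)
      finally have "pair_sum x P \<le> b * \<psi> b + (1 - b) * \<psi> (1 - b) - (1 - b) * \<eta> ^ t"
        using Fm by (simp add: algebra_simps)
      \<comment> \<open>Bounding the other parts by a single one of size 1 - b has left the two-part
        value.\<close>
      also have "b * \<psi> b + (1 - b) * \<psi> (1 - b) = f b"
      proof -
        have "z ^ t = z * z ^ (t - 1)" for z :: real using t_ge2 by (simp flip: power_Suc)
        then show ?thesis unfolding f1 \<psi>_def by (simp add: mult_ac)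
      qed
      also have "f b - (1 - b) * \<eta> ^ t \<le> M - \<eta> * \<eta> ^ t"
        using f_le_M[OF b] b\<eta> \<eta> by (intro diff_mono mult_right_mono) auto
      also have "\<eta> * \<eta> ^ t = \<eta> ^ (t + 1)" by simp
      also have "M - \<eta> ^ (t + 1) \<le> M - (\<eta> / 2) ^ (t + 1)"
        using \<eta> by (intro diff_left_mono power_mono) auto
      finally show ?thesis .
    qed
  qed
qed

lemma pair_sum_le:
  fixes x :: "'i \<Rightarrow> real"
  assumes P: "finite P" "\<And>i. i \<in> P \<Longrightarrow> 0 \<le> x i" "(\<Sum>i\<in>P. x i) = 1"
  shows "pair_sum x P \<le> M"
proof -
  have pairs: "x i + x j \<le> 1 - 0" if "i \<in> P" "j \<in> P" "i \<noteq> j" for i j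
    using sum_mono2[of P "{i, j}" x] P that by auto
  show ?thesis
  proof (cases "s = 1")
    case True
    then show ?thesis using pair_sum_le_s1[OF _ P _ _ pairs] by simp
  next
    case False
    then have "s \<ge> 2" using s_pos by simp
    then show ?thesis using pair_sum_le_s2[OF _ P _ pairs] by simp
  qed
qed

text \<open>The number of parts is unbounded, so compactness is not directly available; the loss
  comes from explicit estimates that depend only on \<eta>, s and t.\<close>

lemma pair_sum_gap:
  assumes \<eta>: "\<eta> > 0"
  shows "\<exists>\<epsilon>>0. \<forall>(P :: 'i set) x. finite P \<longrightarrow> (\<forall>i\<in>P. 0 \<le> x i) \<longrightarrow> (\<Sum>i\<in>P. x i) = 1
    \<longrightarrow> (\<forall>i\<in>P. \<forall>j\<in>P. i \<noteq> j \<longrightarrow> x i + x j \<le> 1 - \<eta>) \<longrightarrow> pair_sum x P \<le> M - \<epsilon>"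
proof -
  define \<theta> where "\<theta> = min \<eta> 1"
  have \<theta>: "0 < \<theta>" "\<theta> \<le> 1" "\<theta> \<le> \<eta>" using \<eta> by (auto simp: \<theta>_def)
  show ?thesis
  proof (cases "s = 1")
    case True
    show ?thesis
    proof (intro exI[of _ "(\<theta> / 2) ^ (t + 1)"] conjI allI impI)
      fix P :: "'i set" and x :: "'i \<Rightarrow> real"
      assume P: "finite P" "\<forall>i\<in>P. 0 \<le> x i" "(\<Sum>i\<in>P. x i) = 1"
        and gap: "\<forall>i\<in>P. \<forall>j\<in>P. i \<noteq> j \<longrightarrow> x i + x j \<le> 1 - \<eta>"
      have pairs: "x i + x j \<le> 1 - \<theta>" if "i \<in> P" "j \<in> P" "i \<noteq> j" for i j
        using gap that \<theta>(3) by fastforce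
      show "pair_sum x P \<le> M - (\<theta> / 2) ^ (t + 1)"
        using pair_sum_le_s1[OF True, of P x \<theta>] \<theta> P pairs by auto
    qed (use \<theta> in auto)
  next
    case False
    then have s2: "s \<ge> 2" using s_pos by simp
    show ?thesis
    proof (intro exI[of _ "M - M / (1 + \<theta>)"] conjI allI impI)
      fix P :: "'i set" and x :: "'i \<Rightarrow> real"
      assume P: "finite P" "\<forall>i\<in>P. 0 \<le> x i" "(\<Sum>i\<in>P. x i) = 1"
        and gap: "\<forall>i\<in>P. \<forall>j\<in>P. i \<noteq> j \<longrightarrow> x i + x j \<le> 1 - \<eta>"
      have pairs: "x i + x j \<le> 1 - \<theta>" if "i \<in> P" "j \<in> P" "i \<noteq> j" for i j
        using gap that \<theta>(3) by fastforce
      have "pair_sum x P * (1 + \<theta>) \<le> M"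
        using pair_sum_le_s2[OF s2, of P x \<theta>] \<theta> P pairs by auto
      then show "pair_sum x P \<le> M - (M - M / (1 + \<theta>))" using \<theta> by (simp add: field_simps)
    qed (use \<theta> M_pos in \<open>simp add: field_simps\<close>)
  qed
qed

end

subsection \<open>Counting induced complete bipartite subgraphs\<close>

definition size_pairs :: "nat \<Rightarrow> nat \<Rightarrow> 'a set \<Rightarrow> ('a set \<times> 'a set) set" where
  "size_pairs s t V = {(X, Y). X \<subseteq> V \<and> Y \<subseteq> V \<and> X \<inter> Y = {} \<and> card X = s \<and> card Y = t}"

text \<open>A copy is recorded with its sides as an ordered pair: once if s and t differ, twice if s
  = t. The relation is arbitrary outside V, and only later comes from a graph.\<close>

definition bicliques :: "nat \<Rightarrow> nat \<Rightarrow> ('a \<Rightarrow> 'a \<Rightarrow> bool) \<Rightarrow> 'a set \<Rightarrow> ('a set \<times> 'a set) set" where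
  "bicliques s t E V = {(X, Y) \<in> size_pairs s t V. \<forall>u\<in>X \<union> Y. \<forall>v\<in>X \<union> Y. E u v \<longleftrightarrow> (u \<in> X) \<noteq> (v \<in> X)}"

definition bicliques_at :: "nat \<Rightarrow> nat \<Rightarrow> ('a \<Rightarrow> 'a \<Rightarrow> bool) \<Rightarrow> 'a set \<Rightarrow> 'a set \<Rightarrow> ('a set \<times> 'a set) set" where
  "bicliques_at s t E V T = {(X, Y) \<in> bicliques s t E V. T \<subseteq> X \<union> Y}"

definition cut :: "'a set \<Rightarrow> 'a \<Rightarrow> 'a \<Rightarrow> bool" where
  "cut A u v \<longleftrightarrow> (u \<in> A) \<noteq> (v \<in> A)"

text \<open>Ordered pairs, so each wrong pair of a symmetric relation counts twice.\<close>

definition defects :: "('a \<Rightarrow> 'a \<Rightarrow> bool) \<Rightarrow> 'a set \<Rightarrow> 'a set \<Rightarrow> ('a \<times> 'a) set" where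
  "defects E A V = {(u, v) \<in> V \<times> V. E u v \<noteq> cut A u v}"

lemma symp_cut [simp]: "symp (cut A)" and irreflp_cut [simp]: "irreflp (cut A)"
  by (auto simp: cut_def symp_def irreflp_def)

lemma finite_size_pairs [simp]: "finite V \<Longrightarrow> finite (size_pairs s t V)"
  by (rule finite_subset[of _ "Pow V \<times> Pow V"]) (auto simp: size_pairs_def)

lemma bicliques_subset: "bicliques s t E V \<subseteq> size_pairs s t V"
  by (auto simp: bicliques_def)

lemma finite_bicliques [simp]: "finite V \<Longrightarrow> finite (bicliques s t E V)"
  by (rule finite_subset[OF bicliques_subset]) simp

lemma bicliques_at_subset: "bicliques_at s t E V T \<subseteq> bicliques s t E V"
  by (auto simp: bicliques_at_def)

lemma finite_bicliques_at [simp]: "finite V \<Longrightarrow> finite (bicliques_at s t E V T)"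
  by (rule finite_subset[OF bicliques_at_subset]) simp

lemma finite_defects [simp]: "finite V \<Longrightarrow> finite (defects E A V)"
  by (rule finite_subset[of _ "V \<times> V"]) (auto simp: defects_def)

lemma binomial_le_power: "n choose k \<le> n ^ k"
  by (cases "k \<le> n") (auto intro: binomial_le_pow simp: not_le binomial_eq_0)

text \<open>A pair of sides covering T is determined by its s + t - |T| other vertices and by which
  vertices of the union form the first side. The power of the order stands on the left to avoid
  division.\<close>

lemma card_size_pairs_containing:
  assumes "finite V"
  shows "card {(X, Y) \<in> size_pairs s t V. T \<subseteq> X \<union> Y} * card V ^ card T \<le> 2 ^ (s + t) * card V ^ (s + t)"
    (is "card ?Q * _ \<le> _")
proof (cases "?Q = {}")
  case False
  have TQ: "finite T \<and> card T \<le> s + t" if "(X, Y) \<in> ?Q" for X Y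
  proof -
    have "finite (X \<union> Y)" using that assms by (auto simp: size_pairs_def intro: finite_subset)
    moreover have "card (X \<union> Y) = s + t"
      using that calculation by (auto simp: size_pairs_def card_Un_disjoint)
    ultimately show ?thesis using that card_mono[of "X \<union> Y" T] by (auto intro: finite_subset)
  qed
  then have T: "finite T" "card T \<le> s + t" using False by auto
  define R where "R = {R. R \<subseteq> V \<and> card R = s + t - card T}"
  define g where "g = (\<lambda>(X, Y). (X \<union> Y - T, X :: 'a set))"
  have "inj_on g ?Q"
  proof (rule inj_onI, clarify)
    fix X Y X' Y' assume *: "(X, Y) \<in> size_pairs s t V" "T \<subseteq> X \<union> Y" "(X', Y') \<in> size_pairs s t V"
      "T \<subseteq> X' \<union> Y'" "g (X, Y) = g (X', Y')"
    then have "X = X'" "X \<union> Y = X' \<union> Y'" unfolding g_def by auto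
    with * show "X = X' \<and> Y = Y'" by (auto simp: size_pairs_def)
  qed
  moreover have "g ` ?Q \<subseteq> (SIGMA r:R. Pow (r \<union> T))"
  proof (rule image_subsetI)
    fix p assume "p \<in> ?Q"
    then obtain X Y where p: "p = (X, Y)" and XY: "(X, Y) \<in> size_pairs s t V" "T \<subseteq> X \<union> Y" by auto
    have "finite (X \<union> Y)" using XY assms by (auto simp: size_pairs_def intro: finite_subset)
    moreover have "card (X \<union> Y) = s + t"
      using XY calculation by (auto simp: size_pairs_def card_Un_disjoint)
    ultimately have "card (X \<union> Y - T) = s + t - card T" using XY T by (simp add: card_Diff_subset)
    with XY show "g p \<in> (SIGMA r:R. Pow (r \<union> T))" unfolding p
      by (auto simp: g_def R_def size_pairs_def)
  qed
  moreover have fR: "finite R" using assms by (simp add: R_def)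
  moreover have "finite (SIGMA r:R. Pow (r \<union> T))"
    using assms T fR by (intro finite_SigmaI) (auto simp: R_def intro: finite_subset)
  ultimately have "card ?Q \<le> card (SIGMA r:R. Pow (r \<union> T))"
    by (meson card_inj_on_le)
  also have "\<dots> = (\<Sum>r\<in>R. card (Pow (r \<union> T)))"
    using fR assms T by (intro card_SigmaI) (auto simp: R_def intro: finite_subset)
  also have "\<dots> \<le> (\<Sum>r\<in>R. 2 ^ (s + t))"
  proof (rule sum_mono)
    fix r assume r: "r \<in> R"
    then have "card (r \<union> T) \<le> s + t" using card_Un_le[of r T] T by (auto simp: R_def)
    moreover have "finite (r \<union> T)" using r assms T by (auto simp: R_def intro: finite_subset)
    ultimately show "card (Pow (r \<union> T)) \<le> 2 ^ (s + t)" by (simp add: card_Pow)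
  qed
  also have "\<dots> = (card V choose (s + t - card T)) * 2 ^ (s + t)"
    using n_subsets[OF assms] by (simp add: R_def)
  finally have "card ?Q * card V ^ card T \<le> (card V choose (s + t - card T)) * 2 ^ (s + t) * card V ^ card T"
    by simp
  also have "\<dots> \<le> card V ^ (s + t - card T) * 2 ^ (s + t) * card V ^ card T"
    by (intro mult_right_mono binomial_le_power) auto
  also have "\<dots> = 2 ^ (s + t) * card V ^ (s + t)" using T by (simp flip: power_add)
  finally show ?thesis .
next
  case True
  show ?thesis unfolding True by simp
qed

text \<open>A union bound. The index set will consist of wrong pairs or of their endpoints: copies
  spoiled by few of these are few.\<close>

lemma card_size_pairs_meeting:
  assumes "finite V" "finite I" "\<And>i. i \<in> I \<Longrightarrow> card (T i) = j"
    and "Q \<subseteq> {(X, Y) \<in> size_pairs s t V. \<exists>i\<in>I. T i \<subseteq> X \<union> Y}"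
  shows "card Q * card V ^ j \<le> card I * (2 ^ (s + t) * card V ^ (s + t))"
proof -
  have "Q \<subseteq> (\<Union>i\<in>I. {(X, Y) \<in> size_pairs s t V. T i \<subseteq> X \<union> Y})" using assms(4) by auto
  moreover have fin: "finite {(X, Y) \<in> size_pairs s t V. T i \<subseteq> X \<union> Y}" for i
    by (rule finite_subset[of _ "size_pairs s t V"]) (use assms in auto)
  ultimately have "card Q \<le> card (\<Union>i\<in>I. {(X, Y) \<in> size_pairs s t V. T i \<subseteq> X \<union> Y})"
    using assms by (intro card_mono) auto
  also have "\<dots> \<le> (\<Sum>i\<in>I. card {(X, Y) \<in> size_pairs s t V. T i \<subseteq> X \<union> Y})"
    using assms(2) by (rule card_UN_le)
  finally have "card Q * card V ^ j \<le> (\<Sum>i\<in>I. card {(X, Y) \<in> size_pairs s t V. T i \<subseteq> X \<union> Y} * card V ^ j)"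
    by (simp flip: sum_distrib_right)
  also have "\<dots> \<le> (\<Sum>i\<in>I. 2 ^ (s + t) * card V ^ (s + t))"
  proof (rule sum_mono)
    fix i assume "i \<in> I"
    from assms(3)[OF this] card_size_pairs_containing[OF assms(1), of s t "T i"]
    show "card {(X, Y) \<in> size_pairs s t V. T i \<subseteq> X \<union> Y} * card V ^ j \<le> 2 ^ (s + t) * card V ^ (s + t)"
      by simp
  qed
  finally show ?thesis by simp
qed

lemma card_bicliques_cut:
  assumes "finite V" "A \<subseteq> V" "s \<ge> 1" "t \<ge> 1"
  shows "card (bicliques s t (cut A) V) =
    (card A choose s) * (card (V - A) choose t) + (card (V - A) choose s) * (card A choose t)"
proof -
  define P where "P Z m = {X. X \<subseteq> Z \<and> card X = m}" for Z :: "'a set" and m :: nat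
  have P: "finite (P Z m)" "card (P Z m) = card Z choose m" if "Z \<subseteq> V" for Z m
    using finite_subset[OF that assms(1)] n_subsets[of Z m] by (auto simp: P_def)
  have ne: "X \<noteq> {}" if "X \<in> P Z s \<or> X \<in> P Z t" for X Z using that assms by (auto simp: P_def)
  have "bicliques s t (cut A) V = P A s \<times> P (V - A) t \<union> P (V - A) s \<times> P A t" (is "?l = ?r")
  proof
    show "?l \<subseteq> ?r"
    proof clarify
      fix X Y assume XY: "(X, Y) \<in> ?l" "\<not> (X \<in> P (V - A) s \<and> Y \<in> P A t)"
      then have *: "X \<subseteq> V" "Y \<subseteq> V" "X \<inter> Y = {}" "card X = s" "card Y = t"
        "\<And>u v. u \<in> X \<union> Y \<Longrightarrow> v \<in> X \<union> Y \<Longrightarrow> cut A u v \<longleftrightarrow> (u \<in> X) \<noteq> (v \<in> X)"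
        by (auto simp: bicliques_def size_pairs_def)
      obtain x y where xy: "x \<in> X" "y \<in> Y" using * assms by (metis card.empty ex_in_conv not_one_le_zero)
      have "x \<in> A" using *(6)[of x] xy XY(2) * unfolding cut_def P_def by blast
      then show "X \<in> P A s \<and> Y \<in> P (V - A) t"
        using *(6)[of x] xy * unfolding cut_def P_def by blast
    qed
    show "?r \<subseteq> ?l"
      using assms by (auto simp: bicliques_def size_pairs_def P_def cut_def)
  qed
  \<comment> \<open>The sides are nonempty, so a first side cannot lie both in A and in its
    complement.\<close>
  moreover have "(P A s \<times> P (V - A) t) \<inter> (P (V - A) s \<times> P A t) = {}"
    using ne by (auto simp: P_def) blast
  ultimately show ?thesis using P[of A] P[of "V - A"] assms
    by (simp add: card_Un_disjoint card_cartesian_product)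
qed

text \<open>Non-adjacency means lying in the same part, so each side of a copy lies within one part,
  and the two parts differ.\<close>

lemma card_bicliques_multipartite_le:
  assumes "finite V" "partition_on V P" "s \<ge> 1" "t \<ge> 1"
    and E: "\<And>u v. u \<in> V \<Longrightarrow> v \<in> V \<Longrightarrow> E u v \<longleftrightarrow> \<not> (\<exists>A\<in>P. u \<in> A \<and> v \<in> A)"
  shows "card (bicliques s t E V) \<le> (\<Sum>A\<in>P. \<Sum>B\<in>P - {A}. (card A choose s) * (card B choose t))"
proof -
  define S where "S Z m = {X. X \<subseteq> Z \<and> card X = m}" for Z :: "'a set" and m :: nat
  have finP: "finite P" using finite_elements[OF assms(1,2)] .
  have PV: "A \<subseteq> V" "finite A" if "A \<in> P" for A
    using that assms(1,2) by (auto simp: partition_on_def intro: finite_subset)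
  have S: "finite (S Z m)" "card (S Z m) = card Z choose m" if "Z \<in> P" for Z m
    using PV[OF that] n_subsets[of Z m] by (auto simp: S_def)
  have uniq: "A = B" if "A \<in> P" "B \<in> P" "u \<in> A" "u \<in> B" for A B u
    using that assms(2) by (auto simp: partition_on_def disjoint_def)
  have "bicliques s t E V \<subseteq> (\<Union>A\<in>P. \<Union>B\<in>P - {A}. S A s \<times> S B t)"
  proof clarify
    fix X Y assume "(X, Y) \<in> bicliques s t E V"
    then have *: "X \<subseteq> V" "Y \<subseteq> V" "X \<inter> Y = {}" "card X = s" "card Y = t"
      "\<And>u v. u \<in> X \<union> Y \<Longrightarrow> v \<in> X \<union> Y \<Longrightarrow> E u v \<longleftrightarrow> (u \<in> X) \<noteq> (v \<in> X)"
      by (auto simp: bicliques_def size_pairs_def)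
    obtain x y where xy: "x \<in> X" "y \<in> Y" using * assms by (metis card.empty ex_in_conv not_one_le_zero)
    obtain A B where AB: "A \<in> P" "x \<in> A" "B \<in> P" "y \<in> B"
      using xy * assms(2) unfolding partition_on_def by blast
    have XA: "X \<subseteq> A"
    proof
      fix z assume "z \<in> X"
      then have "\<not> E x z" using *(6)[of x z] xy \<open>z \<in> X\<close> by auto
      moreover have "x \<in> V" "z \<in> V" using xy \<open>z \<in> X\<close> * by auto
      ultimately obtain C where "C \<in> P" "x \<in> C" "z \<in> C" using E[of x z] by auto
      then show "z \<in> A" using uniq[of C A x] AB by auto
    qed
    have YB: "Y \<subseteq> B"
    proof
      fix z assume "z \<in> Y"
      then have "\<not> E y z" using *(3) *(6)[of y z] xy \<open>z \<in> Y\<close> by auto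
      moreover have "y \<in> V" "z \<in> V" using xy \<open>z \<in> Y\<close> * by auto
      ultimately obtain C where "C \<in> P" "y \<in> C" "z \<in> C" using E[of y z] by auto
      then show "z \<in> B" using uniq[of C B y] AB by auto
    qed
    have "E x y" using *(3) *(6)[of x y] xy by auto
    moreover have "x \<in> V" "y \<in> V" using xy * by auto
    ultimately have "A \<noteq> B" using E[of x y] AB by auto
    with AB XA YB * show "(X, Y) \<in> (\<Union>A\<in>P. \<Union>B\<in>P - {A}. S A s \<times> S B t)"
      by (intro UN_I[of A] UN_I[of B]) (simp_all add: S_def)
  qed
  then have "card (bicliques s t E V) \<le> card (\<Union>A\<in>P. \<Union>B\<in>P - {A}. S A s \<times> S B t)"
    using finP S by (intro card_mono) auto
  also have "\<dots> \<le> (\<Sum>A\<in>P. card (\<Union>B\<in>P - {A}. S A s \<times> S B t))" using finP by (rule card_UN_le)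
  also have "\<dots> \<le> (\<Sum>A\<in>P. \<Sum>B\<in>P - {A}. card (S A s \<times> S B t))"
    using finP by (intro sum_mono card_UN_le) auto
  also have "\<dots> = (\<Sum>A\<in>P. \<Sum>B\<in>P - {A}. (card A choose s) * (card B choose t))"
    using S by (intro sum.cong refl) (auto simp: card_cartesian_product)
  finally show ?thesis .
qed

text \<open>Every changed pair contains T, so a copy that does not cover T is a copy for both
  relations. It is applied with T a vertex or a pair.\<close>

lemma card_bicliques_change:
  assumes "finite V" "\<And>u v. u \<in> V \<Longrightarrow> v \<in> V \<Longrightarrow> E u v \<noteq> E' u v \<Longrightarrow> T \<subseteq> {u, v}"
  shows "card (bicliques s t E' V) + card (bicliques_at s t E V T)
       = card (bicliques s t E V) + card (bicliques_at s t E' V T)"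
proof -
  have split: "card (bicliques s t F V) = card (bicliques_at s t F V T) + card (bicliques s t F V - bicliques_at s t F V T)" for F
    using card_Un_disjoint[of "bicliques_at s t F V T" "bicliques s t F V - bicliques_at s t F V T"]
      bicliques_at_subset[of s t F V T] assms(1) by (simp add: Un_absorb1)
  have "(X, Y) \<in> bicliques s t E V \<longleftrightarrow> (X, Y) \<in> bicliques s t E' V" if "\<not> T \<subseteq> X \<union> Y" for X Y
  proof -
    have "E u v = E' u v" if "u \<in> X \<union> Y" "v \<in> X \<union> Y" "X \<subseteq> V" "Y \<subseteq> V" for u v
      using assms(2)[of u v] that \<open>\<not> T \<subseteq> X \<union> Y\<close> by blast
    then have "(\<forall>u\<in>X \<union> Y. \<forall>v\<in>X \<union> Y. E u v \<longleftrightarrow> (u \<in> X) \<noteq> (v \<in> X)) \<longleftrightarrow>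
      (\<forall>u\<in>X \<union> Y. \<forall>v\<in>X \<union> Y. E' u v \<longleftrightarrow> (u \<in> X) \<noteq> (v \<in> X))" if "X \<subseteq> V" "Y \<subseteq> V"
      using that by (intro ball_cong refl) simp
    then show ?thesis by (auto simp: bicliques_def size_pairs_def)
  qed
  then have "bicliques s t E V - bicliques_at s t E V T = bicliques s t E' V - bicliques_at s t E' V T"
    unfolding bicliques_at_def by blast
  with split[of E] split[of E'] show ?thesis by simp
qed

lemma card_partition_sum:
  assumes "finite V" "partition_on V P"
  shows "(\<Sum>A\<in>P. card A) = card V"
proof -
  have "\<And>A. A \<in> P \<Longrightarrow> finite A" using assms by (auto simp: partition_on_def intro: finite_subset)
  then show ?thesis
    using card_Union_disjoint[of P] assms by (auto simp: partition_on_def disjoint_def pairwise_def disjnt_def)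
qed

subsection \<open>Symmetrisation\<close>

definition twin :: "('a \<Rightarrow> 'a \<Rightarrow> bool) \<Rightarrow> 'a set \<Rightarrow> 'a \<Rightarrow> 'a \<Rightarrow> bool" where
  "twin E V x y \<longleftrightarrow> (\<forall>z\<in>V. E x z = E y z)"

text \<open>The secondary potential of the symmetrisation, for steps that keep the number of
  copies.\<close>

definition twin_pairs :: "('a \<Rightarrow> 'a \<Rightarrow> bool) \<Rightarrow> 'a set \<Rightarrow> ('a \<times> 'a) set" where
  "twin_pairs E V = {(x, y) \<in> V \<times> V. twin E V x y}"

lemma finite_twin_pairs [simp]: "finite V \<Longrightarrow> finite (twin_pairs E V)"
  by (rule finite_subset[of _ "V \<times> V"]) (auto simp: twin_pairs_def)

definition clone :: "'a \<Rightarrow> 'a \<Rightarrow> ('a \<Rightarrow> 'a \<Rightarrow> bool) \<Rightarrow> 'a \<Rightarrow> 'a \<Rightarrow> bool" where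
  "clone u v E x y = E (if x = u then v else x) (if y = u then v else y)"

lemma clone_symp: "symp E \<Longrightarrow> symp (clone u v E)"
  and clone_irreflp: "irreflp E \<Longrightarrow> irreflp (clone u v E)"
  and clone_other: "x \<noteq> u \<Longrightarrow> y \<noteq> u \<Longrightarrow> clone u v E x y = E x y"
  by (auto simp: clone_def symp_def irreflp_def)

definition bicliques_sep :: "nat \<Rightarrow> nat \<Rightarrow> ('a \<Rightarrow> 'a \<Rightarrow> bool) \<Rightarrow> 'a set \<Rightarrow> 'a \<Rightarrow> 'a \<Rightarrow> ('a set \<times> 'a set) set" where
  "bicliques_sep s t E V u v = {(X, Y) \<in> bicliques s t E V. u \<in> X \<union> Y \<and> v \<notin> X \<union> Y}"

lemma finite_bicliques_sep [simp]: "finite V \<Longrightarrow> finite (bicliques_sep s t E V u v)"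
  by (rule finite_subset[of _ "bicliques s t E V"]) (auto simp: bicliques_sep_def)

text \<open>Copies without u are unchanged. A copy with both u and v has them on the same side,
  since they are not adjacent, and survives. A copy with v but not u becomes one with u but not v
  when v is renamed to u. Only old copies with u but not v can be lost.\<close>

lemma card_bicliques_clone:
  assumes fin: "finite V" and uv: "u \<in> V" "v \<in> V" "u \<noteq> v" "\<not> E u v" and E: "symp E" "irreflp E"
  shows "card (bicliques s t E V) + card (bicliques_sep s t E V v u)
       \<le> card (bicliques s t (clone u v E) V) + card (bicliques_sep s t E V u v)"
proof -
  let ?E = "clone u v E"
  define Z where "Z F = {(X, Y) \<in> bicliques s t F V. u \<notin> X \<union> Y}" for F
  define W where "W F = {(X, Y) \<in> bicliques s t F V. u \<in> X \<union> Y \<and> v \<in> X \<union> Y}" for F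
  have fins: "finite (Z F)" "finite (W F)" for F
    by (rule finite_subset[of _ "bicliques s t F V"]; use fin in \<open>auto simp: Z_def W_def\<close>)+
  have split: "card (bicliques s t F V) = card (Z F) + (card (W F) + card (bicliques_sep s t F V u v))" for F
  proof -
    have "bicliques s t F V = Z F \<union> (W F \<union> bicliques_sep s t F V u v)"
      by (auto simp: Z_def W_def bicliques_sep_def)
    moreover have "card (Z F \<union> (W F \<union> bicliques_sep s t F V u v)) = card (Z F) + card (W F \<union> bicliques_sep s t F V u v)"
      using fins fin by (intro card_Un_disjoint finite_UnI finite_bicliques_sep) (auto simp: Z_def W_def bicliques_sep_def)
    moreover have "card (W F \<union> bicliques_sep s t F V u v) = card (W F) + card (bicliques_sep s t F V u v)"
      using fins fin by (intro card_Un_disjoint finite_bicliques_sep) (auto simp: W_def bicliques_sep_def)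
    ultimately show ?thesis by simp
  qed
  have nE: "\<not> E v u" "\<And>x. \<not> E x x" using uv E by (auto simp: symp_def irreflp_def)
  have "Z E = Z ?E"
  proof -
    have "(X, Y) \<in> bicliques s t E V \<longleftrightarrow> (X, Y) \<in> bicliques s t ?E V" if "u \<notin> X \<union> Y" for X Y
    proof -
      have "(\<forall>x\<in>X \<union> Y. \<forall>y\<in>X \<union> Y. E x y \<longleftrightarrow> (x \<in> X) \<noteq> (y \<in> X)) \<longleftrightarrow>
        (\<forall>x\<in>X \<union> Y. \<forall>y\<in>X \<union> Y. ?E x y \<longleftrightarrow> (x \<in> X) \<noteq> (y \<in> X))"
        using that by (intro ball_cong refl) (metis clone_other)
      then show ?thesis by (simp add: bicliques_def)
    qed
    then show ?thesis unfolding Z_def by blast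
  qed
  then have "card (Z E) = card (Z ?E)" by simp
  moreover have "W E \<subseteq> W ?E"
  proof clarify
    fix X Y assume XY: "(X, Y) \<in> W E"
    then have side: "u \<in> X \<longleftrightarrow> v \<in> X" and *: "\<forall>x\<in>X \<union> Y. \<forall>y\<in>X \<union> Y. E x y \<longleftrightarrow> (x \<in> X) \<noteq> (y \<in> X)"
      and uvS: "u \<in> X \<union> Y" "v \<in> X \<union> Y"
      using uv by (auto simp: W_def bicliques_def)
    have "?E x y \<longleftrightarrow> (x \<in> X) \<noteq> (y \<in> X)" if "x \<in> X \<union> Y" "y \<in> X \<union> Y" for x y
    proof -
      let ?r = "\<lambda>x. if x = u then v else x"
      have "?E x y \<longleftrightarrow> E (?r x) (?r y)" by (simp add: clone_def)
      also have "\<dots> \<longleftrightarrow> (?r x \<in> X) \<noteq> (?r y \<in> X)" 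
      proof -
        have "?r x \<in> X \<union> Y" "?r y \<in> X \<union> Y" using that uvS by auto
        with * show ?thesis by blast
      qed
      also have "\<dots> \<longleftrightarrow> (x \<in> X) \<noteq> (y \<in> X)" using side by auto
      finally show ?thesis .
    qed
    with XY show "(X, Y) \<in> W ?E" by (auto simp: W_def bicliques_def)
  qed
  then have "card (W E) \<le> card (W ?E)" using fins by (intro card_mono)
  moreover have "card (bicliques_sep s t E V v u) \<le> card (bicliques_sep s t ?E V u v)"
  proof -
    define r where "r x = (if x = v then u else x)" for x
    have inj: "inj_on r X" if "u \<notin> X" for X using that by (auto simp: r_def inj_on_def split: if_splits)
    define g where "g = (\<lambda>(X, Y). (r ` X, r ` Y))"
    show ?thesis
    proof (rule card_inj_on_le)
      show "inj_on g (bicliques_sep s t E V v u)"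
      proof (rule inj_onI, clarify)
        fix X Y X' Y' assume *: "(X, Y) \<in> bicliques_sep s t E V v u" "(X', Y') \<in> bicliques_sep s t E V v u"
          "g (X, Y) = g (X', Y')"
        have ni: "u \<notin> X \<union> X'" "u \<notin> Y \<union> Y'" using * by (auto simp: bicliques_sep_def)
        from * have "r ` X = r ` X'" "r ` Y = r ` Y'" by (auto simp: g_def)
        then show "X = X' \<and> Y = Y'"
          using inj_on_image_eq_iff[OF inj[OF ni(1)], of X X'] inj_on_image_eq_iff[OF inj[OF ni(2)], of Y Y'] by simp
      qed
      show "g ` bicliques_sep s t E V v u \<subseteq> bicliques_sep s t ?E V u v"
      proof (rule image_subsetI)
        fix p assume "p \<in> bicliques_sep s t E V v u"
        then obtain X Y where p: "p = (X, Y)" and "(X, Y) \<in> bicliques_sep s t E V v u" by (cases p) auto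
        then have *: "X \<subseteq> V" "Y \<subseteq> V" "X \<inter> Y = {}" "card X = s" "card Y = t"
          "\<And>x y. x \<in> X \<union> Y \<Longrightarrow> y \<in> X \<union> Y \<Longrightarrow> E x y \<longleftrightarrow> (x \<in> X) \<noteq> (y \<in> X)"
          "v \<in> X \<union> Y" "u \<notin> X" "u \<notin> Y"
          by (auto simp: bicliques_sep_def bicliques_def size_pairs_def)
        have rr: "?E (r x) (r y) = E x y" if "x \<in> X \<union> Y" "y \<in> X \<union> Y" for x y
          using that * by (auto simp: clone_def r_def)
        have inj': "inj_on r (X \<union> Y)" using * by (intro inj) simp
        have rX: "r x \<in> r ` X \<longleftrightarrow> x \<in> X" if "x \<in> X \<union> Y" for x
          using that inj' by (meson inj_on_image_mem_iff sup_ge1)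
        have "r ` X \<subseteq> V" "r ` Y \<subseteq> V" "u \<in> r ` X \<union> r ` Y" "v \<notin> r ` X \<union> r ` Y"
          using * uv by (auto simp: r_def)
        moreover have "r ` X \<inter> r ` Y = {}"
          using inj_on_image_Int[OF inj', of X Y] * by simp
        moreover have "card (r ` X) = s" "card (r ` Y) = t"
          using * inj by (simp_all add: card_image)
        moreover have "\<forall>x\<in>r ` X \<union> r ` Y. \<forall>y\<in>r ` X \<union> r ` Y. ?E x y \<longleftrightarrow> (x \<in> r ` X) \<noteq> (y \<in> r ` X)"
        proof (intro ballI)
          fix x y assume "x \<in> r ` X \<union> r ` Y" "y \<in> r ` X \<union> r ` Y"
          then obtain x' y' where xy: "x = r x'" "x' \<in> X \<union> Y" "y = r y'" "y' \<in> X \<union> Y" by blast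
          show "?E x y \<longleftrightarrow> (x \<in> r ` X) \<noteq> (y \<in> r ` X)"
            unfolding xy rr[OF xy(2,4)] rX[OF xy(2)] rX[OF xy(4)] by (rule *(6)[OF xy(2,4)])
        qed
        ultimately show "g p \<in> bicliques_sep s t ?E V u v" unfolding p
          by (simp add: g_def bicliques_sep_def bicliques_def size_pairs_def)
      qed
    qed (use fin in auto)
  qed
  ultimately show ?thesis using split[of E] split[of ?E] by linarith
qed

text \<open>With C denoting twin classes in E, the ordered twin pairs involving u number 2 |C u| - 1
  before and at least 2 |C v| + 1 after the cloning, since u joins the class of v. Pairs not
  involving u remain.\<close>

lemma card_twin_pairs_clone:
  assumes fin: "finite V" and uv: "u \<in> V" "v \<in> V" "u \<noteq> v"
    and nt: "\<not> twin E V u v"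
    and le: "card {y \<in> V. twin E V u y} \<le> card {y \<in> V. twin E V v y}"
  shows "card (twin_pairs E V) < card (twin_pairs (clone u v E) V)"
proof -
  define C where "C x = {y \<in> V. twin E V x y}" for x
  define off where "off = {(x, y) \<in> twin_pairs E V. x \<noteq> u \<and> y \<noteq> u}"
  have finC: "finite (C x)" for x using fin by (simp add: C_def)
  have finoff: "finite off" by (rule finite_subset[of _ "twin_pairs E V"]) (use fin in \<open>auto simp: off_def\<close>)
  have uC: "u \<in> C u" "u \<notin> C v" "v \<in> C v" using uv nt by (auto simp: C_def twin_def)
  have "twin_pairs E V = off \<union> ({u} \<times> C u \<union> (C u - {u}) \<times> {u})"
    using uv by (auto simp: off_def twin_pairs_def C_def twin_def)
  moreover have "card (off \<union> ({u} \<times> C u \<union> (C u - {u}) \<times> {u})) = card off + card ({u} \<times> C u \<union> (C u - {u}) \<times> {u})"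
    using finoff finC by (intro card_Un_disjoint) (auto simp: off_def)
  moreover have "card ({u} \<times> C u \<union> (C u - {u}) \<times> {u}) = card ({u} \<times> C u) + card ((C u - {u}) \<times> {u})"
    using finC by (intro card_Un_disjoint) auto
  ultimately have 1: "card (twin_pairs E V) = card off + (card (C u) + (card (C u) - 1))"
    using uC finC by (simp add: card_cartesian_product)
  have "off \<union> ({u} \<times> insert u (C v) \<union> C v \<times> {u}) \<subseteq> twin_pairs (clone u v E) V"
    using uv by (auto simp: off_def twin_pairs_def C_def twin_def clone_def)
  then have "card (off \<union> ({u} \<times> insert u (C v) \<union> C v \<times> {u})) \<le> card (twin_pairs (clone u v E) V)"
    using fin by (intro card_mono) auto
  moreover have "card (off \<union> ({u} \<times> insert u (C v) \<union> C v \<times> {u})) = card off + card ({u} \<times> insert u (C v) \<union> C v \<times> {u})"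
    using finoff finC by (intro card_Un_disjoint) (auto simp: off_def)
  moreover have "card ({u} \<times> insert u (C v) \<union> C v \<times> {u}) = card ({u} \<times> insert u (C v)) + card (C v \<times> {u})"
    using finC uC by (intro card_Un_disjoint) auto
  ultimately have 2: "card off + (card (C v) + 1 + card (C v)) \<le> card (twin_pairs (clone u v E) V)"
    using uC finC by (simp add: card_cartesian_product)
  show ?thesis using 1 2 le by (simp flip: C_def)
qed

text \<open>If the two directions of cloning give equally many copies, cloning into the larger twin class
  increases the number of twin pairs.\<close>

lemma zykov_step:
  assumes fin: "finite V" and E: "symp E" "irreflp E"
    and ex: "\<exists>u\<in>V. \<exists>v\<in>V. \<not> E u v \<and> \<not> twin E V u v"
  obtains E' u where "symp E'" "irreflp E'" "u \<in> V" "\<And>x y. x \<noteq> u \<Longrightarrow> y \<noteq> u \<Longrightarrow> E' x y = E x y"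
    "card (bicliques s t E V) \<le> card (bicliques s t E' V)"
    "card (bicliques s t E V) < card (bicliques s t E' V) \<or> card (twin_pairs E V) < card (twin_pairs E' V)"
proof -
  let ?sep = "\<lambda>u v. card (bicliques_sep s t E V u v)"
  let ?C = "\<lambda>u. card {y \<in> V. twin E V u y}"
  obtain a b where ab: "a \<in> V" "b \<in> V" "\<not> E a b" "\<not> twin E V a b" using ex by blast
  have ba: "\<not> E b a" "\<not> twin E V b a" using ab E by (auto simp: symp_def twin_def)
  obtain u v where uv: "u \<in> V" "v \<in> V" "\<not> E u v" "\<not> twin E V u v"
    "?sep u v < ?sep v u \<or> ?sep u v = ?sep v u \<and> ?C u \<le> ?C v"
  proof (cases "?sep a b < ?sep b a \<or> ?sep a b = ?sep b a \<and> ?C a \<le> ?C b")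
    case True
    with ab that[of a b] show ?thesis by blast
  next
    case False
    then have "?sep b a < ?sep a b \<or> ?sep b a = ?sep a b \<and> ?C b \<le> ?C a" by linarith
    with ab ba that[of b a] show ?thesis by blast
  qed
  have ne: "u \<noteq> v" using uv(4) by (auto simp: twin_def)
  have le: "card (bicliques s t E V) + ?sep v u \<le> card (bicliques s t (clone u v E) V) + ?sep u v"
    using card_bicliques_clone[OF fin uv(1,2) ne uv(3) E] .
  show ?thesis
  proof (rule that[of "clone u v E" u])
    show "card (bicliques s t E V) < card (bicliques s t (clone u v E) V) \<or>
        card (twin_pairs E V) < card (twin_pairs (clone u v E) V)"
      using uv(5) le card_twin_pairs_clone[OF fin uv(1,2) ne uv(4)] by linarith
    show "card (bicliques s t E V) \<le> card (bicliques s t (clone u v E) V)" using uv(5) le by linarith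
  qed (use E uv in \<open>auto simp: clone_symp clone_irreflp clone_other\<close>)
qed

subsection \<open>Correcting defects of a cut\<close>

definition fix_vertex :: "'a set \<Rightarrow> 'a \<Rightarrow> ('a \<Rightarrow> 'a \<Rightarrow> bool) \<Rightarrow> 'a \<Rightarrow> 'a \<Rightarrow> bool" where
  "fix_vertex A w E x y = (if x = w \<or> y = w then cut A x y else E x y)"

definition fix_edge :: "'a set \<Rightarrow> 'a \<Rightarrow> 'a \<Rightarrow> ('a \<Rightarrow> 'a \<Rightarrow> bool) \<Rightarrow> 'a \<Rightarrow> 'a \<Rightarrow> bool" where
  "fix_edge A u v E x y = (if {x, y} = {u, v} then cut A x y else E x y)"

lemma fix_vertex_symp: "symp E \<Longrightarrow> symp (fix_vertex A w E)"
  and fix_vertex_irreflp: "irreflp E \<Longrightarrow> irreflp (fix_vertex A w E)"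
  by (auto simp: fix_vertex_def symp_def irreflp_def cut_def)

lemma fix_edge_symp: "symp E \<Longrightarrow> symp (fix_edge A u v E)"
  and fix_edge_irreflp: "irreflp E \<Longrightarrow> irreflp (fix_edge A u v E)"
  by (auto simp: fix_edge_def symp_def irreflp_def cut_def insert_commute)

lemma card_defects_le:
  assumes "finite V" "finite Q" "\<And>x y. x \<in> V \<Longrightarrow> y \<in> V \<Longrightarrow> E x y \<noteq> E' x y \<Longrightarrow> (x, y) \<in> Q"
  shows "card (defects E A V) \<le> card (defects E' A V) + card Q"
proof -
  have "defects E A V \<subseteq> defects E' A V \<union> Q" using assms(3) by (auto simp: defects_def)
  then have "card (defects E A V) \<le> card (defects E' A V \<union> Q)"
    using assms by (intro card_mono) auto
  then show ?thesis using card_Un_le[of "defects E' A V" Q] by linarith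
qed

text \<open>There are at most 2 |V| ordered pairs at w. How the relations differ there is
  irrelevant, so this serves both for symmetrisation steps and for correcting a vertex.\<close>

lemma card_defects_star_le:
  assumes "finite V" "w \<in> V" "\<And>x y. x \<noteq> w \<Longrightarrow> y \<noteq> w \<Longrightarrow> E x y = E' x y"
  shows "card (defects E A V) \<le> card (defects E' A V) + 2 * card V"
proof -
  have "card ({w} \<times> V \<union> V \<times> {w}) \<le> 2 * card V"
    using card_Un_le[of "{w} \<times> V" "V \<times> {w}"] by (simp add: card_cartesian_product)
  then show ?thesis
    using card_defects_le[of V "{w} \<times> V \<union> V \<times> {w}" E E' A] assms by fastforce
qed

lemma card_defects_fix_edge_le:
  assumes "finite V"
  shows "card (defects E A' V) \<le> card (defects (fix_edge A u v E) A' V) + 2"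
proof -
  have "card {(u, v), (v, u)} \<le> 2" using card_insert_le_m1[of 2 "{(v, u)}" "(u, v)"] by simp
  moreover have q: "(x, y) \<in> {(u, v), (v, u)}" if "E x y \<noteq> fix_edge A u v E x y" for x y
  proof -
    have "{x, y} = {u, v}" by (rule ccontr) (use that in \<open>simp add: fix_edge_def\<close>)
    then show ?thesis by (simp add: doubleton_eq_iff)
  qed
  have "card (defects E A' V) \<le> card (defects (fix_edge A u v E) A' V) + card {(u, v), (v, u)}"
    by (rule card_defects_le[OF assms]) (simp, rule q)
  ultimately show ?thesis by linarith
qed

lemma defects_irrefl: "irreflp E \<Longrightarrow> p \<in> defects E A V \<Longrightarrow> fst p \<noteq> snd p"
  by (cases p) (auto simp: defects_def cut_def irreflp_def)

lemma defects_fix_vertex: "defects (fix_vertex A w E) A V = {p \<in> defects E A V. fst p \<noteq> w \<and> snd p \<noteq> w}"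
  by (auto simp: defects_def fix_vertex_def)

lemma defects_fix_edge: "defects (fix_edge A u v E) A V = defects E A V - {(u, v), (v, u)}"
  by (auto simp: defects_def fix_edge_def doubleton_eq_iff)

lemma defects_complement: "A \<subseteq> V \<Longrightarrow> defects E (V - A) V = defects E A V"
  by (auto simp: defects_def cut_def)

lemma bicliques_cong:
  assumes "\<And>x y. x \<in> V \<Longrightarrow> y \<in> V \<Longrightarrow> E x y = E' x y"
  shows "bicliques s t E V = bicliques s t E' V"
proof -
  have "(\<forall>u\<in>X \<union> Y. \<forall>v\<in>X \<union> Y. E u v \<longleftrightarrow> (u \<in> X) \<noteq> (v \<in> X)) \<longleftrightarrow>
    (\<forall>u\<in>X \<union> Y. \<forall>v\<in>X \<union> Y. E' u v \<longleftrightarrow> (u \<in> X) \<noteq> (v \<in> X))" if "X \<union> Y \<subseteq> V" for X Y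
    using that assms by (intro ball_cong refl) blast
  then show ?thesis unfolding bicliques_def size_pairs_def by auto
qed

lemma bicliques_cut_complement: "bicliques s t (cut (V - A)) V = bicliques s t (cut A) V"
  by (rule bicliques_cong) (auto simp: cut_def)

lemma bicliques_at_cut_complement: "bicliques_at s t (cut (V - A)) V T = bicliques_at s t (cut A) V T"
  by (simp add: bicliques_at_def bicliques_cut_complement)

section \<open>Copies through a prescribed vertex or pair\<close>

definition split_pairs :: "nat \<Rightarrow> nat \<Rightarrow> 'a set \<Rightarrow> 'a set \<Rightarrow> 'a set \<Rightarrow> ('a set \<times> 'a set) set" where
  "split_pairs s t A V T = {(X, Y) \<in> size_pairs s t V. X \<subseteq> A \<and> Y \<subseteq> V - A \<and> T \<subseteq> X \<union> Y}"

lemma split_pairs_subset: "split_pairs s t A V T \<subseteq> bicliques_at s t (cut A) V T"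
  by (auto simp: split_pairs_def bicliques_at_def bicliques_def cut_def)

lemma finite_split_pairs [simp]: "finite V \<Longrightarrow> finite (split_pairs s t A V T)"
  by (rule finite_subset[OF split_pairs_subset]) simp

text \<open>S and T are the prescribed vertices on the two sides; different completions give
  different copies, all with the first side in A.\<close>

lemma card_split_pairs_ge:
  assumes fin: "finite V" and A: "A \<subseteq> V" and S: "S \<subseteq> A" "card S \<le> s" and T: "T \<subseteq> V - A" "card T \<le> t"
  shows "((card A - card S) choose (s - card S)) * ((card (V - A) - card T) choose (t - card T))
    \<le> card (split_pairs s t A V (S \<union> T))"
proof -
  define P where "P Z m = {X. X \<subseteq> Z \<and> card X = m}" for Z :: "'a set" and m :: nat
  have fins: "finite A" "finite (V - A)" "finite S" "finite T"
    using fin A S T by (auto intro: finite_subset)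
  have cP: "card (P Z m) = card Z choose m" if "finite Z" for Z m
    using n_subsets[OF that] by (simp add: P_def)
  have "card (P (A - S) (s - card S) \<times> P (V - A - T) (t - card T)) \<le> card (split_pairs s t A V (S \<union> T))"
  proof (rule card_inj_on_le[of "\<lambda>(X, Y). (S \<union> X, T \<union> Y)"])
    show "inj_on (\<lambda>(X, Y). (S \<union> X, T \<union> Y)) (P (A - S) (s - card S) \<times> P (V - A - T) (t - card T))"
      by (rule inj_onI) (auto simp: P_def)
    show "(\<lambda>(X, Y). (S \<union> X, T \<union> Y)) ` (P (A - S) (s - card S) \<times> P (V - A - T) (t - card T))
      \<subseteq> split_pairs s t A V (S \<union> T)"
    proof (rule image_subsetI)
      fix p assume "p \<in> P (A - S) (s - card S) \<times> P (V - A - T) (t - card T)"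
      then obtain X Y where p: "p = (X, Y)" "X \<subseteq> A - S" "card X = s - card S" "Y \<subseteq> V - A - T" "card Y = t - card T"
        by (auto simp: P_def)
      have "finite X" "finite Y" using p fins by (auto intro: finite_subset)
      then have "card (S \<union> X) = s" "card (T \<union> Y) = t"
        using p fins S T by (subst card_Un_disjoint; auto)+
      then show "(case p of (X, Y) \<Rightarrow> (S \<union> X, T \<union> Y)) \<in> split_pairs s t A V (S \<union> T)"
        using p A S T by (auto simp: split_pairs_def size_pairs_def)
    qed
  qed (use fin in simp)
  then show ?thesis
    using fins S T by (simp add: card_cartesian_product cP card_Diff_subset)
qed

text \<open>The two orientations exclude each other because the first side is nonempty.\<close>

lemma card_bicliques_at_cut_ge:
  assumes fin: "finite V" and A: "A \<subseteq> V" and st: "1 \<le> s" "1 \<le> t"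
  shows "card (split_pairs s t A V T) + card (split_pairs s t (V - A) V T) \<le> card (bicliques_at s t (cut A) V T)"
proof -
  have "split_pairs s t A V T \<inter> split_pairs s t (V - A) V T = {}"
  proof -
    have "card X = 0" if "X \<subseteq> A" "X \<subseteq> V - A" for X
    proof -
      have "X = {}" using that by blast
      then show ?thesis by simp
    qed
    moreover have "X \<subseteq> A \<and> X \<subseteq> V - A \<and> card X = s"
      if "(X, Y) \<in> split_pairs s t A V T" "(X, Y) \<in> split_pairs s t (V - A) V T" for X Y
      using that by (simp add: split_pairs_def size_pairs_def)
    ultimately have "(X, Y) \<notin> split_pairs s t A V T \<inter> split_pairs s t (V - A) V T" for X Y
      using st(1) by (metis IntE not_one_le_zero)
    then show ?thesis by auto
  qed
  then have "card (split_pairs s t A V T) + card (split_pairs s t (V - A) V T)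
    = card (split_pairs s t A V T \<union> split_pairs s t (V - A) V T)"
    using fin by (simp add: card_Un_disjoint)
  also have "\<dots> \<le> card (bicliques_at s t (cut A) V T)"
    using fin split_pairs_subset[of s t A V T] split_pairs_subset[of s t "V - A" V T]
    by (intro card_mono) (auto simp: bicliques_at_cut_complement)
  finally show ?thesis .
qed

text \<open>Off w the copy follows the cut, so Y lies on one side of it and the rest of X on the
  other. Moreover Y consists of neighbours of w and X of non-neighbours. The two summands are the
  two possible sides of Y.\<close>

lemma card_bicliques_at_vertex_half:
  fixes E :: "'a \<Rightarrow> 'a \<Rightarrow> bool" and w :: 'a
  assumes fin: "finite V" and A: "A \<subseteq> V" and E: "symp E" "irreflp E" and st: "1 \<le> s" "1 \<le> t"
  defines "N \<equiv> {v \<in> V. E w v}"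
  shows "card {(X, Y) \<in> bicliques s t E V. w \<in> X \<and> (\<forall>u\<in>X \<union> Y - {w}. \<forall>v\<in>X \<union> Y - {w}. E u v = cut A u v)}
    \<le> (card (A - N) choose (s - 1)) * (card ((V - A) \<inter> N) choose t)
      + (card (V - A - N) choose (s - 1)) * (card (A \<inter> N) choose t)" (is "card ?Q \<le> _")
proof -
  define P where "P Z m = {X. X \<subseteq> Z \<and> card X = m}" for Z :: "'a set" and m :: nat
  have fins: "finite A" "finite (V - A)"
    using fin A by (auto intro: finite_subset)
  have cP: "card (P Z m) = card Z choose m" "finite (P Z m)" if "finite Z" for Z m
    using n_subsets[OF that] that by (simp_all add: P_def)
  have "card ?Q \<le> card (P (A - N) (s - 1) \<times> P ((V - A) \<inter> N) t \<union> P (V - A - N) (s - 1) \<times> P (A \<inter> N) t)"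
  proof (rule card_inj_on_le[of "\<lambda>(X, Y). (X - {w}, Y)"])
    show "inj_on (\<lambda>(X, Y). (X - {w}, Y)) ?Q" by (rule inj_onI) auto
    show "(\<lambda>(X, Y). (X - {w}, Y)) ` ?Q
      \<subseteq> P (A - N) (s - 1) \<times> P ((V - A) \<inter> N) t \<union> P (V - A - N) (s - 1) \<times> P (A \<inter> N) t"
    proof (rule image_subsetI)
      fix p assume "p \<in> ?Q"
      then obtain X Y where p: "p = (X, Y)" "X \<subseteq> V" "Y \<subseteq> V" "X \<inter> Y = {}" "card X = s" "card Y = t" "w \<in> X"
        and adj: "\<And>u v. u \<in> X \<union> Y \<Longrightarrow> v \<in> X \<union> Y \<Longrightarrow> E u v \<longleftrightarrow> (u \<in> X) \<noteq> (v \<in> X)"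
        and agree: "\<And>u v. u \<in> X \<union> Y - {w} \<Longrightarrow> v \<in> X \<union> Y - {w} \<Longrightarrow> E u v = cut A u v"
        by (auto simp: bicliques_def size_pairs_def)
      have YN: "y \<in> N" if "y \<in> Y" for y using adj[of w y] p that by (auto simp: N_def)
      have XN: "x \<notin> N" if "x \<in> X" for x using adj[of w x] p that by (auto simp: N_def)
      obtain y where y: "y \<in> Y" using p(6) st by (metis card.empty ex_in_conv not_one_le_zero)
      have side: "z \<in> A \<longleftrightarrow> y \<in> A" if "z \<in> Y" for z
        using adj[of y z] agree[of y z] p y that by (auto simp: cut_def)
      have side': "z \<in> A \<longleftrightarrow> y \<notin> A" if "z \<in> X - {w}" for z
        using adj[of y z] agree[of y z] p y that by (auto simp: cut_def)
      have "card (X - {w}) = s - 1" using p by simp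
      then show "(case p of (X, Y) \<Rightarrow> (X - {w}, Y))
        \<in> P (A - N) (s - 1) \<times> P ((V - A) \<inter> N) t \<union> P (V - A - N) (s - 1) \<times> P (A \<inter> N) t"
        using YN XN side side' p by (cases "y \<in> A") (auto simp: P_def)
    qed
  qed (use fins cP in simp)
  also have "\<dots> \<le> card (P (A - N) (s - 1) \<times> P ((V - A) \<inter> N) t) + card (P (V - A - N) (s - 1) \<times> P (A \<inter> N) t)"
    by (rule card_Un_le)
  finally show ?thesis using fins cP by (simp add: card_cartesian_product)
qed

text \<open>A copy with w on the second side is one with w on the first after exchanging the roles
  of s and t.\<close>

lemma card_bicliques_at_vertex_le:
  fixes E :: "'a \<Rightarrow> 'a \<Rightarrow> bool" and w :: 'a
  assumes fin: "finite V" and A: "A \<subseteq> V" and E: "symp E" "irreflp E" and st: "1 \<le> s" "1 \<le> t"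
  defines "N \<equiv> {v \<in> V. E w v}"
  shows "card {(X, Y) \<in> bicliques_at s t E V {w}. \<forall>u\<in>X \<union> Y - {w}. \<forall>v\<in>X \<union> Y - {w}. E u v = cut A u v}
    \<le> (card (A - N) choose (s - 1)) * (card ((V - A) \<inter> N) choose t)
      + (card (V - A - N) choose (s - 1)) * (card (A \<inter> N) choose t)
      + ((card (A - N) choose (t - 1)) * (card ((V - A) \<inter> N) choose s)
      + (card (V - A - N) choose (t - 1)) * (card (A \<inter> N) choose s))" (is "card ?Q \<le> ?r")
proof -
  define H where "H s t = {(X, Y) \<in> bicliques s t E V. w \<in> X \<and> (\<forall>u\<in>X \<union> Y - {w}. \<forall>v\<in>X \<union> Y - {w}. E u v = cut A u v)}" for s t
  have finH: "finite (H s t)" for s t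
    by (rule finite_subset[of _ "bicliques s t E V"]) (use fin in \<open>auto simp: H_def\<close>)
  have "?Q \<subseteq> H s t \<union> prod.swap ` H t s"
  proof
    fix p assume "p \<in> ?Q"
    then obtain X Y where p: "p = (X, Y)" "(X, Y) \<in> bicliques s t E V" "w \<in> X \<or> w \<in> Y"
      "\<forall>u\<in>X \<union> Y - {w}. \<forall>v\<in>X \<union> Y - {w}. E u v = cut A u v" by (auto simp: bicliques_at_def)
    then have "(Y, X) \<in> bicliques t s E V" by (auto simp: bicliques_def size_pairs_def)
    then show "p \<in> H s t \<union> prod.swap ` H t s"
      using p by (cases "w \<in> X") (auto simp: H_def Un_commute intro!: image_eqI[of _ _ "(Y, X)"])
  qed
  then have "card ?Q \<le> card (H s t \<union> prod.swap ` H t s)" using finH by (intro card_mono) auto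
  also have "\<dots> \<le> card (H s t) + card (H t s)"
    using card_Un_le[of "H s t" "prod.swap ` H t s"] card_image_le[OF finH, of prod.swap t s] by linarith
  also have "\<dots> \<le> ?r" unfolding H_def N_def
    using st by (intro add_mono card_bicliques_at_vertex_half[OF fin A E]) auto
  finally show ?thesis .
qed

text \<open>The error r counts pairs of sides that contain w and a wrong pair elsewhere, hence three
  prescribed vertices. It occurs twice: for old copies that do not follow the cut off w, and for
  copies of the cut that are not copies after the correction.\<close>

lemma card_bicliques_fix_vertex:
  fixes E :: "'a \<Rightarrow> 'a \<Rightarrow> bool" and A V :: "'a set" and w :: 'a
  assumes fin: "finite V" and A: "A \<subseteq> V" and w: "w \<in> A" and E: "symp E" "irreflp E" and st: "1 \<le> s" "1 \<le> t"
  defines "N \<equiv> {v \<in> V. E w v}" and "a \<equiv> card A" and "b \<equiv> card (V - A)"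
  obtains r where "r * card V ^ 3 \<le> card (defects E A V) * (2 ^ (s + t) * card V ^ (s + t))"
    "card (bicliques s t E V) + (((a - 1) choose (s - 1)) * (b choose t) + ((a - 1) choose (t - 1)) * (b choose s))
     \<le> card (bicliques s t (fix_vertex A w E) V) + 2 * r
       + ((card (A - N) choose (s - 1)) * (card ((V - A) \<inter> N) choose t)
      + (card (V - A - N) choose (s - 1)) * (card (A \<inter> N) choose t)
      + ((card (A - N) choose (t - 1)) * (card ((V - A) \<inter> N) choose s)
      + (card (V - A - N) choose (t - 1)) * (card (A \<inter> N) choose s)))"
proof -
  let ?E = "fix_vertex A w E"
  define D where "D = {p \<in> defects E A V. fst p \<noteq> w \<and> snd p \<noteq> w}"
  define R where "R = {(X, Y) \<in> size_pairs s t V. \<exists>p\<in>D. {w, fst p, snd p} \<subseteq> X \<union> Y}"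
  have finD: "finite D" using fin by (auto simp: D_def)
  have finR: "finite R" by (rule finite_subset[of _ "size_pairs s t V"]) (use fin in \<open>auto simp: R_def\<close>)
  have "card R * card V ^ 3 \<le> card D * (2 ^ (s + t) * card V ^ (s + t))"
  proof (rule card_size_pairs_meeting[OF fin finD])
    fix p assume "p \<in> D"
    then show "card {w, fst p, snd p} = 3"
      using defects_irrefl[OF E(2), of p A V] by (auto simp: D_def card_insert_if)
  qed (simp add: R_def)
  also have "\<dots> \<le> card (defects E A V) * (2 ^ (s + t) * card V ^ (s + t))"
    using fin by (intro mult_right_mono card_mono) (auto simp: D_def)
  finally have r: "card R * card V ^ 3 \<le> card (defects E A V) * (2 ^ (s + t) * card V ^ (s + t))" .
  define G where "G = {(X, Y) \<in> bicliques_at s t E V {w}. \<forall>u\<in>X \<union> Y - {w}. \<forall>v\<in>X \<union> Y - {w}. E u v = cut A u v}"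
  have finG: "finite G" by (rule finite_subset[of _ "bicliques_at s t E V {w}"]) (use fin in \<open>auto simp: G_def\<close>)
  have off: "(X, Y) \<in> R" if "(X, Y) \<in> size_pairs s t V" "w \<in> X \<union> Y"
    "u \<in> X \<union> Y - {w}" "v \<in> X \<union> Y - {w}" "E u v \<noteq> cut A u v" for X Y u v
  proof -
    have "(u, v) \<in> D" using that by (auto simp: D_def defects_def size_pairs_def)
    with that(1-4) show ?thesis unfolding R_def by (auto intro!: bexI[of _ "(u, v)"])
  qed
  have "bicliques_at s t E V {w} \<subseteq> G \<union> R"
  proof
    fix p assume p: "p \<in> bicliques_at s t E V {w}"
    obtain X Y where XY: "p = (X, Y)" by (cases p)
    have sp: "(X, Y) \<in> size_pairs s t V" "w \<in> X \<union> Y" using p XY by (auto simp: bicliques_at_def bicliques_def)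
    show "p \<in> G \<union> R"
    proof (cases "\<exists>u\<in>X \<union> Y - {w}. \<exists>v\<in>X \<union> Y - {w}. E u v \<noteq> cut A u v")
      case True
      then obtain u v where "u \<in> X \<union> Y - {w}" "v \<in> X \<union> Y - {w}" "E u v \<noteq> cut A u v" by blast
      from off[OF sp this] XY show ?thesis by simp
    next
      case False
      with p XY show ?thesis by (simp add: G_def)
    qed
  qed
  then have "card (bicliques_at s t E V {w}) \<le> card (G \<union> R)"
    using finG finR by (intro card_mono) auto
  then have 1: "card (bicliques_at s t E V {w}) \<le> card G + card R" using card_Un_le[of G R] by linarith
  have "bicliques_at s t (cut A) V {w} \<subseteq> bicliques_at s t ?E V {w} \<union> R"
  proof
    fix p assume "p \<in> bicliques_at s t (cut A) V {w}"
    then obtain X Y where p: "p = (X, Y)" "(X, Y) \<in> size_pairs s t V" "w \<in> X \<union> Y"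
      and adj: "\<And>u v. u \<in> X \<union> Y \<Longrightarrow> v \<in> X \<union> Y \<Longrightarrow> cut A u v \<longleftrightarrow> (u \<in> X) \<noteq> (v \<in> X)"
      by (auto simp: bicliques_at_def bicliques_def)
    show "p \<in> bicliques_at s t ?E V {w} \<union> R"
    proof (cases "\<exists>u\<in>X \<union> Y - {w}. \<exists>v\<in>X \<union> Y - {w}. E u v \<noteq> cut A u v")
      case True
      then obtain u v where "u \<in> X \<union> Y - {w}" "v \<in> X \<union> Y - {w}" "E u v \<noteq> cut A u v" by blast
      from off[OF p(2,3) this] p(1) show ?thesis by simp
    next
      case False
      then have "?E u v \<longleftrightarrow> (u \<in> X) \<noteq> (v \<in> X)" if "u \<in> X \<union> Y" "v \<in> X \<union> Y" for u v
        using adj[OF that] that by (auto simp: fix_vertex_def)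
      then show ?thesis using p by (auto simp: bicliques_at_def bicliques_def)
    qed
  qed
  then have "card (bicliques_at s t (cut A) V {w}) \<le> card (bicliques_at s t ?E V {w} \<union> R)"
    using fin finR by (intro card_mono) auto
  then have 2: "card (bicliques_at s t (cut A) V {w}) \<le> card (bicliques_at s t ?E V {w}) + card R"
    using card_Un_le[of "bicliques_at s t ?E V {w}" R] by linarith
  have 3: "card (bicliques s t ?E V) + card (bicliques_at s t E V {w})
       = card (bicliques s t E V) + card (bicliques_at s t ?E V {w})"
    by (rule card_bicliques_change[OF fin]) (auto simp: fix_vertex_def split: if_splits)
  have "((a - 1) choose (s - 1)) * (b choose t) \<le> card (split_pairs s t A V {w})"
    using card_split_pairs_ge[OF fin A, of "{w}" s "{}" t] w st by (simp add: a_def b_def)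
  moreover have "((a - 1) choose (t - 1)) * (b choose s) \<le> card (split_pairs s t (V - A) V {w})"
    using card_split_pairs_ge[OF fin, of "V - A" "{}" s "{w}" t] w st A by (simp add: a_def b_def double_diff mult.commute)
  ultimately have 4: "((a - 1) choose (s - 1)) * (b choose t) + ((a - 1) choose (t - 1)) * (b choose s)
      \<le> card (bicliques_at s t (cut A) V {w})"
    using card_bicliques_at_cut_ge[OF fin A st, of "{w}"] by linarith
  have 5: "card G \<le> (card (A - N) choose (s - 1)) * (card ((V - A) \<inter> N) choose t)
      + (card (V - A - N) choose (s - 1)) * (card (A \<inter> N) choose t)
      + ((card (A - N) choose (t - 1)) * (card ((V - A) \<inter> N) choose s)
      + (card (V - A - N) choose (t - 1)) * (card (A \<inter> N) choose s))"
    unfolding G_def N_def by (rule card_bicliques_at_vertex_le[OF fin A E st])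
  show ?thesis
    by (rule that[OF r]) (use 1 2 3 4 5 in linarith)
qed

text \<open>Before the correction, any third vertex \<open>z\<close> of a copy through the wrong pair \<open>uv\<close> forms another
  wrong pair with \<open>u\<close> or with \<open>v\<close>, so such copies are rare.\<close>

lemma card_bicliques_fix_edge:
  assumes fin: "finite V" and uv: "(u, v) \<in> defects E A V" and E: "symp E" "irreflp E" and k3: "3 \<le> s + t"
    and \<Delta>: "\<And>x. x \<in> V \<Longrightarrow> card {y. (x, y) \<in> defects E A V} \<le> \<Delta>"
  obtains r r' where "r * card V ^ 3 \<le> 2 * \<Delta> * (2 ^ (s + t) * card V ^ (s + t))"
    "r' * card V ^ 4 \<le> card V * \<Delta> * (2 ^ (s + t) * card V ^ (s + t))"
    "card (bicliques s t E V) + card (bicliques_at s t (cut A) V {u, v})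
     \<le> card (bicliques s t (fix_edge A u v E) V) + 2 * r + r'"
proof -
  let ?E = "fix_edge A u v E"
  have uvV: "u \<in> V" "v \<in> V" "u \<noteq> v" using uv E by (auto simp: defects_def cut_def irreflp_def)
  \<comment> \<open>Vertices that form a further wrong pair with u or v, giving three prescribed
    vertices. The set D consists of the wrong pairs disjoint from both, giving four.\<close>
  define Z where "Z = {y. (u, y) \<in> defects E A V} - {v} \<union> ({y. (v, y) \<in> defects E A V} - {u})"
  define D where "D = {p \<in> defects E A V. fst p \<noteq> u \<and> fst p \<noteq> v \<and> snd p \<noteq> u \<and> snd p \<noteq> v}"
  define R where "R = {(X, Y) \<in> size_pairs s t V. \<exists>z\<in>Z. {u, v, z} \<subseteq> X \<union> Y}"
  define R' where "R' = {(X, Y) \<in> size_pairs s t V. \<exists>p\<in>D. {u, v, fst p, snd p} \<subseteq> X \<union> Y}"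
  have findeg: "finite {y. (x, y) \<in> defects E A V}" for x
    by (rule finite_subset[of _ V]) (use fin in \<open>auto simp: defects_def\<close>)
  have fins: "finite Z" "finite D" "finite R" "finite R'"
    using fin findeg by (auto simp: Z_def D_def R_def R'_def intro: finite_subset[of _ "size_pairs s t V"])
  have "card Z \<le> card {y. (u, y) \<in> defects E A V} + card {y. (v, y) \<in> defects E A V}"
    unfolding Z_def using findeg
    by (intro order_trans[OF card_Un_le] add_mono card_mono) auto
  then have cZ: "card Z \<le> 2 * \<Delta>" using \<Delta>[of u] \<Delta>[of v] uvV by linarith
  have "card D \<le> card (SIGMA x:V. {y. (x, y) \<in> defects E A V})"
    using fin findeg by (intro card_mono finite_SigmaI) (auto simp: D_def defects_def)
  also have "\<dots> = (\<Sum>x\<in>V. card {y. (x, y) \<in> defects E A V})"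
    using fin findeg by (intro card_SigmaI) auto
  also have "\<dots> \<le> (\<Sum>x\<in>V. \<Delta>)" using \<Delta> by (rule sum_mono)
  finally have cD: "card D \<le> card V * \<Delta>" by simp
  have loops: "(x, x) \<notin> defects E A V" for x using E by (auto simp: defects_def cut_def irreflp_def)
  have "card R * card V ^ 3 \<le> card Z * (2 ^ (s + t) * card V ^ (s + t))"
  proof (rule card_size_pairs_meeting[OF fin fins(1)])
    fix z assume "z \<in> Z"
    then have "z \<noteq> u" "z \<noteq> v" using loops by (auto simp: Z_def)
    then show "card {u, v, z} = 3" using uvV by auto
  qed (simp add: R_def)
  also have "\<dots> \<le> 2 * \<Delta> * (2 ^ (s + t) * card V ^ (s + t))" using cZ by (intro mult_right_mono) auto
  finally have r: "card R * card V ^ 3 \<le> 2 * \<Delta> * (2 ^ (s + t) * card V ^ (s + t))" .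
  have "card R' * card V ^ 4 \<le> card D * (2 ^ (s + t) * card V ^ (s + t))"
  proof (rule card_size_pairs_meeting[OF fin fins(2)])
    fix p assume "p \<in> D"
    then have "fst p \<noteq> snd p" "u \<noteq> fst p" "u \<noteq> snd p" "v \<noteq> fst p" "v \<noteq> snd p"
      using defects_irrefl[OF E(2), of p A V] by (auto simp: D_def)
    then show "card {u, v, fst p, snd p} = 4" using uvV by simp
  qed (simp add: R'_def)
  also have "\<dots> \<le> card V * \<Delta> * (2 ^ (s + t) * card V ^ (s + t))" using cD by (intro mult_right_mono) auto
  finally have r': "card R' * card V ^ 4 \<le> card V * \<Delta> * (2 ^ (s + t) * card V ^ (s + t))" .
  have "bicliques_at s t E V {u, v} \<subseteq> R"
  proof
    fix p assume "p \<in> bicliques_at s t E V {u, v}"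
    then obtain X Y where p: "p = (X, Y)" "(X, Y) \<in> size_pairs s t V" "{u, v} \<subseteq> X \<union> Y"
      and adj: "\<And>u v. u \<in> X \<union> Y \<Longrightarrow> v \<in> X \<union> Y \<Longrightarrow> E u v \<longleftrightarrow> (u \<in> X) \<noteq> (v \<in> X)"
      by (auto simp: bicliques_at_def bicliques_def)
    have fXY: "finite (X \<union> Y)" using p fin by (auto simp: size_pairs_def intro: finite_subset)
    then have "card (X \<union> Y) = s + t" using p by (auto simp: size_pairs_def card_Un_disjoint)
    then have "\<not> X \<union> Y \<subseteq> {u, v}" using k3 uvV card_mono[of "{u, v}" "X \<union> Y"] by auto
    then obtain z where z: "z \<in> X \<union> Y" "z \<noteq> u" "z \<noteq> v" by auto
    have zV: "z \<in> V" using z p by (auto simp: size_pairs_def)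
    have "E u v \<noteq> cut A u v" using uv by (simp add: defects_def)
    \<comment> \<open>A cut separates an even number of the three pairs of a triangle. On the copy E
      is a cut too, so it cannot differ from \<open>cut A\<close> on uv alone.\<close>
    then have "E u z \<noteq> cut A u z \<or> E v z \<noteq> cut A v z"
      using adj[of u v] adj[of u z] adj[of v z] p(3) z unfolding cut_def by auto
    then have "z \<in> Z" using z zV uvV by (auto simp: Z_def defects_def)
    then show "p \<in> R" using p z by (auto simp: R_def)
  qed
  then have 1: "card (bicliques_at s t E V {u, v}) \<le> card R" using fins by (intro card_mono)
  have "bicliques_at s t (cut A) V {u, v} \<subseteq> bicliques_at s t ?E V {u, v} \<union> (R \<union> R')"
  proof
    fix p assume "p \<in> bicliques_at s t (cut A) V {u, v}"
    then obtain X Y where p: "p = (X, Y)" "(X, Y) \<in> size_pairs s t V" "{u, v} \<subseteq> X \<union> Y"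
      and adj: "\<And>u v. u \<in> X \<union> Y \<Longrightarrow> v \<in> X \<union> Y \<Longrightarrow> cut A u v \<longleftrightarrow> (u \<in> X) \<noteq> (v \<in> X)"
      by (auto simp: bicliques_at_def bicliques_def)
    show "p \<in> bicliques_at s t ?E V {u, v} \<union> (R \<union> R')"
    proof (cases "\<exists>x\<in>X \<union> Y. \<exists>y\<in>X \<union> Y. ?E x y \<noteq> cut A x y")
      case True
      then obtain x y where xy: "x \<in> X \<union> Y" "y \<in> X \<union> Y" "?E x y \<noteq> cut A x y" by blast
      then have nuv: "{x, y} \<noteq> {u, v}" and d: "E x y \<noteq> cut A x y" by (auto simp: fix_edge_def split: if_splits)
      have d': "E y x \<noteq> cut A y x" using d E by (auto simp: symp_def cut_def)
      have xyV: "x \<in> V" "y \<in> V" using xy p by (auto simp: size_pairs_def)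
      have D: "(x, y) \<in> defects E A V" "(y, x) \<in> defects E A V" using d d' xyV by (auto simp: defects_def)
      consider "x \<in> {u, v}" | "y \<in> {u, v}" | "x \<notin> {u, v}" "y \<notin> {u, v}" by blast
      then show ?thesis
      proof cases
        case 1
        then have "y \<in> Z" using D nuv loops by (auto simp: Z_def)
        then show ?thesis using p xy by (auto simp: R_def)
      next
        case 2
        then have "x \<in> Z" using D nuv loops by (auto simp: Z_def)
        then show ?thesis using p xy by (auto simp: R_def)
      next
        case 3
        then have "(x, y) \<in> D" using D by (auto simp: D_def)
        then show ?thesis using p xy(1,2) unfolding R'_def by (auto intro!: bexI[of _ "(x, y)"])
      qed
    next
      case False
      then show ?thesis using p adj by (auto simp: bicliques_at_def bicliques_def)
    qed
  qed
  then have "card (bicliques_at s t (cut A) V {u, v}) \<le> card (bicliques_at s t ?E V {u, v} \<union> (R \<union> R'))"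
    using fin fins by (intro card_mono) auto
  then have 2: "card (bicliques_at s t (cut A) V {u, v}) \<le> card (bicliques_at s t ?E V {u, v}) + card R + card R'"
    using card_Un_le[of "bicliques_at s t ?E V {u, v}" "R \<union> R'"] card_Un_le[of R R'] by linarith
  have 3: "card (bicliques s t ?E V) + card (bicliques_at s t E V {u, v})
       = card (bicliques s t E V) + card (bicliques_at s t ?E V {u, v})"
    by (rule card_bicliques_change[OF fin]) (auto simp: fix_edge_def split: if_splits)
  show ?thesis
    by (rule that[OF r r']) (use 1 2 3 in linarith)
qed

text \<open>A copy without wrong pairs is a copy of the cut; the others have two prescribed
  vertices.\<close>

lemma card_bicliques_le_cut:
  assumes fin: "finite V" and E: "symp E" "irreflp E"
  obtains r where "r * card V ^ 2 \<le> card (defects E A V) * (2 ^ (s + t) * card V ^ (s + t))"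
    "card (bicliques s t E V) \<le> card (bicliques s t (cut A) V) + r"
proof -
  define R where "R = {(X, Y) \<in> size_pairs s t V. \<exists>p\<in>defects E A V. {fst p, snd p} \<subseteq> X \<union> Y}"
  have fins: "finite R" by (rule finite_subset[of _ "size_pairs s t V"]) (use fin in \<open>auto simp: R_def\<close>)
  have "card R * card V ^ 2 \<le> card (defects E A V) * (2 ^ (s + t) * card V ^ (s + t))"
  proof (rule card_size_pairs_meeting[OF fin])
    fix p assume "p \<in> defects E A V"
    then have "fst p \<noteq> snd p" by (rule defects_irrefl[OF E(2)])
    then show "card {fst p, snd p} = 2" by simp
  qed (use fin in \<open>simp_all add: R_def\<close>)
  moreover have "bicliques s t E V \<subseteq> bicliques s t (cut A) V \<union> R"
  proof
    fix p assume "p \<in> bicliques s t E V"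
    then obtain X Y where p: "p = (X, Y)" "(X, Y) \<in> size_pairs s t V"
      and adj: "\<And>u v. u \<in> X \<union> Y \<Longrightarrow> v \<in> X \<union> Y \<Longrightarrow> E u v \<longleftrightarrow> (u \<in> X) \<noteq> (v \<in> X)"
      by (auto simp: bicliques_def)
    show "p \<in> bicliques s t (cut A) V \<union> R"
    proof (cases "\<exists>x\<in>X \<union> Y. \<exists>y\<in>X \<union> Y. E x y \<noteq> cut A x y")
      case True
      then obtain x y where xy: "x \<in> X \<union> Y" "y \<in> X \<union> Y" "E x y \<noteq> cut A x y" by blast
      then have "(x, y) \<in> defects E A V" using p by (auto simp: defects_def size_pairs_def)
      then show ?thesis using p xy(1,2) unfolding R_def by (auto intro!: bexI[of _ "(x, y)"])
    next
      case False
      then show ?thesis using p adj by (auto simp: bicliques_def)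
    qed
  qed
  then have "card (bicliques s t E V) \<le> card (bicliques s t (cut A) V \<union> R)"
    using fin fins by (intro card_mono) auto
  then have "card (bicliques s t E V) \<le> card (bicliques s t (cut A) V) + card R"
    using card_Un_le[of "bicliques s t (cut A) V" R] by linarith
  ultimately show ?thesis by (rule that)
qed

subsection \<open>The gain of a correction\<close>

lemma binomial_fact_le_power: "fact j * real (m choose j) \<le> real m ^ j"
  using binomial_fact_pow[of m j] by (metis mult.commute of_nat_fact of_nat_le_iff of_nat_mult of_nat_power)

text \<open>A lower bound for the falling factorial with error of order n^(j-1); using m - 1 leaves
  room for one vertex already taken. The constant survives the induction because (j + 1) + j (j + 1)
  = (j + 1)^2 <= (j + 1) (j + 2).\<close>

lemma power_le_binomial_fact:
  assumes "m \<le> n" "1 \<le> n"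
  shows "real m ^ j \<le> fact j * real ((m - 1) choose j) + real (j * (j + 1)) * real n ^ j / real n"
proof (induction j)
  case (Suc j)
  let ?B = "fact j * real ((m - 1) choose j)"
  have step: "fact (Suc j) * real ((m - 1) choose Suc j) \<ge> ?B * (real m - 1 - real j)"
  proof (cases "j \<le> m - 1")
    case True
    have "Suc j * ((m - 1) choose Suc j) = (m - 1 - j) * ((m - 1) choose j)"
      by (metis binomial_absorption binomial_absorb_comp)
    then have "real (Suc j) * real ((m - 1) choose Suc j) = real (m - 1 - j) * real ((m - 1) choose j)"
      by (metis of_nat_mult)
    moreover have "real (m - 1 - j) \<ge> real m - 1 - real j" by simp
    ultimately have "real (Suc j) * real ((m - 1) choose Suc j) \<ge> (real m - 1 - real j) * real ((m - 1) choose j)"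
      by (simp add: mult_right_mono)
    then have "fact j * (real (Suc j) * real ((m - 1) choose Suc j)) \<ge> fact j * ((real m - 1 - real j) * real ((m - 1) choose j))"
      by (rule mult_left_mono) simp
    then show ?thesis by (simp add: mult_ac)
  qed (simp add: binomial_eq_0)
  have "real m ^ Suc j = real m * real m ^ j" by simp
  also have "\<dots> \<le> real m * (?B + real (j * (j + 1)) * real n ^ j / real n)"
    using Suc by (intro mult_left_mono) auto
  also have "\<dots> = ?B * (real m - 1 - real j) + (real j + 1) * ?B + real m * (real (j * (j + 1)) * real n ^ j / real n)"
    by (simp add: algebra_simps)
  also have "\<dots> \<le> fact (Suc j) * real ((m - 1) choose Suc j) + ((real j + 1) * real n ^ j + real n * (real (j * (j + 1)) * real n ^ j / real n))"
    unfolding add.assoc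
  proof (intro add_mono step mult_left_mono mult_right_mono)
    have "?B \<le> real (m - 1) ^ j" by (rule binomial_fact_le_power)
    also have "\<dots> \<le> real n ^ j" using assms by (intro power_mono) auto
    finally show "?B \<le> real n ^ j" .
  qed (use assms in auto)
  also have "\<dots> = fact (Suc j) * real ((m - 1) choose Suc j) + (real j + 1) * (real j + 1) * real n ^ j"
    using assms by (simp add: field_simps)
  also have "\<dots> \<le> fact (Suc j) * real ((m - 1) choose Suc j) + real (Suc j * (Suc j + 1)) * real n ^ j"
    by (intro add_left_mono mult_right_mono) (auto simp: algebra_simps)
  also have "real (Suc j * (Suc j + 1)) * real n ^ j = real (Suc j * (Suc j + 1)) * real n ^ Suc j / real n"
    using assms by simp
  finally show ?case .
qed (use assms in simp)

text \<open>Only the order of magnitude matters here: the binomial coefficient is at least the power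
  of the quotient, and removing up to two vertices leaves at least a n / 2 because a n >= 4.\<close>

lemma binomial_ge_fraction:
  fixes a :: real
  assumes a: "0 < a" "a \<le> 1" and m: "a * n \<le> real m" and n: "4 \<le> a * n" "2 * real k \<le> a * n" and j: "j \<le> k" and k: "1 \<le> k" and i: "i \<le> 2"
  shows "(a / (2 * k)) ^ j * real n ^ j \<le> real ((m - i) choose j)"
proof (cases "j = 0")
  case False
  have mi: "a * n / 2 \<le> real (m - i)" using m n i by (simp add: of_nat_diff)
  have "real k \<le> real (m - i)" using mi n by linarith
  then have jm: "j \<le> m - i" using j by linarith
  have "a / (2 * k) * real n \<le> real (m - i) / real j"
  proof -
    have "a / (2 * k) * real n = (a * n / 2) / k" by simp
    also have "\<dots> \<le> real (m - i) / real k" using mi k by (intro divide_right_mono) auto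
    also have "\<dots> \<le> real (m - i) / real j" using j False by (intro divide_left_mono) auto
    finally show ?thesis .
  qed
  then have "(a / (2 * k) * real n) ^ j \<le> (real (m - i) / real j) ^ j"
    using a by (intro power_mono) auto
  also have "\<dots> \<le> real ((m - i) choose j)" using binomial_ge_n_over_k_pow_k[OF jm, where 'a=real] by simp
  finally show ?thesis by (simp only: power_mult_distrib of_nat_mult of_nat_numeral)
qed simp

text \<open>For factors between 0 and 1 absolute errors simply add up.\<close>

lemma product_lower_bound:
  fixes u v p q :: real
  assumes "u \<le> p + d" "v \<le> q + e" "0 \<le> u" "u \<le> 1" "0 \<le> q" "q \<le> 1" "0 \<le> d" "0 \<le> e"
  shows "u * v \<le> p * q + (d + e)"
proof -
  have "u * v \<le> u * (q + e)" using assms by (intro mult_left_mono) auto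
  also have "\<dots> = u * q + u * e" by (simp add: algebra_simps)
  also have "\<dots> \<le> (p + d) * q + 1 * e" using assms by (intro add_mono mult_right_mono) auto
  also have "\<dots> = p * q + d * q + e" by (simp add: algebra_simps)
  also have "\<dots> \<le> p * q + d + e" using assms mult_left_mono[of q 1 d] by auto
  finally show ?thesis by simp
qed

text \<open>Here x and y are the proportions of neighbours of a vertex in its own part and in the
  other one. Type (0, 1) is a correct vertex, and (1, 0) is one attached as if it belonged to the
  other part; the right-hand side vanishes at both. The lower bound e on the proportion of wrong
  pairs excludes the former, the upper bound 1/2 the latter. Averaging gives e <= x or e <= 1 - y,
  and 1/2 <= 1 - x or 1/2 <= y.\<close>

lemma type_defect_ge:
  fixes a b x y e :: real
  assumes "0 \<le> x" "x \<le> 1" "0 \<le> y" "y \<le> 1" "0 \<le> a" "0 \<le> b" "a + b = 1"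
    and e: "0 \<le> e" "e \<le> x * a + (1 - y) * b" "x * a + (1 - y) * b \<le> 1/2"
  shows "e / 2 \<le> (1 - x) * (1 - y) + x * y"
proof -
  have e1: "e \<le> 1/2" using e by linarith
  have mean: "min p q \<le> p * a + q * b" "p * a + q * b \<le> max p q" for p q :: real
  proof -
    have "min p q = min p q * a + min p q * b" using assms(7) by (metis distrib_left mult.right_neutral)
    also have "\<dots> \<le> p * a + q * b" using assms by (intro add_mono mult_right_mono) auto
    finally show "min p q \<le> p * a + q * b" .
    have "p * a + q * b \<le> max p q * a + max p q * b" using assms by (intro add_mono mult_right_mono) auto
    also have "\<dots> = max p q" using assms(7) by (metis distrib_left mult.right_neutral)
    finally show "p * a + q * b \<le> max p q" .
  qed
  have big: "e \<le> x \<or> e \<le> 1 - y" using mean(2)[of x "1 - y"] e by linarith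
  have "(1 - x) * a + y * b = 1 - (x * a + (1 - y) * b)" using assms(7) by (simp add: algebra_simps)
  then have co: "1/2 \<le> 1 - x \<or> 1/2 \<le> y" using mean(2)[of "1 - x" y] e by linarith
  have mix: "r \<le> z * c + (1 - z) * d" if "r \<le> c" "r \<le> d" "0 \<le> z" "z \<le> 1" for r c d z :: real
  proof -
    have "r = z * r + (1 - z) * r" by (simp add: algebra_simps)
    also have "\<dots> \<le> z * c + (1 - z) * d" using that by (intro add_mono mult_left_mono) auto
    finally show ?thesis .
  qed
  have prod: "e / 2 \<le> p * q" if "e \<le> p" "1/2 \<le> q" for p q :: real
  proof -
    have "e * (1/2) \<le> p * q" using that e by (intro mult_mono) auto
    then show ?thesis by simp
  qed
  have nn: "0 \<le> (1 - x) * (1 - y)" "0 \<le> x * y" using assms by auto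
  from big co consider "e \<le> x" "1/2 \<le> 1 - x" | "e \<le> x" "1/2 \<le> y" | "e \<le> 1 - y" "1/2 \<le> 1 - x" | "e \<le> 1 - y" "1/2 \<le> y"
    by blast
  then show ?thesis
  proof cases
    case 1
    have "e / 2 \<le> y * x + (1 - y) * (1 - x)" using 1 e e1 assms by (intro mix) auto
    then show ?thesis by (simp add: mult.commute)
  next
    case 2
    then show ?thesis using prod[of x y] nn by linarith
  next
    case 3
    then show ?thesis using prod[of "1 - y" "1 - x"] nn by (simp add: mult.commute)
  next
    case 4
    have "e / 2 \<le> x * y + (1 - x) * (1 - y)" using 4 e e1 assms by (intro mix) auto
    then show ?thesis by simp
  qed
qed

context biclique_params
begin

abbreviation k :: nat where "k \<equiv> s + t"

text \<open>Turns the products of binomial coefficients into products of falling factorials,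
  comparable with powers.\<close>

definition S :: real where "S = fact s * fact t"

lemma S_pos: "S > 0" by (simp add: S_def)

lemma fact_reduce: "i \<ge> 1 \<Longrightarrow> (fact i :: real) = real i * fact (i - 1)"
  by (simp add: fact_reduce)

lemma binomial_pair_lower:
  assumes "u \<le> n" "v \<le> n" "1 \<le> n"
  shows "real u ^ i * real v ^ j \<le> fact i * real ((u - 1) choose i) * (fact j * real ((v - 1) choose j))
    + real (i * (i + 1) + j * (j + 1)) * real n ^ (i + j) / real n"
proof -
  define N where "N = real n"
  have N: "N > 0" using assms by (simp add: N_def)
  have "(real u / N) ^ i * (real v / N) ^ j \<le> (fact i * real ((u - 1) choose i) / N ^ i) * (fact j * real ((v - 1) choose j) / N ^ j)
      + (real (i * (i + 1)) / N + real (j * (j + 1)) / N)"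
  proof (rule product_lower_bound)
    have *: "(real u / N) ^ i \<le> fact i * real ((u - 1) choose i) / N ^ i + real (i * (i + 1)) / N" if "u \<le> n" for u i
    proof -
      have "real u ^ i / N ^ i \<le> (fact i * real ((u - 1) choose i) + real (i * (i + 1)) * N ^ i / N) / N ^ i"
        using power_le_binomial_fact[OF that assms(3), of i] N by (intro divide_right_mono) (auto simp: N_def)
      also have "\<dots> = fact i * real ((u - 1) choose i) / N ^ i + real (i * (i + 1)) / N"
        using N by (simp add: add_divide_distrib)
      finally show ?thesis by (simp add: power_divide)
    qed
    show "(real u / N) ^ i \<le> fact i * real ((u - 1) choose i) / N ^ i + real (i * (i + 1)) / N" using * assms by blast
    show "(real v / N) ^ j \<le> fact j * real ((v - 1) choose j) / N ^ j + real (j * (j + 1)) / N" using * assms by blast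
    show "(real u / N) ^ i \<le> 1" using assms N by (intro power_le_one) (auto simp: N_def)
    have "fact j * real ((v - 1) choose j) \<le> N ^ j"
      using binomial_fact_le_power[of j "v - 1"] assms
      by (elim order_trans) (auto simp: N_def intro!: power_mono)
    then show "fact j * real ((v - 1) choose j) / N ^ j \<le> 1" using N by simp
  qed (use N in auto)
  then have "((real u / N) ^ i * (real v / N) ^ j) * N ^ (i + j) \<le> ((fact i * real ((u - 1) choose i) / N ^ i) * (fact j * real ((v - 1) choose j) / N ^ j)
      + (real (i * (i + 1)) / N + real (j * (j + 1)) / N)) * N ^ (i + j)"
    using N by (intro mult_right_mono) auto
  moreover have "((real u / N) ^ i * (real v / N) ^ j) * N ^ (i + j) = real u ^ i * real v ^ j"
    using N by (simp add: power_divide power_add)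
  moreover have "((fact i * real ((u - 1) choose i) / N ^ i) * (fact j * real ((v - 1) choose j) / N ^ j)
      + (real (i * (i + 1)) / N + real (j * (j + 1)) / N)) * N ^ (i + j)
      = fact i * real ((u - 1) choose i) * (fact j * real ((v - 1) choose j)) + real (i * (i + 1) + j * (j + 1)) * N ^ (i + j) / N"
    using N by (simp add: power_add field_simps)
  ultimately show ?thesis by (simp add: N_def)
qed

text \<open>After scaling, a correct vertex of A lies in about \<open>deriv_L a\<close> n^(k-1)
  copies, and the old w in at most a combination of the two derivatives and \<open>both_L\<close>
  with weights (1 - x) y, x (1 - y) and x y. The missing weight (1 - x) (1 - y) and the strict gap
  at weight x y yield c e / 2. The subtracted terms are the difference of the derivatives, the error
  of the binomials and the copies with a wrong pair elsewhere.\<close>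

lemma vertex_gain:
  fixes V A :: "'a set" and E :: "'a \<Rightarrow> 'a \<Rightarrow> bool" and w :: 'a and c e \<delta> \<eta> :: real
  assumes fin: "finite V" and A: "A \<subseteq> V" "w \<in> A" "A \<noteq> V" and E: "symp E" "irreflp E"
  defines "n \<equiv> card V" and "a \<equiv> real (card A) / real (card V)" and "N \<equiv> {v \<in> V. E w v}"
  assumes near: "\<bar>deriv_L a - deriv_R a\<bar> < \<eta>" "deriv_L a \<ge> c" "deriv_L a - both_L a \<ge> c"
    and c: "c > 0" and \<delta>: "real (card (defects E A V)) \<le> \<delta> * (real n)\<^sup>2"
    and deg: "0 \<le> e" "e * n \<le> real (card (A \<inter> N) + card (V - A - N))" "real (card (A \<inter> N) + card (V - A - N)) \<le> n / 2"
  shows "S * real (card (bicliques s t E V)) +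
      (c * e / 2 - \<eta> - 2 * real (k * k * (k + 1)) / n - 2 * S * \<delta> * 2 ^ k) * real n ^ (k - 1)
      \<le> S * real (card (bicliques s t (fix_vertex A w E) V))"
proof -
  define na nb xa yb where "na = card A" "nb = card (V - A)" "xa = card (A \<inter> N)" "yb = card ((V - A) \<inter> N)"
  note defs = na_nb_xa_yb_def
  have finA: "finite A" "finite (V - A)" using fin A by (auto intro: finite_subset)
  have pos: "na \<ge> 1" "nb \<ge> 1"
    using A finA by (auto simp: defs Suc_le_eq card_gt_0_iff)
  have nab: "na + nb = n" unfolding defs n_def using card_Un_disjoint[of A "V - A"] finA A by (simp add: Un_absorb1)
  have cA: "card (A - N) = na - xa" "xa \<le> na"
    using finA card_Diff_subset_Int[of A N] by (auto simp: defs Int_commute intro: card_mono)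
  have cB: "card (V - A - N) = nb - yb" "yb \<le> nb"
    using finA card_Diff_subset_Int[of "V - A" N] by (auto simp: defs intro: card_mono)
  define q where "q = real n ^ (k - 1)"
  have n1: "n \<ge> 1" using nab pos by simp
  have q: "q > 0" using n1 by (simp add: q_def)
  define x y where "x = real xa / real na" and "y = real yb / real nb"
  have xy: "0 \<le> x" "x \<le> 1" "0 \<le> y" "y \<le> 1" using cA cB pos by (auto simp: x_def y_def)
  have a: "0 \<le> a" "a \<le> 1" "1 - a = real nb / n"
    using nab n1 pos by (auto simp: a_def n_def[symmetric] defs(1)[symmetric] field_simps)
  have an: "a = real na / n" by (simp add: a_def n_def defs)
  have r1: "real (na - xa) = ((1 - x) * a) * n" "real (nb - yb) = ((1 - y) * (1 - a)) * n"
    "real xa = (x * a) * n" "real yb = (y * (1 - a)) * n"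
    unfolding a(3) unfolding an using cA cB pos n1 by (auto simp: x_def y_def field_simps of_nat_diff)
  obtain r where r: "r * card V ^ 3 \<le> card (defects E A V) * (2 ^ (s + t) * card V ^ (s + t))"
    and le: "card (bicliques s t E V) + (((na - 1) choose (s - 1)) * (nb choose t) + ((na - 1) choose (t - 1)) * (nb choose s))
     \<le> card (bicliques s t (fix_vertex A w E) V) + 2 * r
       + (((na - xa) choose (s - 1)) * (yb choose t) + ((nb - yb) choose (s - 1)) * (xa choose t)
      + (((na - xa) choose (t - 1)) * (yb choose s) + ((nb - yb) choose (t - 1)) * (xa choose s)))"
    using card_bicliques_fix_vertex[OF fin A(1,2) E, of s t] s_pos t_ge2
    unfolding N_def[symmetric] cA(1) cB(1) unfolding defs(1,2)[symmetric] defs(3,4)[symmetric] by auto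
  define LB where "LB = ((na - 1) choose (s - 1)) * (nb choose t) + ((na - 1) choose (t - 1)) * (nb choose s)"
  define UB where "UB = ((na - xa) choose (s - 1)) * (yb choose t) + ((nb - yb) choose (s - 1)) * (xa choose t)
      + (((na - xa) choose (t - 1)) * (yb choose s) + ((nb - yb) choose (t - 1)) * (xa choose s))"
  have Ss: "S = real s * (fact (s - 1) * fact t)" "S = real t * (fact (t - 1) * fact s)"
    using fact_reduce[of s] fact_reduce[of t] s_pos t_ge2 by (simp_all add: S_def)
  have exps: "(s - 1) + t = k - 1" "(t - 1) + s = k - 1" using s_pos t_ge2 by auto
  have qs: "real n ^ (s - 1) * real n ^ t = q" "real n ^ (t - 1) * real n ^ s = q"
    unfolding q_def power_add[symmetric] exps by (rule refl)+
  have pw: "(u * n) ^ (s - 1) * (v * n) ^ t = u ^ (s - 1) * v ^ t * q" "(u * n) ^ (t - 1) * (v * n) ^ s = u ^ (t - 1) * v ^ s * q" for u v :: real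
    by (subst qs(1)[symmetric], simp only: power_mult_distrib mult_ac)
      (subst qs(2)[symmetric], simp only: power_mult_distrib mult_ac)
  have up: "fact i * real (p choose i) * (fact j * real (p' choose j)) \<le> real p ^ i * real p' ^ j" for i j p p' :: nat
    using binomial_fact_le_power by (intro mult_mono) auto
  have "S * real UB = real s * (fact (s - 1) * real ((na - xa) choose (s - 1)) * (fact t * real (yb choose t))
       + fact (s - 1) * real ((nb - yb) choose (s - 1)) * (fact t * real (xa choose t)))
     + real t * (fact (t - 1) * real ((na - xa) choose (t - 1)) * (fact s * real (yb choose s))
       + fact (t - 1) * real ((nb - yb) choose (t - 1)) * (fact s * real (xa choose s)))"
    unfolding UB_def of_nat_add of_nat_mult distrib_left
    by (subst (1 2) Ss(1), subst (1 2) Ss(2)) (simp add: mult_ac)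
  also have "\<dots> \<le> real s * (real (na - xa) ^ (s - 1) * real yb ^ t + real (nb - yb) ^ (s - 1) * real xa ^ t)
     + real t * (real (na - xa) ^ (t - 1) * real yb ^ s + real (nb - yb) ^ (t - 1) * real xa ^ s)"
    by (intro add_mono mult_left_mono up) auto
  also have "\<dots> = q * (real s * (((1 - x) * a) ^ (s - 1) * (y * (1 - a)) ^ t + ((1 - y) * (1 - a)) ^ (s - 1) * (x * a) ^ t)
       + real t * (((1 - x) * a) ^ (t - 1) * (y * (1 - a)) ^ s + ((1 - y) * (1 - a)) ^ (t - 1) * (x * a) ^ s))"
    unfolding r1 pw by (simp only: distrib_left mult_ac)
  also have "\<dots> \<le> q * ((1 - x) * y * deriv_L a + x * (1 - y) * deriv_R a + x * y * both_L a)"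
    using q by (intro mult_left_mono vertex_type_bound xy a) auto
  finally have UB: "S * real UB \<le> q * ((1 - x) * y * deriv_L a + x * (1 - y) * deriv_R a + x * y * both_L a)" .
  have "c * e / 2 \<le> c * ((1 - x) * (1 - y) + x * y)"
  proof -
    have "x * a + (1 - y) * (1 - a) = real (xa + (nb - yb)) / n"
      using r1(2,3) n1 by (simp add: field_simps)
    moreover have "real (xa + (nb - yb)) = real (card (A \<inter> N) + card (V - A - N))" by (simp add: defs cB(1)[unfolded defs])
    ultimately have mean: "x * a + (1 - y) * (1 - a) = real (card (A \<inter> N) + card (V - A - N)) / n" by simp
    have "e \<le> x * a + (1 - y) * (1 - a)" "x * a + (1 - y) * (1 - a) \<le> 1/2"
      unfolding mean using deg n1 by (simp_all add: field_simps)
    then have "e / 2 \<le> (1 - x) * (1 - y) + x * y"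
      using type_defect_ge[of x y a "1 - a" e] xy a deg by simp
    then have "c * (e / 2) \<le> c * ((1 - x) * (1 - y) + x * y)" using c by (intro mult_left_mono) auto
    then show ?thesis by simp
  qed
  \<comment> \<open>The right-hand side is \<open>deriv_L a\<close> minus the weighted combination,
    regrouped by the four weights. Only the term with x (1 - y) can be negative, and by at most
    \<eta>.\<close>
  moreover have "(1 - x) * (1 - y) * c + x * y * c - 1 * \<eta> \<le>
      (1 - x) * (1 - y) * deriv_L a + x * y * (deriv_L a - both_L a) + x * (1 - y) * (deriv_L a - deriv_R a)"
  proof -
    have "x * (1 - y) * (deriv_R a - deriv_L a) \<le> x * (1 - y) * \<bar>deriv_L a - deriv_R a\<bar>"
      using xy by (intro mult_left_mono) auto
    also have "\<dots> \<le> 1 * \<bar>deriv_L a - deriv_R a\<bar>"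
      using xy by (intro mult_right_mono mult_le_one) auto
    finally have "x * (1 - y) * (deriv_R a - deriv_L a) \<le> \<bar>deriv_L a - deriv_R a\<bar>" by simp
    then have "x * (1 - y) * (deriv_R a - deriv_L a) \<le> \<eta>" using near by linarith
    moreover have "(1 - x) * (1 - y) * c \<le> (1 - x) * (1 - y) * deriv_L a" "x * y * c \<le> x * y * (deriv_L a - both_L a)"
      using xy near by (auto intro!: mult_left_mono)
    ultimately show ?thesis by (simp add: algebra_simps)
  qed
  ultimately have gap: "c * e / 2 - \<eta> \<le> deriv_L a - ((1 - x) * y * deriv_L a + x * (1 - y) * deriv_R a + x * y * both_L a)"
    by (simp add: algebra_simps)
  \<comment> \<open>\<open>binomial_pair_lower\<close> lowers both sizes by one, but w only uses up
    a vertex of A, so nb may be restored.\<close>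
  have low: "real na ^ i * real nb ^ j \<le> fact i * real ((na - 1) choose i) * (fact j * real (nb choose j)) + real (2 * k * (k + 1)) * q / n"
    if "i + j = k - 1" for i j
  proof -
    have "real na ^ i * real nb ^ j \<le> fact i * real ((na - 1) choose i) * (fact j * real ((nb - 1) choose j))
      + real (i * (i + 1) + j * (j + 1)) * real n ^ (i + j) / real n"
      using nab n1 by (intro binomial_pair_lower) auto
    also have "\<dots> \<le> fact i * real ((na - 1) choose i) * (fact j * real (nb choose j)) + real (2 * k * (k + 1)) * q / n"
    proof (intro add_mono mult_left_mono divide_right_mono)
      have "i \<le> k" "j \<le> k" using that by auto
      then have "i * (i + 1) \<le> k * (k + 1)" "j * (j + 1) \<le> k * (k + 1)" by (intro mult_le_mono; simp)+
      then have "i * (i + 1) + j * (j + 1) \<le> 2 * k * (k + 1)" by linarith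
      then have "real (i * (i + 1) + j * (j + 1)) \<le> real (2 * k * (k + 1))" by (rule of_nat_mono)
      then show "real (i * (i + 1) + j * (j + 1)) * real n ^ (i + j) \<le> real (2 * k * (k + 1)) * q"
        unfolding that q_def by (intro mult_right_mono) auto
      show "real ((nb - 1) choose j) \<le> real (nb choose j)" by (intro of_nat_mono binomial_right_mono) auto
    qed auto
    finally show ?thesis .
  qed
  have "q * deriv_L a = real s * (real na ^ (s - 1) * real nb ^ t) + real t * (real na ^ (t - 1) * real nb ^ s)"
  proof -
    have na: "real na = a * n" "real nb = (1 - a) * n" using an a(3) n1 by auto
    show ?thesis unfolding na pw deriv_L_def by (simp only: distrib_left mult_ac)
  qed
  also have "\<dots> \<le> real s * (fact (s - 1) * real ((na - 1) choose (s - 1)) * (fact t * real (nb choose t)) + real (2 * k * (k + 1)) * q / n)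
     + real t * (fact (t - 1) * real ((na - 1) choose (t - 1)) * (fact s * real (nb choose s)) + real (2 * k * (k + 1)) * q / n)"
    using low exps by (intro add_mono mult_left_mono) auto
  also have "\<dots> = S * real LB + real k * (real (2 * k * (k + 1)) * q / n)"
  proof -
    have "S * real LB = real s * (fact (s - 1) * real ((na - 1) choose (s - 1)) * (fact t * real (nb choose t)))
      + real t * (fact (t - 1) * real ((na - 1) choose (t - 1)) * (fact s * real (nb choose s)))"
      unfolding LB_def of_nat_add of_nat_mult distrib_left by (subst Ss(1), subst Ss(2)) (simp add: mult_ac)
    then show ?thesis by (simp only: distrib_left distrib_right of_nat_add add_ac)
  qed
  also have "real k * (real (2 * k * (k + 1)) * q / n) = 2 * real (k * k * (k + 1)) / n * q"
    by (simp add: algebra_simps)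
  finally have LB: "q * deriv_L a \<le> S * real LB + 2 * real (k * k * (k + 1)) / n * q" .
  have rr: "real r \<le> \<delta> * 2 ^ k * q"
  proof -
    have "real r * real n ^ 3 \<le> real (card (defects E A V)) * (2 ^ k * real n ^ k)"
      using of_nat_mono[OF r, where 'a=real] by (simp add: n_def)
    also have "\<dots> \<le> \<delta> * (real n)\<^sup>2 * (2 ^ k * real n ^ k)" using \<delta> by (intro mult_right_mono) auto
    also have "real n ^ k = n * q" using s_pos by (simp add: q_def flip: power_Suc)
    also have "\<delta> * (real n)\<^sup>2 * (2 ^ k * (n * q)) = (\<delta> * 2 ^ k * q) * real n ^ 3"
      by (simp add: power2_eq_square power3_eq_cube mult_ac)
    finally show ?thesis using n1 by (simp add: mult_le_cancel_right)
  qed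
  have "real (card (bicliques s t E V)) + real LB \<le> real (card (bicliques s t (fix_vertex A w E) V)) + 2 * real r + real UB"
    using of_nat_mono[OF le, where 'a=real] unfolding LB_def UB_def by simp
  then have "S * (real (card (bicliques s t E V)) + real LB) \<le> S * (real (card (bicliques s t (fix_vertex A w E) V)) + 2 * real r + real UB)"
    using S_pos by (intro mult_left_mono) auto
  then have "S * real (card (bicliques s t E V)) + S * real LB
      \<le> S * real (card (bicliques s t (fix_vertex A w E) V)) + 2 * (S * real r) + S * real UB"
    by (simp add: algebra_simps)
  moreover have "S * real r \<le> S * (\<delta> * 2 ^ k * q)" using rr S_pos by (intro mult_left_mono) auto
  moreover have "q * (c * e / 2 - \<eta>) \<le> q * (deriv_L a - ((1 - x) * y * deriv_L a + x * (1 - y) * deriv_R a + x * y * both_L a))"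
    using gap q by (intro mult_left_mono) auto
  ultimately have "S * real (card (bicliques s t E V)) + (q * (c * e / 2 - \<eta>) - 2 * real (k * k * (k + 1)) / n * q - 2 * (S * (\<delta> * 2 ^ k * q)))
      \<le> S * real (card (bicliques s t (fix_vertex A w E) V))"
    using LB UB unfolding right_diff_distrib by linarith
  moreover have "q * (c * e / 2 - \<eta>) - 2 * real (k * k * (k + 1)) / n * q - 2 * (S * (\<delta> * 2 ^ k * q))
    = (c * e / 2 - \<eta> - 2 * real (k * k * (k + 1)) / n - 2 * S * \<delta> * 2 ^ k) * q"
    by (simp only: left_diff_distrib right_diff_distrib mult_ac)
  ultimately show ?thesis unfolding q_def by simp
qed

text \<open>Both parts are large, so a fixed proportion of n^(k-2) copies of the cut pass through a
  given pair. Those affected by other wrong pairs are at most 5 e 2^k n^(k-2): the error with three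
  prescribed vertices is 2 e and counts twice, the one with four is e and counts once.\<close>

lemma edge_gain:
  fixes V A :: "'a set" and E :: "'a \<Rightarrow> 'a \<Rightarrow> bool" and u :: 'a and a e :: real
  assumes fin: "finite V" and A: "A \<subseteq> V" "u \<in> A" and E: "symp E" "irreflp E"
    and uv: "(u, v) \<in> defects E A V"
  defines "n \<equiv> card V"
  assumes a: "0 < a" "a \<le> 1" "a * n \<le> card A" "a * n \<le> card (V - A)" "4 \<le> a * n" "2 * real k \<le> a * n"
    and \<Delta>: "\<And>x. x \<in> V \<Longrightarrow> real (card {y. (x, y) \<in> defects E A V}) \<le> e * n" and e: "0 \<le> e"
  shows "real (card (bicliques s t E V)) + ((a / (2 * real k)) ^ (k - 2) - 5 * e * 2 ^ k) * real n ^ (k - 2)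
      \<le> real (card (bicliques s t (fix_edge A u v E) V))"
proof -
  define q where "q = real n ^ (k - 2)"
  have k2: "k - 2 + 2 = k" "3 \<le> k" using s_pos t_ge2 by auto
  have "n \<noteq> 0" using a by (cases "n = 0") auto
  then have n1: "n \<ge> 1" by simp
  have q: "q > 0" using n1 by (simp add: q_def)
  have nk: "real n ^ k = q * (real n)\<^sup>2" unfolding q_def power_add[symmetric] k2 ..
  define \<Delta>' where "\<Delta>' = nat \<lfloor>e * n\<rfloor>"
  have "card {y. (x, y) \<in> defects E A V} \<le> \<Delta>'" if "x \<in> V" for x
    using \<Delta>[OF that] unfolding \<Delta>'_def by (simp add: le_nat_floor)
  moreover have \<Delta>'_le: "real \<Delta>' \<le> e * n" unfolding \<Delta>'_def using e by (simp add: of_nat_floor)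
  ultimately obtain r r' where r: "r * card V ^ 3 \<le> 2 * \<Delta>' * (2 ^ (s + t) * card V ^ (s + t))"
    and r': "r' * card V ^ 4 \<le> card V * \<Delta>' * (2 ^ (s + t) * card V ^ (s + t))"
    and le: "card (bicliques s t E V) + card (bicliques_at s t (cut A) V {u, v})
     \<le> card (bicliques s t (fix_edge A u v E) V) + 2 * r + r'"
    using card_bicliques_fix_edge[OF fin uv E, of s t \<Delta>'] k2 by blast
  have rr: "real r \<le> 2 * e * 2 ^ k * q"
  proof -
    have "real r * real n ^ 3 \<le> 2 * real \<Delta>' * (2 ^ k * real n ^ k)"
      using of_nat_mono[OF r, where 'a=real] by (simp add: n_def)
    also have "\<dots> \<le> 2 * (e * n) * (2 ^ k * real n ^ k)" using \<Delta>'_le by (intro mult_mono) (use e in auto)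
    also have "\<dots> = (2 * e * 2 ^ k * q) * real n ^ 3"
      by (simp add: nk power2_eq_square power3_eq_cube mult_ac)
    finally show ?thesis using n1 by (simp add: mult_le_cancel_right)
  qed
  have rr': "real r' \<le> e * 2 ^ k * q"
  proof -
    have "real r' * real n ^ 4 \<le> n * real \<Delta>' * (2 ^ k * real n ^ k)"
      using of_nat_mono[OF r', where 'a=real] by (simp add: n_def)
    also have "\<dots> \<le> n * (e * n) * (2 ^ k * real n ^ k)" using \<Delta>'_le by (intro mult_mono) (use e in auto)
    also have "\<dots> = (e * 2 ^ k * q) * real n ^ 4"
      by (simp add: nk power2_eq_square power4_eq_xxxx mult_ac)
    finally show ?thesis using n1 by (simp add: mult_le_cancel_right)
  qed
  have uvV: "u \<in> V" "v \<in> V" "u \<noteq> v" using uv E by (auto simp: defects_def cut_def irreflp_def)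
  define \<theta> where "\<theta> = a / (2 * real k)"
  have \<theta>: "0 < \<theta>" "\<theta> \<le> 1" using a k2 by (auto simp: \<theta>_def field_simps)
  have big: "\<theta> ^ j * real n ^ j \<le> real ((m - i) choose j)" if "a * n \<le> real m" "j \<le> k" "i \<le> 2" for m j i
    unfolding \<theta>_def using that a k2 by (intro binomial_ge_fraction) auto
  have prod: "\<theta> ^ (k - 2) * q \<le> real (p * p')"
    if "\<theta> ^ i * real n ^ i \<le> real p" "\<theta> ^ j * real n ^ j \<le> real p'" "i + j = k - 2" for i j p p'
  proof -
    have "(\<theta> ^ i * real n ^ i) * (\<theta> ^ j * real n ^ j) \<le> real p * real p'"
      using that \<theta> by (intro mult_mono) auto
    then show ?thesis unfolding q_def that(3)[symmetric] by (simp add: power_add mult_ac)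
  qed
  have "\<theta> ^ (k - 2) * q \<le> real (card (bicliques_at s t (cut A) V {u, v}))"
  proof (cases "v \<in> A")
    case False
    have "\<theta> ^ (k - 2) * q \<le> real (((card A - 1) choose (s - 1)) * ((card (V - A) - 1) choose (t - 1)))"
      using s_pos t_ge2 a by (intro prod[of "s - 1" _ "t - 1"] big) auto
    also have "\<dots> \<le> real (card (split_pairs s t A V ({u} \<union> {v})))"
      using card_split_pairs_ge[OF fin A(1), of "{u}" s "{v}" t] A uvV False s_pos t_ge2
      by (intro of_nat_mono) auto
    also have "\<dots> \<le> real (card (bicliques_at s t (cut A) V {u, v}))"
      using fin split_pairs_subset[of s t A V "{u, v}"]
      by (intro of_nat_mono card_mono) (simp_all add: insert_commute)
    finally show ?thesis .
  next
    case True
    \<comment> \<open>Both ends lie in A, so a copy of the cut has them on the same side; the side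
      of size t has room for them as t >= 2.\<close>
    have "\<theta> ^ (k - 2) * q \<le> real (((card (V - A) - 0) choose (s - 0)) * ((card A - 2) choose (t - 2)))"
      using s_pos t_ge2 a by (intro prod[of "s - 0" _ "t - 2"] big) auto
    also have "\<dots> \<le> real (card (split_pairs s t (V - A) V ({} \<union> {u, v})))"
      using card_split_pairs_ge[OF fin, of "V - A" "{}" s "{u, v}" t] A uvV True t_ge2
      by (intro of_nat_mono) (auto simp: double_diff numeral_2_eq_2)
    also have "\<dots> \<le> real (card (bicliques_at s t (cut A) V {u, v}))"
      using fin split_pairs_subset[of s t "V - A" V "{u, v}"]
      by (intro of_nat_mono card_mono) (auto simp: bicliques_at_cut_complement)
    finally show ?thesis .
  qed
  then have "real (card (bicliques s t E V)) + \<theta> ^ (k - 2) * q \<le> real (card (bicliques s t (fix_edge A u v E) V)) + 2 * real r + real r'"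
    using of_nat_mono[OF le, where 'a=real] by simp
  then have "real (card (bicliques s t E V)) + \<theta> ^ (k - 2) * q - 5 * e * 2 ^ k * q \<le> real (card (bicliques s t (fix_edge A u v E) V))"
    using rr rr' by linarith
  then show ?thesis unfolding \<theta>_def q_def by (simp add: algebra_simps)
qed

text \<open>This direction has no error term, since falling factorials are at most powers.\<close>

lemma cut_count_le:
  assumes "finite V" "A \<subseteq> V" "V \<noteq> {}"
  shows "S * real (card (bicliques s t (cut A) V)) \<le> f (card A / card V) * real (card V) ^ k"
proof -
  define n na nb where "n = card V" and "na = card A" and "nb = card (V - A)"
  have n1: "n > 0" using assms by (auto simp: n_def card_gt_0_iff)
  have finA: "finite A" "finite (V - A)" using assms by (auto intro: finite_subset)
  have nab: "na + nb = n" unfolding na_def nb_def n_def using card_Un_disjoint[of A "V - A"] finA assms by (simp add: Un_absorb1)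
  have up: "fact i * real (p choose i) * (fact j * real (p' choose j)) \<le> real p ^ i * real p' ^ j" for i j p p' :: nat
    using binomial_fact_le_power by (intro mult_mono) auto
  have "card (bicliques s t (cut A) V) = (na choose s) * (nb choose t) + (nb choose s) * (na choose t)"
    using card_bicliques_cut[OF assms(1,2), of s t] s_pos t_ge2 by (simp add: na_def nb_def)
  then have "S * real (card (bicliques s t (cut A) V)) = fact s * real (na choose s) * (fact t * real (nb choose t))
     + fact s * real (nb choose s) * (fact t * real (na choose t))"
    by (simp add: S_def algebra_simps)
  also have "\<dots> \<le> real na ^ s * real nb ^ t + real nb ^ s * real na ^ t" by (intro add_mono up)
  also have "\<dots> = f (na / n) * real n ^ k"
  proof -
    have "1 - na / n = nb / n" using nab n1 by (simp add: field_simps)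
    then show ?thesis using n1 by (simp add: f_st_def power_add power_divide field_simps)
  qed
  finally show ?thesis by (simp add: n_def na_def)
qed

end

subsection \<open>Stability\<close>

lemma defect_neighbours:
  assumes "w \<in> A" "A \<subseteq> V" "irreflp E"
  shows "{y. (w, y) \<in> defects E A V} = (A \<inter> {v \<in> V. E w v}) \<union> (V - A - {v \<in> V. E w v})"
  using assms by (auto simp: defects_def cut_def irreflp_def)

text \<open>Moving w to the other side of the cut exchanges the right and the wrong pairs at w and
  affects no others. By minimality at most half of the pairs at w are wrong.\<close>

lemma minimal_defect_degree:
  assumes fin: "finite V" and A: "w \<in> A" "A \<subseteq> V" and E: "symp E" "irreflp E"
    and min: "\<And>B. B \<subseteq> V \<Longrightarrow> card (defects E A V) \<le> card (defects E B V)"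
  shows "2 * card {y. (w, y) \<in> defects E A V} \<le> card V"
proof -
  define G where "G = {y. (w, y) \<in> defects E A V}"
  define D where "D = {p \<in> defects E A V. fst p \<noteq> w \<and> snd p \<noteq> w}"
  have wG: "w \<notin> G" "G \<subseteq> V" using A E by (auto simp: G_def defects_def irreflp_def cut_def)
  have fins: "finite G" "finite D" using fin wG by (auto simp: D_def intro: finite_subset)
  have sym: "(y, w) \<in> defects E A V \<longleftrightarrow> y \<in> G" for y
    using E by (auto simp: G_def defects_def cut_def symp_def)
  have disj: "card (D \<union> ({w} \<times> H \<union> H \<times> {w})) = card D + 2 * card H" if "finite H" "w \<notin> H" for H
  proof -
    have "card (D \<union> ({w} \<times> H \<union> H \<times> {w})) = card D + card ({w} \<times> H \<union> H \<times> {w})"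
      using fins that by (intro card_Un_disjoint) (auto simp: D_def)
    also have "card ({w} \<times> H \<union> H \<times> {w}) = card ({w} \<times> H) + card (H \<times> {w})"
      using that by (intro card_Un_disjoint) auto
    finally show ?thesis by (simp add: card_cartesian_product)
  qed
  have "D \<union> ({w} \<times> G \<union> G \<times> {w}) \<subseteq> defects E A V" using sym by (auto simp: D_def G_def)
  then have 1: "card D + 2 * card G \<le> card (defects E A V)"
    using card_mono[OF finite_defects[OF fin]] disj[OF fins(1) wG(1)] by metis
  define H where "H = V - insert w G"
  have H: "finite H" "w \<notin> H" using fin by (auto simp: H_def)
  have "defects E (A - {w}) V \<subseteq> D \<union> ({w} \<times> H \<union> H \<times> {w})"
  proof (rule subrelI, rule ccontr)
    fix x y assume "(x, y) \<in> defects E (A - {w}) V" "(x, y) \<notin> D \<union> ({w} \<times> H \<union> H \<times> {w})"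
    then have xy: "(x, y) \<in> defects E (A - {w}) V" "(x, y) \<notin> {w} \<times> H" "(x, y) \<notin> H \<times> {w}" "(x, y) \<notin> D"
      by auto
    have ne: "x \<noteq> y" using defects_irrefl[OF E(2) xy(1)] by simp
    have xyV: "x \<in> V" "y \<in> V" and d: "E x y \<noteq> cut (A - {w}) x y" using xy by (auto simp: defects_def)
    have "x \<noteq> w"
    proof
      assume "x = w"
      then have "y \<in> G" using xy ne xyV by (auto simp: H_def)
      then show False using d A ne \<open>x = w\<close> by (auto simp: G_def defects_def cut_def)
    qed
    moreover have "y \<noteq> w"
    proof
      assume "y = w"
      then have "x \<in> G" using xy ne xyV by (auto simp: H_def)
      then have "(x, w) \<in> defects E A V" using sym by simp
      then show False using d A ne \<open>y = w\<close> by (auto simp: defects_def cut_def)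
    qed
    ultimately have "(x, y) \<in> D" using d xyV by (auto simp: D_def defects_def cut_def)
    with xy(4) show False by simp
  qed
  then have "card (defects E (A - {w}) V) \<le> card (D \<union> ({w} \<times> H \<union> H \<times> {w}))"
    using fins H by (intro card_mono) auto
  then have 2: "card (defects E (A - {w}) V) \<le> card D + 2 * card H" using disj[OF H] by simp
  have "card H = card V - Suc (card G)"
    unfolding H_def using fins wG A by (subst card_Diff_subset) auto
  moreover have "card (defects E A V) \<le> card (defects E (A - {w}) V)" using A by (intro min) auto
  ultimately show ?thesis using 1 2 unfolding G_def[symmetric] by linarith
qed

context biclique_params
begin

text \<open>A vertex with more than e n wrong pairs is corrected as a whole; if there is none, a
  single wrong pair is. The number g bounds the decrease of the defects for every cut, because the
  minimal cut may change with the relation. The gain is at least \<gamma> n^(k-2) per unit of g,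
  where g = 2 n for a vertex and g = 2 for a pair.\<close>

lemma improvement:
  fixes V A :: "'a set" and E :: "'a \<Rightarrow> 'a \<Rightarrow> bool" and a e \<delta> \<eta> c \<gamma> \<epsilon> :: real
  assumes fin: "finite V" and A: "A \<subseteq> V" and E: "symp E" "irreflp E"
    and min: "\<And>B. B \<subseteq> V \<Longrightarrow> card (defects E A V) \<le> card (defects E B V)"
    and ne: "defects E A V \<noteq> {}"
    and near: "\<And>x. 0 \<le> x \<Longrightarrow> x \<le> 1 \<Longrightarrow> f x \<ge> M - \<epsilon> \<Longrightarrow>
       \<bar>deriv_L x - deriv_R x\<bar> < \<eta> \<and> deriv_L x \<ge> c \<and> deriv_L x - both_L x \<ge> c \<and> a \<le> x \<and> a \<le> 1 - x"
    and fA: "f (card A / card V) \<ge> M - \<epsilon>"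
    and c: "c > 0" and a: "0 < a" "4 \<le> a * card V" "2 * real k \<le> a * card V"
    and \<delta>: "real (card (defects E A V)) \<le> \<delta> * (real (card V))\<^sup>2"
    and e: "0 < e"
    and \<gamma>: "2 * \<gamma> * S \<le> c * e / 2 - \<eta> - 2 * real (k * k * (k + 1)) / card V - 2 * S * \<delta> * 2 ^ k"
      "2 * \<gamma> \<le> (a / (2 * real k)) ^ (k - 2) - 5 * e * 2 ^ k"
  shows "\<exists>E' g. symp E' \<and> irreflp E' \<and> card (defects E' A V) < card (defects E A V) \<and>
    (\<forall>B. card (defects E B V) \<le> card (defects E' B V) + g) \<and>
    real (card (bicliques s t E V)) + \<gamma> * real (card V) ^ (k - 2) * real g \<le> real (card (bicliques s t E' V))"
proof -
  define n where "n = card V"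
  have n1: "n \<ge> 1" using a by (cases "card V = 0") (auto simp: n_def)
  have k3: "k \<ge> 3" using s_pos t_ge2 by simp
  \<comment> \<open>The gain estimates want the vertex in the first part. If it is not, the
    complement of A describes the same cut with the mirrored proportion, and f is symmetric.\<close>
  have side: "\<exists>B. B \<subseteq> V \<and> x \<in> B \<and> (\<forall>E. defects E B V = defects E A V) \<and> f (card B / n) \<ge> M - \<epsilon>" if x: "x \<in> V" for x
  proof (cases "x \<in> A")
    case True
    then show ?thesis using A fA by (auto simp: n_def)
  next
    case False
    have "card A \<le> n" using A fin by (simp add: n_def card_mono)
    then have "real (card (V - A)) = real n - real (card A)"
      using A fin by (simp add: card_Diff_subset finite_subset[OF A] n_def of_nat_diff)
    then have "real (card (V - A)) / n = 1 - card A / n" using n1 by (simp add: diff_divide_distrib)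
    then have "f (card (V - A) / n) \<ge> M - \<epsilon>" using fA f_mirror by (simp add: n_def)
    with False x show ?thesis using defects_complement[OF A] by (intro exI[of _ "V - A"]) auto
  qed
  have frac: "a \<le> card B / n \<and> a \<le> 1 - card B / n \<and> B \<noteq> V \<and> 0 \<le> card B / n \<and> card B / n \<le> 1"
    if "B \<subseteq> V" "f (card B / n) \<ge> M - \<epsilon>" for B
  proof -
    have "card B \<le> n" using that fin by (simp add: n_def card_mono)
    then have 1: "0 \<le> card B / n" "card B / n \<le> 1" using n1 by auto
    with near[OF _ _ that(2)] a n1 show ?thesis by (auto simp: n_def)
  qed
  show ?thesis
  proof (cases "\<exists>w\<in>V. real (card {y. (w, y) \<in> defects E A V}) > e * n")
    case True
    then obtain w where w: "w \<in> V" "real (card {y. (w, y) \<in> defects E A V}) > e * n" by blast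
    obtain B where B: "B \<subseteq> V" "w \<in> B" "\<And>E. defects E B V = defects E A V" "f (card B / n) \<ge> M - \<epsilon>"
      using side[OF w(1)] by blast
    have nearB: "\<bar>deriv_L (card B / n) - deriv_R (card B / n)\<bar> < \<eta>" "deriv_L (card B / n) \<ge> c"
      "deriv_L (card B / n) - both_L (card B / n) \<ge> c" "B \<noteq> V"
      using near[OF _ _ B(4)] frac[OF B(1,4)] by auto
    let ?N = "{v \<in> V. E w v}"
    have deg: "card {y. (w, y) \<in> defects E A V} = card (B \<inter> ?N) + card (V - B - ?N)"
      unfolding B(3)[symmetric] defect_neighbours[OF B(2,1) E(2)]
      using fin finite_subset[OF B(1) fin] by (intro card_Un_disjoint) auto
    have "2 * card {y. (w, y) \<in> defects E A V} \<le> n"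
      using minimal_defect_degree[OF fin B(2,1) E] min unfolding B(3) n_def by blast
    then have "real (2 * card {y. (w, y) \<in> defects E A V}) \<le> real n" by (rule of_nat_mono)
    then have deg2: "real (card (B \<inter> ?N) + card (V - B - ?N)) \<le> n / 2" unfolding deg by simp
    let ?E = "fix_vertex B w E"
    have gain: "S * real (card (bicliques s t E V)) +
      (c * e / 2 - \<eta> - 2 * real (k * k * (k + 1)) / n - 2 * S * \<delta> * 2 ^ k) * real n ^ (k - 1)
      \<le> S * real (card (bicliques s t ?E V))"
      unfolding n_def
    proof (rule vertex_gain[OF fin B(1,2) nearB(4) E])
      show "e * real (card V) \<le> real (card (B \<inter> ?N) + card (V - B - ?N))"
        using w(2) unfolding deg n_def by simp
      show "real (card (B \<inter> ?N) + card (V - B - ?N)) \<le> real (card V) / 2" using deg2 by (simp add: n_def)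
    qed (use nearB c \<delta> e B(3) in \<open>auto simp: n_def\<close>)
    have "S * (2 * \<gamma> * real n ^ (k - 1)) = (2 * \<gamma> * S) * real n ^ (k - 1)" by simp
    also have "\<dots> \<le> (c * e / 2 - \<eta> - 2 * real (k * k * (k + 1)) / n - 2 * S * \<delta> * 2 ^ k) * real n ^ (k - 1)"
      using \<gamma>(1) by (intro mult_right_mono) (auto simp: n_def)
    finally have "S * (real (card (bicliques s t E V)) + 2 * \<gamma> * real n ^ (k - 1)) \<le> S * real (card (bicliques s t ?E V))"
      using gain by (simp only: distrib_left)
    then have "real (card (bicliques s t E V)) + 2 * \<gamma> * real n ^ (k - 1) \<le> real (card (bicliques s t ?E V))"
      using S_pos by (simp add: mult_le_cancel_left)
    moreover have "2 * \<gamma> * real n ^ (k - 1) = \<gamma> * real n ^ (k - 2) * real (2 * n)"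
    proof -
      have "k - 1 = Suc (k - 2)" using k3 by simp
      then show ?thesis by simp
    qed
    ultimately have "real (card (bicliques s t E V)) + \<gamma> * real n ^ (k - 2) * real (2 * n) \<le> real (card (bicliques s t ?E V))"
      by linarith
    moreover have "card (defects ?E A V) < card (defects E A V)"
    proof (rule psubset_card_mono)
      have "card {y. (w, y) \<in> defects E A V} \<noteq> 0"
      proof
        assume "card {y. (w, y) \<in> defects E A V} = 0"
        then have "e * n < 0" using w(2) by simp
        then show False using e n1 by (simp add: mult_less_0_iff)
      qed
      then have "{y. (w, y) \<in> defects E A V} \<noteq> {}" by (metis card.empty)
      then obtain y where "(w, y) \<in> defects E A V" by auto
      moreover have sub: "defects ?E A V = {p \<in> defects E A V. fst p \<noteq> w \<and> snd p \<noteq> w}"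
        using defects_fix_vertex[of B w E V] unfolding B(3) .
      ultimately have "(w, y) \<notin> defects ?E A V" "(w, y) \<in> defects E A V" by simp_all
      then show "defects ?E A V \<subset> defects E A V" using sub by blast
    qed (use fin in simp)
    moreover have "card (defects E C V) \<le> card (defects ?E C V) + 2 * n" for C
      unfolding n_def by (rule card_defects_star_le[OF fin w(1)]) (simp add: fix_vertex_def)
    ultimately show ?thesis
      using fix_vertex_symp[OF E(1)] fix_vertex_irreflp[OF E(2)] unfolding n_def
      by (intro exI[of _ ?E] exI[of _ "2 * card V"] conjI allI)
  next
    case False
    obtain u v where uv: "(u, v) \<in> defects E A V" using ne by auto
    then have uV: "u \<in> V" by (auto simp: defects_def)
    obtain B where B: "B \<subseteq> V" "u \<in> B" "\<And>E. defects E B V = defects E A V" "f (card B / n) \<ge> M - \<epsilon>"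
      using side[OF uV] by blast
    have fr: "a \<le> card B / n" "a \<le> 1 - card B / n" "a \<le> 1" using frac[OF B(1,4)] by auto
    have cB: "real (card (V - B)) = real n - real (card B)"
      using B fin by (simp add: card_Diff_subset finite_subset[OF B(1)] n_def of_nat_diff card_mono)
    let ?E = "fix_edge B u v E"
    have gain: "real (card (bicliques s t E V)) + ((a / (2 * real k)) ^ (k - 2) - 5 * e * 2 ^ k) * real n ^ (k - 2)
      \<le> real (card (bicliques s t ?E V))"
      unfolding n_def
    proof (rule edge_gain[OF fin B(1,2) E])
      show "(u, v) \<in> defects E B V" using uv B by simp
      show "a * real (card V) \<le> real (card B)" using fr n1 by (simp add: n_def field_simps)
      show "a * real (card V) \<le> real (card (V - B))" using fr n1 unfolding cB by (simp add: n_def field_simps)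
      show "real (card {y. (x, y) \<in> defects E B V}) \<le> e * real (card V)" if "x \<in> V" for x
        using False that unfolding B(3) n_def by (simp add: not_less)
    qed (use a e fr in auto)
    have "2 * \<gamma> * real n ^ (k - 2) \<le> ((a / (2 * real k)) ^ (k - 2) - 5 * e * 2 ^ k) * real n ^ (k - 2)"
      using \<gamma>(2) by (intro mult_right_mono) auto
    then have "real (card (bicliques s t E V)) + \<gamma> * real n ^ (k - 2) * real 2 \<le> real (card (bicliques s t ?E V))"
      using gain by (simp add: algebra_simps)
    moreover have "card (defects ?E A V) < card (defects E A V)"
    proof (rule psubset_card_mono)
      show "defects ?E A V \<subset> defects E A V"
        using defects_fix_edge[of B u v E V] uv unfolding B(3) by auto
    qed (use fin in simp)
    moreover have "card (defects E C V) \<le> card (defects ?E C V) + 2" for C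
      by (rule card_defects_fix_edge_le[OF fin])
    ultimately show ?thesis
      using fix_edge_symp[OF E(1)] fix_edge_irreflp[OF E(2)] unfolding n_def
      by (intro exI[of _ ?E] exI[of _ 2]) simp
  qed
qed

lemma minimal_cut:
  assumes "finite V"
  obtains A where "A \<subseteq> V" "\<And>B. B \<subseteq> V \<Longrightarrow> card (defects E A V) \<le> card (defects E B V)"
  using ex_has_least_nat[of "\<lambda>A. A \<subseteq> V" "{}" "\<lambda>A. card (defects E A V)"] by auto

text \<open>Corrections are repeated until no wrong pair is left, where the count is at most m. Each
  raises the count by \<gamma> n^(k-2) times what it can remove from the minimal number of defects,
  so the gains add up to the claimed loss. The hypotheses persist: counts do not fall and the
  minimal number of defects decreases.\<close>

lemma local_stability:
  obtains \<delta> \<gamma> \<epsilon> n\<^sub>0 :: real where "\<delta> > 0" "\<gamma> > 0" "\<epsilon> > 0"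
    "\<And>(V :: 'a set) E A m. finite V \<Longrightarrow> real (card V) \<ge> n\<^sub>0 \<Longrightarrow> symp E \<Longrightarrow> irreflp E \<Longrightarrow>
      (\<And>E. symp E \<Longrightarrow> irreflp E \<Longrightarrow> real (card (bicliques s t E V)) \<le> m) \<Longrightarrow>
      A \<subseteq> V \<Longrightarrow> (\<And>B. B \<subseteq> V \<Longrightarrow> card (defects E A V) \<le> card (defects E B V)) \<Longrightarrow>
      real (card (defects E A V)) \<le> \<delta> * (real (card V))\<^sup>2 \<Longrightarrow>
      (M - \<epsilon>) * real (card V) ^ k \<le> S * real (card (bicliques s t E V)) \<Longrightarrow>
      real (card (bicliques s t E V)) + \<gamma> * real (card V) ^ (k - 2) * real (card (defects E A V)) \<le> m"
proof -
  obtain c a where ca: "c > 0" "a > 0" and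
    near: "\<And>\<eta>. \<eta> > 0 \<Longrightarrow> \<exists>\<epsilon>>0. \<forall>x. 0 \<le> x \<and> x \<le> 1 \<and> f x \<ge> M - \<epsilon> \<longrightarrow>
       \<bar>deriv_L x - deriv_R x\<bar> < \<eta> \<and> deriv_L x \<ge> c \<and> deriv_L x - both_L x \<ge> c \<and> a \<le> x \<and> a \<le> 1 - x"
    by (rule stability_constants) blast
  have k3: "k \<ge> 3" using s_pos t_ge2 by simp
  define g where "g = (a / (2 * real k)) ^ (k - 2)"
  have g: "g > 0" using ca k3 by (auto simp: g_def)
  \<comment> \<open>Chosen so that 5 e 2^k = g / 2. Of the vertex gain c e / 2, each of \<eta>, the
    binomial error and the other wrong pairs then takes at most c e / 8, and c e / 8 remains for
    \<gamma>.\<close>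
  define e where "e = g / (10 * 2 ^ k)"
  have e: "e > 0" using g by (simp add: e_def)
  define \<eta> where "\<eta> = c * e / 8"
  have \<eta>: "\<eta> > 0" using ca e by (simp add: \<eta>_def)
  obtain \<epsilon>' where \<epsilon>': "\<epsilon>' > 0" "\<And>x. 0 \<le> x \<Longrightarrow> x \<le> 1 \<Longrightarrow> f x \<ge> M - \<epsilon>' \<Longrightarrow>
       \<bar>deriv_L x - deriv_R x\<bar> < \<eta> \<and> deriv_L x \<ge> c \<and> deriv_L x - both_L x \<ge> c \<and> a \<le> x \<and> a \<le> 1 - x"
    using near[OF \<eta>] by blast
  define \<delta> where "\<delta> = min (\<epsilon>' / 2) (c * e / 16) / (S * 2 ^ k)"
  have \<delta>: "\<delta> > 0" using ca e \<epsilon>' S_pos by (simp add: \<delta>_def)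
  have "S * \<delta> * 2 ^ k = min (\<epsilon>' / 2) (c * e / 16)" using S_pos by (simp add: \<delta>_def)
  then have S\<delta>: "S * \<delta> * 2 ^ k \<le> \<epsilon>' / 2" "S * \<delta> * 2 ^ k \<le> c * e / 16" by auto
  define \<gamma> where "\<gamma> = min (g / 4) (c * e / (16 * S))"
  have \<gamma>: "\<gamma> > 0" using g ca e S_pos by (simp add: \<gamma>_def)
  have \<gamma>2: "2 * \<gamma> \<le> g - 5 * e * 2 ^ k" by (simp add: \<gamma>_def e_def)
  have "\<gamma> * S \<le> c * e / (16 * S) * S" using S_pos by (intro mult_right_mono) (auto simp: \<gamma>_def)
  then have \<gamma>1: "2 * \<gamma> * S \<le> c * e / 8" using S_pos by simp
  define n\<^sub>0 where "n\<^sub>0 = max (max (4 / a) (2 * real k / a)) (16 * real (k * k * (k + 1)) / (c * e))"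
  show ?thesis
  proof (rule that[of \<delta> \<gamma> "\<epsilon>' / 2" n\<^sub>0])
    fix V :: "'a set" and E A and m :: real
    assume fin: "finite V" and n0: "real (card V) \<ge> n\<^sub>0"
      and m: "\<And>E. symp E \<Longrightarrow> irreflp E \<Longrightarrow> real (card (bicliques s t E V)) \<le> m"
    define n where "n = card V"
    have big: "4 / a \<le> n" "2 * real k / a \<le> n" "16 * real (k * k * (k + 1)) / (c * e) \<le> n"
      using n0 by (auto simp: n\<^sub>0_def n_def)
    then have an: "4 \<le> a * n" "2 * real k \<le> a * n" using ca by (simp_all add: field_simps)
    then have n1: "n \<ge> 1" by (cases "n = 0") auto
    have err: "2 * real (k * k * (k + 1)) / n \<le> c * e / 8" using big(3) ca e n1 by (simp add: field_simps)
    have step1: "2 * \<gamma> * S \<le> c * e / 2 - \<eta> - 2 * real (k * k * (k + 1)) / n - 2 * S * \<delta> * 2 ^ k"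
      using err S\<delta>(2) \<gamma>1 unfolding \<eta>_def by linarith
    assume E: "symp E" "irreflp E" "A \<subseteq> V" "\<And>B. B \<subseteq> V \<Longrightarrow> card (defects E A V) \<le> card (defects E B V)"
      "real (card (defects E A V)) \<le> \<delta> * (real (card V))\<^sup>2"
      "(M - \<epsilon>' / 2) * real (card V) ^ k \<le> S * real (card (bicliques s t E V))"
    then show "real (card (bicliques s t E V)) + \<gamma> * real (card V) ^ (k - 2) * real (card (defects E A V)) \<le> m"
    proof (induction "card (defects E A V)" arbitrary: E A rule: less_induct)
      case less
      show ?case
      proof (cases "defects E A V = {}")
        case True
        then show ?thesis using m[OF less.prems(1,2)] by simp
      next
        case False
        obtain r where r: "r * card V ^ 2 \<le> card (defects E A V) * (2 ^ (s + t) * card V ^ (s + t))"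
          "card (bicliques s t E V) \<le> card (bicliques s t (cut A) V) + r"
          by (rule card_bicliques_le_cut[OF fin less.prems(1,2), of A s t])
        \<comment> \<open>Few wrong pairs change the count little, so the cut itself is nearly
          extremal and its proportion nearly optimal. Half of \<open>\<epsilon>'\<close> is spent on
          the deficit of E, half on its wrong pairs.\<close>
        have "real r * (real n)\<^sup>2 \<le> real (card (defects E A V)) * (2 ^ k * real n ^ k)"
          using of_nat_mono[OF r(1), where 'a=real] by (simp add: n_def)
        also have "\<dots> \<le> \<delta> * (real n)\<^sup>2 * (2 ^ k * real n ^ k)"
          using less.prems(5) by (intro mult_right_mono) (auto simp: n_def)
        also have "\<dots> = (\<delta> * 2 ^ k * real n ^ k) * (real n)\<^sup>2" by simp
        finally have rr: "real r \<le> \<delta> * 2 ^ k * real n ^ k" using n1 by (simp add: mult_le_cancel_right)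
        have "(M - \<epsilon>' / 2) * real n ^ k \<le> S * real (card (bicliques s t E V))" using less.prems(6) by (simp add: n_def)
        also have "\<dots> \<le> S * (real (card (bicliques s t (cut A) V)) + real r)"
          using of_nat_mono[OF r(2), where 'a=real] S_pos by (intro mult_left_mono) auto
        also have "\<dots> = S * real (card (bicliques s t (cut A) V)) + S * real r" by (simp add: distrib_left)
        also have "\<dots> \<le> f (card A / n) * real n ^ k + S * (\<delta> * 2 ^ k * real n ^ k)"
        proof (intro add_mono mult_left_mono)
          have "V \<noteq> {}" using n1 by (auto simp: n_def)
          then show "S * real (card (bicliques s t (cut A) V)) \<le> f (card A / n) * real n ^ k"
            using cut_count_le[OF fin less.prems(3)] by (simp add: n_def)
        qed (use rr S_pos in auto)
        also have "\<dots> = (f (card A / n) + S * \<delta> * 2 ^ k) * real n ^ k" by (simp add: algebra_simps)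
        finally have "M - \<epsilon>' / 2 \<le> f (card A / n) + S * \<delta> * 2 ^ k" using n1 by (simp add: mult_le_cancel_right)
        then have fA: "f (card A / card V) \<ge> M - \<epsilon>'" using S\<delta>(1) unfolding n_def by linarith
        obtain E' h where E': "symp E'" "irreflp E'" "card (defects E' A V) < card (defects E A V)"
          "\<And>B. card (defects E B V) \<le> card (defects E' B V) + h"
          "real (card (bicliques s t E V)) + \<gamma> * real (card V) ^ (k - 2) * real h \<le> real (card (bicliques s t E' V))"
          using improvement[OF fin less.prems(3,1,2,4) False \<epsilon>'(2) fA ca(1,2) _ _ less.prems(5) e, of \<gamma>]
            an step1 \<gamma>2 unfolding n_def g_def by blast
        \<comment> \<open>The cut is optimised anew for the corrected relation; this keeps the
          degree bound at 1/2 available.\<close>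
        obtain A' where A': "A' \<subseteq> V" "\<And>B. B \<subseteq> V \<Longrightarrow> card (defects E' A' V) \<le> card (defects E' B V)"
          using minimal_cut[OF fin] by blast
        have A'_less: "card (defects E' A' V) < card (defects E A V)"
          using A'(2)[OF less.prems(3)] E'(3) by linarith
        have "0 \<le> \<gamma> * real (card V) ^ (k - 2) * real h" using \<gamma> by simp
        then have "real (card (bicliques s t E V)) \<le> real (card (bicliques s t E' V))" using E'(5) by linarith
        then have "S * real (card (bicliques s t E V)) \<le> S * real (card (bicliques s t E' V))"
          using S_pos by (intro mult_left_mono) auto
        then have IH: "real (card (bicliques s t E' V)) + \<gamma> * real (card V) ^ (k - 2) * real (card (defects E' A' V)) \<le> m"
          using less.prems(5,6) A'_less
          by (intro less.hyps[OF A'_less E'(1,2) A']) auto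
        have "card (defects E A V) \<le> card (defects E' A' V) + h"
          using less.prems(4)[OF A'(1)] E'(4)[of A'] by linarith
        then have "real (card (defects E A V)) \<le> real (card (defects E' A' V)) + real h" by linarith
        then have "\<gamma> * real (card V) ^ (k - 2) * real (card (defects E A V)) \<le>
          \<gamma> * real (card V) ^ (k - 2) * (real (card (defects E' A' V)) + real h)"
          using \<gamma> by (intro mult_left_mono) auto
        then show ?thesis using IH E'(5) by (simp add: distrib_left)
      qed
    qed
  qed (use \<delta> \<gamma> \<epsilon>' in auto)
qed

end

text \<open>The measure is lexicographic: the number of copies weighted by K + 1, more than any
  number of twin pairs, plus the number of twin pairs. It is bounded, so symmetrisation stops. The
  property is carried backwards, from the more symmetric relation to the given one.\<close>

lemma zykov_induct [consumes 3, case_names multipartite step]: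
  assumes fin: "finite V" and E: "symp E" "irreflp E"
    and base: "\<And>E. symp E \<Longrightarrow> irreflp E \<Longrightarrow> (\<And>u v. u \<in> V \<Longrightarrow> v \<in> V \<Longrightarrow> \<not> E u v \<Longrightarrow> twin E V u v) \<Longrightarrow> P E"
    and step: "\<And>E E' u. symp E \<Longrightarrow> irreflp E \<Longrightarrow> symp E' \<Longrightarrow> irreflp E' \<Longrightarrow> u \<in> V \<Longrightarrow>
      (\<And>x y. x \<noteq> u \<Longrightarrow> y \<noteq> u \<Longrightarrow> E' x y = E x y) \<Longrightarrow>
      card (bicliques s t E V) \<le> card (bicliques s t E' V) \<Longrightarrow> P E' \<Longrightarrow> P E"
  shows "P E"
proof -
  define K where "K = card (V \<times> V)"
  define m where "m E = card (bicliques s t E V) * (K + 1) + card (twin_pairs E V)" for E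
  define B where "B = card (size_pairs s t V) * (K + 1) + K"
  have le: "card (bicliques s t E V) \<le> card (size_pairs s t V)" "card (twin_pairs E V) \<le> K" for E
  proof -
    show "card (bicliques s t E V) \<le> card (size_pairs s t V)"
      using fin by (intro card_mono bicliques_subset) simp
    have "twin_pairs E V \<subseteq> V \<times> V" by (auto simp: twin_pairs_def)
    then show "card (twin_pairs E V) \<le> K" using fin unfolding K_def by (intro card_mono) auto
  qed
  have mB: "m E \<le> B" for E unfolding m_def B_def by (intro add_mono mult_right_mono le) simp
  show ?thesis using E
  proof (induction "B - m E" arbitrary: E rule: less_induct)
    case less
    show ?case
    proof (cases "\<exists>u\<in>V. \<exists>v\<in>V. \<not> E u v \<and> \<not> twin E V u v")
      case False
      then show ?thesis using base[OF less.prems] by blast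
    next
      case True
      obtain E' u where E': "symp E'" "irreflp E'" "u \<in> V" "\<And>x y. x \<noteq> u \<Longrightarrow> y \<noteq> u \<Longrightarrow> E' x y = E x y"
        "card (bicliques s t E V) \<le> card (bicliques s t E' V)"
        "card (bicliques s t E V) < card (bicliques s t E' V) \<or> card (twin_pairs E V) < card (twin_pairs E' V)"
        by (rule zykov_step[OF fin less.prems True, of s t]) blast
      have "m E < m E'"
      proof (cases "card (bicliques s t E V) < card (bicliques s t E' V)")
        case True
        have "m E < (card (bicliques s t E V) + 1) * (K + 1)"
          using le(2)[of E] unfolding m_def by simp
        also have "\<dots> \<le> card (bicliques s t E' V) * (K + 1)"
          using True by (intro mult_right_mono) auto
        also have "\<dots> \<le> m E'" by (simp add: m_def)
        finally show ?thesis .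
      next
        case False
        then show ?thesis using E'(5,6) unfolding m_def by simp
      qed
      then have "B - m E' < B - m E" using mB[of E'] by linarith
      then have "P E'" using less.hyps E'(1,2) by blast
      then show ?thesis using step[OF less.prems E'(1-5)] by blast
    qed
  qed
qed

text \<open>The parts are the twin classes; twins are never adjacent because the relation is
  irreflexive.\<close>

lemma multipartite_partition:
  assumes E: "irreflp E" and twins: "\<And>u v. u \<in> V \<Longrightarrow> v \<in> V \<Longrightarrow> \<not> E u v \<Longrightarrow> twin E V u v"
  obtains P where "partition_on V P" "\<And>u v. u \<in> V \<Longrightarrow> v \<in> V \<Longrightarrow> E u v \<longleftrightarrow> \<not> (\<exists>A\<in>P. u \<in> A \<and> v \<in> A)"
proof -
  define r where "r = {(x, y) \<in> V \<times> V. twin E V x y}"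
  have equiv: "equiv V r"
    by (rule equivI) (auto simp: r_def twin_def refl_on_def sym_def trans_def)
  show ?thesis
  proof (rule that)
    show "partition_on V (V // r)" using equiv by (rule partition_on_quotient)
    fix u v assume uv: "u \<in> V" "v \<in> V"
    have "\<not> E u v \<longleftrightarrow> (u, v) \<in> r"
      using twins[OF uv] uv E by (auto simp: r_def twin_def irreflp_def)
    moreover have "(\<exists>A\<in>V // r. u \<in> A \<and> v \<in> A) \<longleftrightarrow> (u, v) \<in> r"
      using uv equiv quotient_eqI[OF equiv] by (meson ImageI Image_singleton_iff equiv_class_self in_quotient_imp_in_rel quotientI
        insert_subset empty_subsetI)
    ultimately show "E u v \<longleftrightarrow> \<not> (\<exists>A\<in>V // r. u \<in> A \<and> v \<in> A)" by blast
  qed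
qed

section \<open>Asymptotic maximum and passage to arbitrary graphs\<close>

context biclique_params
begin

text \<open>The counterpart of \<open>cut_count_le\<close> with an error of order 1/n; the constant
  4 collects the errors of two orientations with two binomials each.\<close>

lemma cut_count_ge:
  assumes "finite V" "A \<subseteq> V" "V \<noteq> {}"
  shows "(f (card A / card V) - 4 * real (k * (k + 1)) / card V) * real (card V) ^ k \<le> S * real (card (bicliques s t (cut A) V))"
proof -
  define n na nb where "n = card V" and "na = card A" and "nb = card (V - A)"
  have n1: "n \<ge> 1" using assms by (simp add: n_def Suc_le_eq card_gt_0_iff)
  have finA: "finite A" "finite (V - A)" using assms by (auto intro: finite_subset)
  have nab: "na + nb = n" unfolding na_def nb_def n_def using card_Un_disjoint[of A "V - A"] finA assms by (simp add: Un_absorb1)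
  have low: "real u ^ i * real v ^ j \<le> fact i * real (u choose i) * (fact j * real (v choose j)) + real (2 * k * (k + 1)) * real n ^ k / n"
    if "u \<le> n" "v \<le> n" "i + j = k" for u v i j
  proof -
    have "real u ^ i * real v ^ j \<le> fact i * real ((u - 1) choose i) * (fact j * real ((v - 1) choose j))
      + real (i * (i + 1) + j * (j + 1)) * real n ^ (i + j) / real n"
      using that n1 by (intro binomial_pair_lower) auto
    also have "\<dots> \<le> fact i * real (u choose i) * (fact j * real (v choose j)) + real (2 * k * (k + 1)) * real n ^ k / n"
    proof (intro add_mono mult_mono divide_right_mono)
      have "i \<le> k" "j \<le> k" using that by auto
      then have "i * (i + 1) \<le> k * (k + 1)" "j * (j + 1) \<le> k * (k + 1)" by (intro mult_le_mono; simp)+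
      then have "i * (i + 1) + j * (j + 1) \<le> 2 * k * (k + 1)" by linarith
      then show "real (i * (i + 1) + j * (j + 1)) \<le> real (2 * k * (k + 1))" by (rule of_nat_mono)
    qed (use that in \<open>auto intro!: binomial_right_mono\<close>)
    finally show ?thesis .
  qed
  have "f (na / n) * real n ^ k = real na ^ s * real nb ^ t + real nb ^ s * real na ^ t"
  proof -
    have "1 - na / n = nb / n" using nab n1 by (simp add: field_simps)
    then show ?thesis using n1 by (simp add: f_st_def power_add power_divide field_simps)
  qed
  also have "\<dots> \<le> (fact s * real (na choose s) * (fact t * real (nb choose t)) + real (2 * k * (k + 1)) * real n ^ k / n)
     + (fact s * real (nb choose s) * (fact t * real (na choose t)) + real (2 * k * (k + 1)) * real n ^ k / n)"
    using nab by (intro add_mono low) auto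
  also have "\<dots> = S * real ((na choose s) * (nb choose t) + (nb choose s) * (na choose t)) + 2 * (real (2 * k * (k + 1)) * real n ^ k / n)"
    unfolding S_def of_nat_add of_nat_mult by (simp only: distrib_left mult_ac mult_2 add_ac)
  also have "2 * (real (2 * k * (k + 1)) * real n ^ k / n) = 4 * real (k * (k + 1)) / n * real n ^ k" by simp
  also have "(na choose s) * (nb choose t) + (nb choose s) * (na choose t) = card (bicliques s t (cut A) V)"
    using card_bicliques_cut[OF assms(1,2), of s t] s_pos t_ge2 by (simp add: na_def nb_def)
  finally show ?thesis unfolding left_diff_distrib by (simp only: n_def na_def)
qed

lemma multipartite_count_le:
  assumes fin: "finite V" and ne: "V \<noteq> {}" and P: "partition_on V P"
    and E: "\<And>u v. u \<in> V \<Longrightarrow> v \<in> V \<Longrightarrow> E u v \<longleftrightarrow> \<not> (\<exists>A\<in>P. u \<in> A \<and> v \<in> A)"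
  shows "S * real (card (bicliques s t E V)) \<le> pair_sum (\<lambda>A. card A / card V) P * real (card V) ^ k"
proof -
  have n: "card V > 0" using fin ne by (simp add: card_gt_0_iff)
  have up: "fact i * real (p choose i) * (fact j * real (p' choose j)) \<le> real p ^ i * real p' ^ j" for i j p p' :: nat
    using binomial_fact_le_power by (intro mult_mono) auto
  have "card (bicliques s t E V) \<le> (\<Sum>A\<in>P. \<Sum>B\<in>P - {A}. (card A choose s) * (card B choose t))"
    by (rule card_bicliques_multipartite_le[OF fin P _ _ E]) (use s_pos t_ge2 in auto)
  from of_nat_mono[OF this, where 'a=real]
  have "S * real (card (bicliques s t E V)) \<le> S * (\<Sum>A\<in>P. \<Sum>B\<in>P - {A}. real (card A choose s) * real (card B choose t))"
    using S_pos by (intro mult_left_mono) auto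
  also have "\<dots> = (\<Sum>A\<in>P. \<Sum>B\<in>P - {A}. fact s * real (card A choose s) * (fact t * real (card B choose t)))"
    by (simp add: S_def sum_distrib_left mult_ac)
  also have "\<dots> \<le> (\<Sum>A\<in>P. \<Sum>B\<in>P - {A}. real (card A) ^ s * real (card B) ^ t)"
    by (intro sum_mono up)
  also have "\<dots> = pair_sum (\<lambda>A. card A / card V) P * real (card V) ^ k"
    using n by (simp add: pair_sum_def sum_distrib_right power_divide power_add)
  finally show ?thesis .
qed

lemma fractions_sum:
  assumes "finite V" "V \<noteq> {}" "partition_on V P"
  shows "(\<Sum>A\<in>P. real (card A) / card V) = 1"
proof -
  have "(\<Sum>A\<in>P. real (card A)) = card V" using card_partition_sum[OF assms(1,3)] by (metis of_nat_sum)
  moreover have "card V > 0" using assms by (simp add: card_gt_0_iff)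
  ultimately show ?thesis by (simp flip: sum_divide_distrib)
qed

lemma count_le:
  assumes fin: "finite V" and E: "symp E" "irreflp E"
  shows "S * real (card (bicliques s t E V)) \<le> M * real (card V) ^ k"
proof (cases "V = {}")
  case True
  have "bicliques s t E V = {}" using s_pos by (auto simp: True bicliques_def size_pairs_def)
  then show ?thesis using M_pos by simp
next
  case False
  from fin E show ?thesis
  proof (induction rule: zykov_induct[where s = s and t = t])
    case (multipartite E)
    obtain P where P: "partition_on V P" "\<And>u v. u \<in> V \<Longrightarrow> v \<in> V \<Longrightarrow> E u v \<longleftrightarrow> \<not> (\<exists>A\<in>P. u \<in> A \<and> v \<in> A)"
      using multipartite_partition[OF multipartite(2), of V] multipartite(3) by blast
    have "pair_sum (\<lambda>A. card A / card V) P \<le> M"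
      using finite_elements[OF fin P(1)] fractions_sum[OF fin False P(1)] by (intro pair_sum_le) auto
    then have "pair_sum (\<lambda>A. card A / card V) P * real (card V) ^ k \<le> M * real (card V) ^ k"
      by (intro mult_right_mono) auto
    with multipartite_count_le[OF fin False P] show ?case by linarith
  next
    case (step E E' u)
    have "S * real (card (bicliques s t E V)) \<le> S * real (card (bicliques s t E' V))"
      using step(7) S_pos by (intro mult_left_mono) auto
    with step(8) show ?case by linarith
  qed
qed

lemma cut_fraction_tendsto:
  "(\<lambda>n. real (nat \<lceil>\<alpha> * real n\<rceil>) / real n) \<longlonglongrightarrow> \<alpha>"
proof (rule tendsto_sandwich)
  have a0: "\<alpha> \<ge> 0" using \<alpha> by auto
  show "\<forall>\<^sub>F n in sequentially. \<alpha> \<le> real (nat \<lceil>\<alpha> * real n\<rceil>) / real n"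
    using eventually_gt_at_top[of 0]
  proof eventually_elim
    case (elim n)
    have "\<alpha> * n \<le> real (nat \<lceil>\<alpha> * real n\<rceil>)" by linarith
    with elim show ?case by (simp add: field_simps)
  qed
  show "\<forall>\<^sub>F n in sequentially. real (nat \<lceil>\<alpha> * real n\<rceil>) / real n \<le> \<alpha> + 1 / real n"
    using eventually_gt_at_top[of 0]
  proof eventually_elim
    case (elim n)
    have "real (nat \<lceil>\<alpha> * real n\<rceil>) \<le> \<alpha> * n + 1" using a0 by (simp add: of_nat_nat)
    with elim show ?case by (simp add: field_simps)
  qed
  show "(\<lambda>n. \<alpha> + 1 / real n) \<longlonglongrightarrow> \<alpha>"
    using tendsto_add[OF tendsto_const lim_const_over_n[of 1], of \<alpha>] by simp
qed simp

lemma cut_fraction_le: "nat \<lceil>\<alpha> * real n\<rceil> \<le> n"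
proof -
  have "\<alpha> * real n \<le> 1 * real n" using \<alpha> by (intro mult_right_mono) auto
  then show ?thesis by linarith
qed

lemma cut_count_lower_tendsto:
  "(\<lambda>n. f (real (nat \<lceil>\<alpha> * real n\<rceil>) / real n) - 4 * real (k * (k + 1)) / real n) \<longlonglongrightarrow> M"
proof -
  have "isCont f \<alpha>" using continuous_f[of UNIV] by (simp add: continuous_on_eq_continuous_at)
  from isCont_tendsto_compose[OF this cut_fraction_tendsto]
  have "(\<lambda>n. f (real (nat \<lceil>\<alpha> * real n\<rceil>) / real n)) \<longlonglongrightarrow> M" using \<alpha> by simp
  from tendsto_diff[OF this lim_const_over_n[of "4 * real (k * (k + 1))"]] show ?thesis by simp
qed

lemma near_max_cut:
  assumes "\<epsilon> > 0"
  shows "\<forall>\<^sub>F n in sequentially. \<forall>V :: 'a set. finite V \<longrightarrow> card V = n \<longrightarrow>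
    (\<exists>A\<subseteq>V. (M - \<epsilon>) * real n ^ k \<le> S * real (card (bicliques s t (cut A) V)))"
proof -
  have "\<forall>\<^sub>F n in sequentially. f (real (nat \<lceil>\<alpha> * real n\<rceil>) / real n) - 4 * real (k * (k + 1)) / real n > M - \<epsilon>"
    using cut_count_lower_tendsto assms by (intro order_tendstoD) auto
  then show ?thesis using eventually_gt_at_top[of 0]
  proof eventually_elim
    case (elim n)
    show ?case
    proof (intro allI impI)
      fix V :: "'a set" assume V: "finite V" "card V = n"
      obtain A where A: "A \<subseteq> V" "card A = nat \<lceil>\<alpha> * real n\<rceil>"
        using obtain_subset_with_card_n[of "nat \<lceil>\<alpha> * real n\<rceil>" V] cut_fraction_le[of n] V by auto
      have "(M - \<epsilon>) * real n ^ k \<le> (f (card A / card V) - 4 * real (k * (k + 1)) / card V) * real (card V) ^ k"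
        unfolding V A by (rule mult_right_mono[OF less_imp_le[OF elim(1)]]) simp
      also have "\<dots> \<le> S * real (card (bicliques s t (cut A) V))"
        using elim V by (intro cut_count_ge A) auto
      finally show "\<exists>A\<subseteq>V. (M - \<epsilon>) * real n ^ k \<le> S * real (card (bicliques s t (cut A) V))" using A by blast
    qed
  qed
qed

text \<open>The contrapositive of \<open>pair_sum_gap\<close>, carried over from proportions to
  counts.\<close>

lemma multipartite_near_max:
  fixes \<eta> :: real
  assumes "\<eta> > 0"
  obtains \<epsilon> where "\<epsilon> > 0"
    "\<And>(V :: 'a set) P E. finite V \<Longrightarrow> V \<noteq> {} \<Longrightarrow> partition_on V P \<Longrightarrow>
      (\<And>u v. u \<in> V \<Longrightarrow> v \<in> V \<Longrightarrow> E u v \<longleftrightarrow> \<not> (\<exists>A\<in>P. u \<in> A \<and> v \<in> A)) \<Longrightarrow>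
      (M - \<epsilon>) * real (card V) ^ k < S * real (card (bicliques s t E V)) \<Longrightarrow>
      \<exists>A\<in>P. \<exists>B\<in>P. A \<noteq> B \<and> real (card A + card B) > (1 - \<eta>) * card V"
proof -
  obtain \<epsilon> where \<epsilon>: "\<epsilon> > 0" "\<And>(P :: 'a set set) x. finite P \<Longrightarrow> (\<forall>i\<in>P. 0 \<le> x i) \<Longrightarrow> (\<Sum>i\<in>P. x i) = 1
    \<Longrightarrow> (\<forall>i\<in>P. \<forall>j\<in>P. i \<noteq> j \<longrightarrow> x i + x j \<le> 1 - \<eta>) \<Longrightarrow> pair_sum x P \<le> M - \<epsilon>"
    using pair_sum_gap[OF assms, where 'i = "'a set"] by blast
  show ?thesis
  proof (rule that[OF \<epsilon>(1)], rule ccontr)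
    fix V :: "'a set" and P E
    assume fin: "finite V" and ne: "V \<noteq> {}" and P: "partition_on V P"
      and E: "\<And>u v. u \<in> V \<Longrightarrow> v \<in> V \<Longrightarrow> E u v \<longleftrightarrow> \<not> (\<exists>A\<in>P. u \<in> A \<and> v \<in> A)"
      and big: "(M - \<epsilon>) * real (card V) ^ k < S * real (card (bicliques s t E V))"
      and no: "\<not> (\<exists>A\<in>P. \<exists>B\<in>P. A \<noteq> B \<and> real (card A + card B) > (1 - \<eta>) * card V)"
    have n: "card V > 0" using fin ne by (simp add: card_gt_0_iff)
    have "\<forall>A\<in>P. \<forall>B\<in>P. A \<noteq> B \<longrightarrow> real (card A) / card V + real (card B) / card V \<le> 1 - \<eta>"
      using no n by (auto simp: field_simps not_less)
    then have "pair_sum (\<lambda>A. card A / card V) P \<le> M - \<epsilon>"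
      using finite_elements[OF fin P(1)] fractions_sum[OF fin ne P] by (intro \<epsilon>(2)) auto
    then have "pair_sum (\<lambda>A. card A / card V) P * real (card V) ^ k \<le> (M - \<epsilon>) * real (card V) ^ k"
      by (intro mult_right_mono) auto
    with multipartite_count_le[OF fin ne P E] big show False by linarith
  qed
qed

text \<open>Within the union of A and B, lying in different parts means being separated by A. So
  every wrong pair meets the remaining vertices.\<close>

lemma defects_two_parts:
  assumes fin: "finite V" and P: "partition_on V P" "A \<in> P" "B \<in> P" "A \<noteq> B"
    and E: "\<And>u v. u \<in> V \<Longrightarrow> v \<in> V \<Longrightarrow> E u v \<longleftrightarrow> \<not> (\<exists>A\<in>P. u \<in> A \<and> v \<in> A)"
  shows "card (defects E A V) \<le> 2 * (card V - (card A + card B)) * card V"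
proof -
  have AB: "A \<subseteq> V" "B \<subseteq> V" "A \<inter> B = {}"
    using P by (auto simp: partition_on_def disjoint_def)
  have uniq: "C = D" if "C \<in> P" "D \<in> P" "u \<in> C" "u \<in> D" for C D u
    using that P(1) by (auto simp: partition_on_def disjoint_def)
  define R where "R = V - (A \<union> B)"
  have "defects E A V \<subseteq> R \<times> V \<union> V \<times> R"
  proof (rule subrelI, rule ccontr)
    fix x y assume xy: "(x, y) \<in> defects E A V" "(x, y) \<notin> R \<times> V \<union> V \<times> R"
    then have V: "x \<in> V" "y \<in> V" and d: "E x y \<noteq> cut A x y" by (auto simp: defects_def)
    then have AoB: "x \<in> A \<or> x \<in> B" "y \<in> A \<or> y \<in> B" using xy by (auto simp: R_def)
    have "(\<exists>C\<in>P. x \<in> C \<and> y \<in> C) \<longleftrightarrow> \<not> cut A x y"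
      using AoB P AB uniq unfolding cut_def by metis
    then show False using E[OF V] d by blast
  qed
  then have "card (defects E A V) \<le> card (R \<times> V \<union> V \<times> R)"
    using fin by (intro card_mono) (auto simp: R_def)
  also have "\<dots> \<le> card (R \<times> V) + card (V \<times> R)" by (rule card_Un_le)
  also have "\<dots> = 2 * card R * card V" by (simp add: card_cartesian_product)
  also have "card R = card V - (card A + card B)"
    using AB fin finite_subset[OF AB(1) fin] finite_subset[OF AB(2) fin] by (simp add: R_def card_Diff_subset card_Un_disjoint)
  finally show ?thesis .
qed

text \<open>Relations far from all cuts cost only a factor \<delta>/2 in the constant: at most n^2
  ordered pairs can be wrong, so truncating their number at \<delta>/2 n^2 lowers it by no more than
  this factor.\<close>

lemma global_stability:
  obtains \<gamma> n\<^sub>0 :: real where "\<gamma> > 0"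
    "\<And>(V :: 'a set) E m. finite V \<Longrightarrow> real (card V) \<ge> n\<^sub>0 \<Longrightarrow> symp E \<Longrightarrow> irreflp E \<Longrightarrow>
      (\<And>E. symp E \<Longrightarrow> irreflp E \<Longrightarrow> real (card (bicliques s t E V)) \<le> m) \<Longrightarrow>
      \<exists>A\<subseteq>V. real (card (bicliques s t E V)) + \<gamma> * real (card V) ^ (k - 2) * real (card (defects E A V)) \<le> m"
proof -
  obtain \<delta>' \<gamma>' \<epsilon>\<^sub>1 n\<^sub>1 where loc: "\<delta>' > 0" "\<gamma>' > 0" "\<epsilon>\<^sub>1 > 0"
    "\<And>(V :: 'a set) E A m. finite V \<Longrightarrow> real (card V) \<ge> n\<^sub>1 \<Longrightarrow> symp E \<Longrightarrow> irreflp E \<Longrightarrow>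
      (\<And>E. symp E \<Longrightarrow> irreflp E \<Longrightarrow> real (card (bicliques s t E V)) \<le> m) \<Longrightarrow>
      A \<subseteq> V \<Longrightarrow> (\<And>B. B \<subseteq> V \<Longrightarrow> card (defects E A V) \<le> card (defects E B V)) \<Longrightarrow>
      real (card (defects E A V)) \<le> \<delta>' * (real (card V))\<^sup>2 \<Longrightarrow>
      (M - \<epsilon>\<^sub>1) * real (card V) ^ k \<le> S * real (card (bicliques s t E V)) \<Longrightarrow>
      real (card (bicliques s t E V)) + \<gamma>' * real (card V) ^ (k - 2) * real (card (defects E A V)) \<le> m"
    by (rule local_stability[where 'a='a]) blast
  define \<delta> where "\<delta> = min \<delta>' 1"
  have \<delta>: "\<delta> > 0" "\<delta> \<le> \<delta>'" "\<delta> \<le> 1" using loc by (auto simp: \<delta>_def)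
  obtain \<epsilon>\<^sub>2 where mp: "\<epsilon>\<^sub>2 > 0"
    "\<And>(V :: 'a set) P E. finite V \<Longrightarrow> V \<noteq> {} \<Longrightarrow> partition_on V P \<Longrightarrow>
      (\<And>u v. u \<in> V \<Longrightarrow> v \<in> V \<Longrightarrow> E u v \<longleftrightarrow> \<not> (\<exists>A\<in>P. u \<in> A \<and> v \<in> A)) \<Longrightarrow>
      (M - \<epsilon>\<^sub>2) * real (card V) ^ k < S * real (card (bicliques s t E V)) \<Longrightarrow>
      \<exists>A\<in>P. \<exists>B\<in>P. A \<noteq> B \<and> real (card A + card B) > (1 - \<delta> / 2) * card V"
    by (rule multipartite_near_max[of "\<delta> / 2", where 'a='a]) (use \<delta>(1) in simp, blast)
  define \<epsilon> where "\<epsilon> = min \<epsilon>\<^sub>1 \<epsilon>\<^sub>2"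
  have \<epsilon>: "\<epsilon> > 0" "\<epsilon> \<le> \<epsilon>\<^sub>1" "\<epsilon> \<le> \<epsilon>\<^sub>2" using loc mp by (auto simp: \<epsilon>_def)
  obtain n\<^sub>2 where n2: "\<And>(V :: 'a set). finite V \<Longrightarrow> card V \<ge> n\<^sub>2 \<Longrightarrow>
    \<exists>A\<subseteq>V. (M - \<epsilon> / 2) * real (card V) ^ k \<le> S * real (card (bicliques s t (cut A) V))"
    using near_max_cut[of "\<epsilon> / 2", where 'a='a] \<epsilon>(1) unfolding eventually_sequentially by auto
  define \<gamma> where "\<gamma> = min \<gamma>' (\<epsilon> / S)"
  have \<gamma>: "\<gamma> > 0" "\<gamma> \<le> \<gamma>'" "\<gamma> * S \<le> \<epsilon>" using loc \<epsilon> S_pos by (auto simp: \<gamma>_def min_def field_simps)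
  define n\<^sub>0 where "n\<^sub>0 = max (max n\<^sub>1 (real n\<^sub>2)) (4 / \<delta>)"
  show ?thesis
  proof (rule that[of "\<gamma> * (\<delta> / 2)" n\<^sub>0])
    show "\<gamma> * (\<delta> / 2) > 0" using \<gamma> \<delta> by simp
    fix V :: "'a set" and E :: "'a \<Rightarrow> 'a \<Rightarrow> bool" and m :: real
    assume fin: "finite V" and n0: "real (card V) \<ge> n\<^sub>0" and E: "symp E" "irreflp E"
      and m: "\<And>E. symp E \<Longrightarrow> irreflp E \<Longrightarrow> real (card (bicliques s t E V)) \<le> m"
    define n where "n = card V"
    have n: "n\<^sub>1 \<le> n" "n\<^sub>2 \<le> n" "4 / \<delta> \<le> n" using n0 by (auto simp: n\<^sub>0_def n_def)
    then have n4: "4 \<le> \<delta> * n" using \<delta> by (simp add: field_simps)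
    then have npos: "n > 0" by (cases "n = 0") auto
    have ne: "V \<noteq> {}" using npos by (auto simp: n_def)
    have nk: "real n ^ k = real n ^ (k - 2) * (real n)\<^sup>2"
    proof -
      have "k = (k - 2) + 2" using s_pos t_ge2 by simp
      then show ?thesis by (metis power_add)
    qed
    obtain C where C: "C \<subseteq> V" "(M - \<epsilon> / 2) * real n ^ k \<le> S * real (card (bicliques s t (cut C) V))"
      using n2[OF fin] n by (auto simp: n_def)
    have "S * real (card (bicliques s t (cut C) V)) \<le> S * m" using m S_pos by (intro mult_left_mono) auto
    then have m_ge: "(M - \<epsilon> / 2) * real n ^ k \<le> S * m" using C by linarith
    \<comment> \<open>The number of defects is truncated so that the claim survives a symmetrisation step, which may
      lower it by \<open>2 n\<close>.\<close>
    define Q where "Q E \<longleftrightarrow> (\<forall>A\<subseteq>V. (\<forall>B\<subseteq>V. card (defects E A V) \<le> card (defects E B V)) \<longrightarrow>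
      real (card (bicliques s t E V)) + \<gamma> * real n ^ (k - 2) * min (real (card (defects E A V))) (\<delta> / 2 * (real n)\<^sup>2) \<le> m)" for E
    \<comment> \<open>After scaling by S the claimed loss is at most \<epsilon>/2 n^k, because
      \<gamma> S <= \<epsilon> and \<delta> <= 1. This is the distance from M - \<epsilon> to the
      value M - \<epsilon>/2 that some cut reaches.\<close>
    have low: "Q E" if "S * real (card (bicliques s t E V)) \<le> (M - \<epsilon>) * real n ^ k" for E
      unfolding Q_def
    proof (intro allI impI)
      fix A
      have "\<gamma> * real n ^ (k - 2) * min (real (card (defects E A V))) (\<delta> / 2 * (real n)\<^sup>2) \<le> \<gamma> * real n ^ (k - 2) * (\<delta> / 2 * (real n)\<^sup>2)"
        using \<gamma> by (intro mult_left_mono) auto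
      also have "\<dots> = \<gamma> * \<delta> / 2 * real n ^ k" by (simp add: nk)
      also have "\<dots> \<le> \<gamma> / 2 * real n ^ k" using \<gamma> \<delta> by (intro mult_right_mono) auto
      finally have "S * (real (card (bicliques s t E V)) + \<gamma> * real n ^ (k - 2) * min (real (card (defects E A V))) (\<delta> / 2 * (real n)\<^sup>2))
        \<le> S * real (card (bicliques s t E V)) + S * (\<gamma> / 2 * real n ^ k)"
        unfolding distrib_left using S_pos by (intro add_left_mono mult_left_mono) auto
      also have "S * (\<gamma> / 2 * real n ^ k) = \<gamma> * S / 2 * real n ^ k" by simp
      also have "\<dots> \<le> \<epsilon> / 2 * real n ^ k" using \<gamma> by (intro mult_right_mono) auto
      also have "S * real (card (bicliques s t E V)) + \<epsilon> / 2 * real n ^ k \<le> (M - \<epsilon>) * real n ^ k + \<epsilon> / 2 * real n ^ k"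
        using that by simp
      also have "\<dots> = (M - \<epsilon> / 2) * real n ^ k" by (simp add: algebra_simps)
      also have "\<dots> \<le> S * m" by (rule m_ge)
      finally show "real (card (bicliques s t E V)) + \<gamma> * real n ^ (k - 2) * min (real (card (defects E A V))) (\<delta> / 2 * (real n)\<^sup>2) \<le> m"
        using S_pos by (simp add: mult_le_cancel_left)
    qed
    have close: "real (card (bicliques s t E V)) + \<gamma> * real n ^ (k - 2) * min (real (card (defects E A V))) (\<delta> / 2 * (real n)\<^sup>2) \<le> m"
      if E: "symp E" "irreflp E" and A: "A \<subseteq> V" "\<And>B. B \<subseteq> V \<Longrightarrow> card (defects E A V) \<le> card (defects E B V)"
        and d: "real (card (defects E A V)) \<le> \<delta> * (real n)\<^sup>2"
        and big: "(M - \<epsilon>) * real n ^ k < S * real (card (bicliques s t E V))" for E A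
    proof -
      have "(M - \<epsilon>\<^sub>1) * real n ^ k \<le> (M - \<epsilon>) * real n ^ k" using \<epsilon> by (intro mult_right_mono) auto
      then have big1: "(M - \<epsilon>\<^sub>1) * real (card V) ^ k \<le> S * real (card (bicliques s t E V))" using big by (simp add: n_def)
      have "\<delta> * (real n)\<^sup>2 \<le> \<delta>' * (real n)\<^sup>2" using \<delta> by (intro mult_right_mono) auto
      then have d1: "real (card (defects E A V)) \<le> \<delta>' * (real (card V))\<^sup>2" using d by (simp add: n_def)
      have "real (card (bicliques s t E V)) + \<gamma>' * real (card V) ^ (k - 2) * real (card (defects E A V)) \<le> m"
        using n(1) by (intro loc(4)[OF fin _ E m A d1 big1]) (auto simp: n_def)
      moreover have "\<gamma> * real n ^ (k - 2) * min (real (card (defects E A V))) (\<delta> / 2 * (real n)\<^sup>2)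
          \<le> \<gamma>' * real n ^ (k - 2) * real (card (defects E A V))"
        using \<gamma> loc \<delta> by (intro mult_mono) auto
      ultimately show ?thesis by (simp add: n_def)
    qed
    from fin E have "Q E"
    proof (induction rule: zykov_induct[where s = s and t = t])
      case (multipartite E)
      show ?case
      proof (cases "S * real (card (bicliques s t E V)) \<le> (M - \<epsilon>) * real n ^ k")
        case False
        then have big: "(M - \<epsilon>) * real n ^ k < S * real (card (bicliques s t E V))" by simp
        obtain P where P: "partition_on V P" "\<And>u v. u \<in> V \<Longrightarrow> v \<in> V \<Longrightarrow> E u v \<longleftrightarrow> \<not> (\<exists>A\<in>P. u \<in> A \<and> v \<in> A)"
          using multipartite_partition[OF multipartite(2), of V] multipartite(3) by blast
        have "(M - \<epsilon>\<^sub>2) * real n ^ k \<le> (M - \<epsilon>) * real n ^ k" using \<epsilon> by (intro mult_right_mono) auto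
        then have "(M - \<epsilon>\<^sub>2) * real (card V) ^ k < S * real (card (bicliques s t E V))" using big by (simp add: n_def)
        then obtain A B where AB: "A \<in> P" "B \<in> P" "A \<noteq> B" "real (card A + card B) > (1 - \<delta> / 2) * card V"
          using mp(2)[OF fin ne P] by blast
        have AV: "A \<subseteq> V" using P AB by (auto simp: partition_on_def)
        have "real (card V - (card A + card B)) \<le> \<delta> / 2 * n"
        proof (cases "card A + card B \<le> card V")
          case True
          then have "real (card V - (card A + card B)) = real n - real (card A + card B)"
            by (simp add: n_def of_nat_diff)
          also have "\<dots> \<le> real n - (1 - \<delta> / 2) * n" using AB(4) by (simp add: n_def)
          finally show ?thesis by (simp add: algebra_simps)
        qed (use \<delta> in simp)
        then have dA: "real (2 * (card V - (card A + card B)) * card V) \<le> \<delta> * (real n)\<^sup>2"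
          \<comment> \<open>Two parts leave out at most \<delta>/2 n vertices, and each of these
            spoils at most 2 n ordered pairs.\<close>
          using mult_right_mono[of "2 * real (card V - (card A + card B))" "\<delta> * n" "real n"]
          by (simp add: n_def power2_eq_square)
        show ?thesis unfolding Q_def
        proof (intro allI impI)
          fix A' assume A': "A' \<subseteq> V" "\<forall>B\<subseteq>V. card (defects E A' V) \<le> card (defects E B V)"
          have "card (defects E A' V) \<le> 2 * (card V - (card A + card B)) * card V"
            using A'(2) AV defects_two_parts[OF fin P(1) AB(1-3) P(2)] by (meson order_trans)
          then have "real (card (defects E A' V)) \<le> real (2 * (card V - (card A + card B)) * card V)"
            by (rule of_nat_mono)
          then have "real (card (defects E A' V)) \<le> \<delta> * (real n)\<^sup>2" using dA by linarith
          then show "real (card (bicliques s t E V)) + \<gamma> * real n ^ (k - 2) * min (real (card (defects E A' V))) (\<delta> / 2 * (real n)\<^sup>2) \<le> m"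
            using A' big multipartite by (intro close) auto
        qed
      qed (rule low)
    next
      case (step E E' u)
      show ?case unfolding Q_def
      proof (intro allI impI)
        fix A assume A: "A \<subseteq> V" "\<forall>B\<subseteq>V. card (defects E A V) \<le> card (defects E B V)"
        show "real (card (bicliques s t E V)) + \<gamma> * real n ^ (k - 2) * min (real (card (defects E A V))) (\<delta> / 2 * (real n)\<^sup>2) \<le> m"
        proof (cases "S * real (card (bicliques s t E V)) \<le> (M - \<epsilon>) * real n ^ k \<or> real (card (defects E A V)) \<le> \<delta> * (real n)\<^sup>2")
          case True
          show ?thesis
          proof (cases "S * real (card (bicliques s t E V)) \<le> (M - \<epsilon>) * real n ^ k")
            case True
            then show ?thesis using low[of E] A unfolding Q_def by blast
          next
            case big: False
            show ?thesis
              by (rule close[OF step(1,2) A(1)]) (use A True big in \<open>auto simp: not_le\<close>)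
          qed
        next
          case False
          obtain A' where A': "A' \<subseteq> V" "\<And>B. B \<subseteq> V \<Longrightarrow> card (defects E' A' V) \<le> card (defects E' B V)"
            using minimal_cut[OF fin] by blast
          \<comment> \<open>By the choice of \<open>n\<^sub>0\<close> the change of 2 n is at most
            \<delta>/2 n^2. From more than \<delta> n^2 defects at least \<delta>/2 n^2 remain, so
            the truncated number is the same for both relations.\<close>
          have "card (defects E A' V) \<le> card (defects E' A' V) + 2 * card V"
            using step(6) by (intro card_defects_star_le[OF fin step(5)]) auto
          then have "card (defects E A V) \<le> card (defects E' A' V) + 2 * card V" using A(2) A'(1) by (meson order_trans)
          then have "real (card (defects E A V)) \<le> real (card (defects E' A' V) + 2 * n)" unfolding n_def by (rule of_nat_mono)
          then have "\<delta> * (real n)\<^sup>2 - 2 * n \<le> real (card (defects E' A' V))" using False by simp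
          moreover have "4 * real n \<le> \<delta> * n * n" using n4 by (intro mult_right_mono) auto
          ultimately have "\<delta> / 2 * (real n)\<^sup>2 \<le> real (card (defects E' A' V))" by (simp add: power2_eq_square)
          then have "min (real (card (defects E' A' V))) (\<delta> / 2 * (real n)\<^sup>2) = \<delta> / 2 * (real n)\<^sup>2" by simp
          then have "real (card (bicliques s t E' V)) + \<gamma> * real n ^ (k - 2) * (\<delta> / 2 * (real n)\<^sup>2) \<le> m"
            using step(8) A' unfolding Q_def by metis
          moreover have "\<gamma> * real n ^ (k - 2) * min (real (card (defects E A V))) (\<delta> / 2 * (real n)\<^sup>2) \<le> \<gamma> * real n ^ (k - 2) * (\<delta> / 2 * (real n)\<^sup>2)"
            using \<gamma> by (intro mult_left_mono) auto
          moreover have "real (card (bicliques s t E V)) \<le> real (card (bicliques s t E' V))" using step(7) by simp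
          ultimately show ?thesis by linarith
        qed
      qed
    qed
    obtain A where A: "A \<subseteq> V" "\<And>B. B \<subseteq> V \<Longrightarrow> card (defects E A V) \<le> card (defects E B V)"
      using minimal_cut[OF fin] by blast
    have "card (defects E A V) \<le> card (V \<times> V)" using fin by (intro card_mono) (auto simp: defects_def)
    then have "card (defects E A V) \<le> n * n" by (simp add: n_def card_cartesian_product)
    then have dn: "real (card (defects E A V)) \<le> (real n)\<^sup>2" by (metis of_nat_le_iff of_nat_mult power2_eq_square)
    have "\<delta> / 2 * real (card (defects E A V)) \<le> min (real (card (defects E A V))) (\<delta> / 2 * (real n)\<^sup>2)"
    proof (rule min.boundedI)
      have "\<delta> / 2 * real (card (defects E A V)) \<le> 1 * real (card (defects E A V))" using \<delta> by (intro mult_right_mono) auto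
      then show "\<delta> / 2 * real (card (defects E A V)) \<le> real (card (defects E A V))" by simp
      show "\<delta> / 2 * real (card (defects E A V)) \<le> \<delta> / 2 * (real n)\<^sup>2" using dn \<delta> by (intro mult_left_mono) auto
    qed
    then have "\<gamma> * real n ^ (k - 2) * (\<delta> / 2 * real (card (defects E A V))) \<le>
      \<gamma> * real n ^ (k - 2) * min (real (card (defects E A V))) (\<delta> / 2 * (real n)\<^sup>2)"
      using \<gamma> by (intro mult_left_mono) auto
    moreover have "real (card (bicliques s t E V)) + \<gamma> * real n ^ (k - 2) * min (real (card (defects E A V))) (\<delta> / 2 * (real n)\<^sup>2) \<le> m"
      using \<open>Q E\<close> A unfolding Q_def by blast
    ultimately have "real (card (bicliques s t E V)) + \<gamma> * (\<delta> / 2) * real (card V) ^ (k - 2) * real (card (defects E A V)) \<le> m"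
      by (simp add: n_def mult_ac)
    with A(1) show "\<exists>A\<subseteq>V. real (card (bicliques s t E V)) + \<gamma> * (\<delta> / 2) * real (card V) ^ (k - 2) * real (card (defects E A V)) \<le> m"
      by blast
  qed
qed

end

subsection \<open>Transfer to graphs\<close>

definition adj :: "ugraph \<Rightarrow> nat \<Rightarrow> nat \<Rightarrow> bool" where
  "adj G u v \<longleftrightarrow> {u, v} \<in> edges G"

definition graph_of :: "nat set \<Rightarrow> (nat \<Rightarrow> nat \<Rightarrow> bool) \<Rightarrow> ugraph" where
  "graph_of V E = (V, {{u, v} |u v. u \<in> V \<and> v \<in> V \<and> E u v})"

lemma symp_adj: "symp (adj G)"
  by (auto simp: symp_def adj_def insert_commute)

lemma irreflp_adj: "simple_graph G \<Longrightarrow> irreflp (adj G)"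
  by (auto simp: irreflp_def adj_def simple_graph_def)

lemma verts_graph_of [simp]: "verts (graph_of V E) = V"
  by (simp add: graph_of_def)

lemma simple_graph_of:
  assumes "finite V" "irreflp E"
  shows "simple_graph (graph_of V E)"
proof -
  have "card {u, v} = 2" if "E u v" for u v
  proof -
    have "u \<noteq> v" using that assms(2) by (auto simp: irreflp_def)
    then show ?thesis by simp
  qed
  then show ?thesis unfolding simple_graph_def graph_of_def using assms(1) by auto
qed

lemma adj_graph_of:
  assumes "symp E" "u \<in> V" "v \<in> V"
  shows "adj (graph_of V E) u v \<longleftrightarrow> E u v"
proof
  assume "adj (graph_of V E) u v"
  then obtain u' v' where "{u, v} = {u', v'}" "E u' v'" by (auto simp: adj_def graph_of_def)
  then show "E u v" using assms(1) by (metis doubleton_eq_iff sympD)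
qed (use assms(2,3) in \<open>auto simp: adj_def graph_of_def\<close>)

lemma bicliques_graph_of: "symp E \<Longrightarrow> bicliques s t (adj (graph_of V E)) V = bicliques s t E V"
  by (rule bicliques_cong) (rule adj_graph_of)

lemma bicliques_swap: "(X, Y) \<in> bicliques s t E V \<longleftrightarrow> (Y, X) \<in> bicliques t s E V"
  by (auto simp: bicliques_def size_pairs_def)

lemma order_complete_bipartite [simp]: "order (complete_bipartite s t) = s + t"
  by (simp add: complete_bipartite_def)

lemma isomorphic_trans:
  assumes "isomorphic F F'" "isomorphic F' G"
  shows "isomorphic F G"
proof -
  obtain \<sigma> \<tau> where \<sigma>: "bij_betw \<sigma> (verts F) (verts F')" "(\<lambda>e. \<sigma> ` e) ` edges F = edges F'"
    and \<tau>: "bij_betw \<tau> (verts F') (verts G)" "(\<lambda>e. \<tau> ` e) ` edges F' = edges G"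
    using assms by (auto simp: isomorphic_def)
  have "(\<lambda>e. (\<tau> \<circ> \<sigma>) ` e) ` edges F = edges G"
    unfolding \<tau>(2)[symmetric] \<sigma>(2)[symmetric] by (simp add: image_image image_comp comp_def)
  then show ?thesis using bij_betw_trans[OF \<sigma>(1) \<tau>(1)] unfolding isomorphic_def by blast
qed

text \<open>The isomorphism is the rotation by t modulo s + t.\<close>

lemma complete_bipartite_swap: "isomorphic (complete_bipartite s t) (complete_bipartite t s)"
proof -
  define \<sigma> where "\<sigma> i = (if i < s then i + t else i - s)" for i
  have "bij_betw \<sigma> {..<s + t} {..<t + s}"
    by (rule bij_betw_byWitness[where f' = "\<lambda>i. if i < t then i + s else i - t"]) (auto simp: \<sigma>_def)
  moreover have "(\<lambda>e. \<sigma> ` e) ` {{i, j} |i j. i < s \<and> s \<le> j \<and> j < s + t} = {{i, j} |i j. i < t \<and> t \<le> j \<and> j < t + s}"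
    (is "?l = ?r")
  proof
    show "?l \<subseteq> ?r"
    proof clarify
      fix i j assume "i < s" "s \<le> j" "j < s + t"
      then show "\<exists>i' j'. \<sigma> ` {i, j} = {i', j'} \<and> i' < t \<and> t \<le> j' \<and> j' < t + s"
        by (intro exI[of _ "j - s"] exI[of _ "i + t"]) (auto simp: \<sigma>_def)
    qed
    show "?r \<subseteq> ?l"
    proof clarify
      fix i j assume "i < t" "t \<le> j" "j < t + s"
      then have "{i, j} = \<sigma> ` {j - t, i + s}" "j - t < s" "s \<le> i + s" "i + s < s + t"
        by (auto simp: \<sigma>_def)
      then show "{i, j} \<in> ?l" by blast
    qed
  qed
  ultimately show ?thesis unfolding isomorphic_def complete_bipartite_def by auto
qed

lemma induced_count_swap: "induced_count (complete_bipartite s t) = induced_count (complete_bipartite t s)"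
proof
  fix G
  have "isomorphic (complete_bipartite s t) H \<longleftrightarrow> isomorphic (complete_bipartite t s) H" for H
    using isomorphic_trans complete_bipartite_swap by blast
  then show "induced_count (complete_bipartite s t) G = induced_count (complete_bipartite t s) G"
    by (simp add: induced_count_def add.commute)
qed

text \<open>From an isomorphism, X is the image of the first s vertices. Conversely, bijections onto
  the two sides are glued together.\<close>

lemma isomorphic_complete_bipartite_iff:
  assumes G: "simple_graph G" and S: "S \<subseteq> verts G" and st: "1 \<le> s" "1 \<le> t"
  shows "card S = s + t \<and> isomorphic (complete_bipartite s t) (induced_subgraph G S) \<longleftrightarrow>
    (\<exists>X\<subseteq>S. (X, S - X) \<in> bicliques s t (adj G) (verts G))"
proof
  assume L: "card S = s + t \<and> isomorphic (complete_bipartite s t) (induced_subgraph G S)"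
  then obtain \<sigma> where \<sigma>: "bij_betw \<sigma> {..<s + t} S"
    and ed: "(\<lambda>e. \<sigma> ` e) ` {{i, j} |i j. i < s \<and> s \<le> j \<and> j < s + t} = {e \<in> edges G. e \<subseteq> S}"
    by (auto simp: isomorphic_def complete_bipartite_def induced_subgraph_def)
  define X where "X = \<sigma> ` {..<s}"
  have inj: "inj_on \<sigma> {..<s + t}" and img: "\<sigma> ` {..<s + t} = S" using \<sigma> by (auto simp: bij_betw_def)
  have inX: "\<sigma> i \<in> X \<longleftrightarrow> i < s" if "i < s + t" for i
    using that inj_on_image_mem_iff[OF inj, of i "{..<s}"] by (auto simp: X_def)
  have XS: "X \<subseteq> S" using img by (auto simp: X_def)
  have cX: "card X = s" unfolding X_def
    by (subst card_image) (auto intro: inj_on_subset[OF inj])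
  have finS: "finite S" using L st by (metis card.infinite add_is_0 not_one_le_zero)
  have cY: "card (S - X) = t" using XS cX L finS by (simp add: card_Diff_subset finite_subset)
  have "adj G u v \<longleftrightarrow> (u \<in> X) \<noteq> (v \<in> X)" if "u \<in> S" "v \<in> S" for u v
  proof -
    have "u \<in> \<sigma> ` {..<s + t}" "v \<in> \<sigma> ` {..<s + t}" using img \<open>u \<in> S\<close> \<open>v \<in> S\<close> by simp_all
    then obtain i j where ij: "u = \<sigma> i" "i < s + t" "v = \<sigma> j" "j < s + t" by auto
    have "adj G u v \<longleftrightarrow> {u, v} \<in> {e \<in> edges G. e \<subseteq> S}" using that by (auto simp: adj_def)
    also have "\<dots> \<longleftrightarrow> (\<exists>i' j'. i' < s \<and> s \<le> j' \<and> j' < s + t \<and> {u, v} = {\<sigma> i', \<sigma> j'})"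
    proof
      assume "{u, v} \<in> {e \<in> edges G. e \<subseteq> S}"
      then show "\<exists>i' j'. i' < s \<and> s \<le> j' \<and> j' < s + t \<and> {u, v} = {\<sigma> i', \<sigma> j'}"
        unfolding ed[symmetric] by auto
    next
      assume "\<exists>i' j'. i' < s \<and> s \<le> j' \<and> j' < s + t \<and> {u, v} = {\<sigma> i', \<sigma> j'}"
      then obtain i' j' where *: "i' < s" "s \<le> j'" "j' < s + t" "{u, v} = {\<sigma> i', \<sigma> j'}" by blast
      have "{u, v} = \<sigma> ` {i', j'}" using *(4) by simp
      then show "{u, v} \<in> {e \<in> edges G. e \<subseteq> S}" unfolding ed[symmetric] using *(1-3) by blast
    qed
    also have "\<dots> \<longleftrightarrow> (i < s) \<noteq> (j < s)"
    proof
      assume "\<exists>i' j'. i' < s \<and> s \<le> j' \<and> j' < s + t \<and> {u, v} = {\<sigma> i', \<sigma> j'}"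
      then obtain i' j' where *: "i' < s" "s \<le> j'" "j' < s + t" "{u, v} = {\<sigma> i', \<sigma> j'}" by blast
      then have "\<sigma> i' \<in> X" "\<sigma> j' \<notin> X" using inX[of i'] inX[of j'] by auto
      then have "(u \<in> X) \<noteq> (v \<in> X)" using *(4) by (auto simp: doubleton_eq_iff)
      then show "(i < s) \<noteq> (j < s)" using inX ij by auto
    next
      assume "(i < s) \<noteq> (j < s)"
      then show "\<exists>i' j'. i' < s \<and> s \<le> j' \<and> j' < s + t \<and> {u, v} = {\<sigma> i', \<sigma> j'}"
      proof (cases "i < s")
        case True
        then show ?thesis using ij \<open>(i < s) \<noteq> (j < s)\<close> by (intro exI[of _ i] exI[of _ j]) auto
      next
        case False
        then show ?thesis using ij \<open>(i < s) \<noteq> (j < s)\<close> by (intro exI[of _ j] exI[of _ i]) auto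
      qed
    qed
    finally show ?thesis using inX ij by auto
  qed
  then show "\<exists>X\<subseteq>S. (X, S - X) \<in> bicliques s t (adj G) (verts G)"
    using XS cX cY S by (intro exI[of _ X]) (auto simp: bicliques_def size_pairs_def)
next
  assume "\<exists>X\<subseteq>S. (X, S - X) \<in> bicliques s t (adj G) (verts G)"
  then obtain X where X: "X \<subseteq> S" "card X = s" "card (S - X) = t"
    and adj: "\<And>u v. u \<in> S \<Longrightarrow> v \<in> S \<Longrightarrow> adj G u v \<longleftrightarrow> (u \<in> X) \<noteq> (v \<in> X)"
    by (auto simp: bicliques_def size_pairs_def)
  have fin: "finite X" "finite (S - X)" using X st by (auto intro: card_ge_0_finite)
  have un: "S = X \<union> (S - X)" using X by auto
  have cS: "card S = s + t" by (subst un, subst card_Un_disjoint) (use fin X in auto)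
  have "card {..<s} = card X" "card {s..<s + t} = card (S - X)" using X by simp_all
  then obtain \<phi> \<psi> where \<phi>: "bij_betw \<phi> {..<s} X" and \<psi>: "bij_betw \<psi> {s..<s + t} (S - X)"
    using finite_same_card_bij fin by (metis finite_lessThan finite_atLeastLessThan)
  define \<sigma> where "\<sigma> i = (if i < s then \<phi> i else \<psi> i)" for i
  have b1: "bij_betw \<sigma> {..<s} X" using \<phi> by (rule bij_betw_cong[THEN iffD1, rotated]) (simp add: \<sigma>_def)
  have b2: "bij_betw \<sigma> {s..<s + t} (S - X)" using \<psi> by (rule bij_betw_cong[THEN iffD1, rotated]) (simp add: \<sigma>_def)
  have "bij_betw \<sigma> ({..<s} \<union> {s..<s + t}) (X \<union> (S - X))" using b1 b2 by (rule bij_betw_combine) auto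
  moreover have "{..<s} \<union> {s..<s + t} = {..<s + t}" by auto
  ultimately have b: "bij_betw \<sigma> {..<s + t} S" using un by simp
  have "(\<lambda>e. \<sigma> ` e) ` {{i, j} |i j. i < s \<and> s \<le> j \<and> j < s + t} = {e \<in> edges G. e \<subseteq> S}"
  proof (intro equalityI subsetI)
    fix e assume "e \<in> (\<lambda>e. \<sigma> ` e) ` {{i, j} |i j. i < s \<and> s \<le> j \<and> j < s + t}"
    then obtain i j where ij: "e = {\<sigma> i, \<sigma> j}" "i < s" "s \<le> j" "j < s + t" by auto
    then have "\<sigma> i \<in> X" "\<sigma> j \<in> S - X" using bij_betw_apply[OF b1] bij_betw_apply[OF b2] by simp_all
    then have "\<sigma> i \<in> S" "\<sigma> j \<in> S" "adj G (\<sigma> i) (\<sigma> j)" using X adj[of "\<sigma> i" "\<sigma> j"] by auto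
    then show "e \<in> {e \<in> edges G. e \<subseteq> S}" using ij by (simp add: adj_def)
  next
    fix e assume e: "e \<in> {e \<in> edges G. e \<subseteq> S}"
    then have "card e = 2" using G by (auto simp: simple_graph_def)
    then obtain u v where uv: "e = {u, v}" by (auto simp: card_2_iff)
    have uvS: "u \<in> S" "v \<in> S" "adj G u v" using e uv by (auto simp: adj_def)
    have "\<exists>x y. e = {x, y} \<and> x \<in> X \<and> y \<in> S - X"
    proof (cases "u \<in> X")
      case True
      then show ?thesis using uv uvS adj[OF uvS(1,2)] by blast
    next
      case False
      then have "e = {v, u}" "v \<in> X" "u \<in> S - X" using uv uvS adj[OF uvS(1,2)] by auto
      then show ?thesis by blast
    qed
    then obtain x y where xy: "e = {x, y}" "x \<in> X" "y \<in> S - X" by blast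
    have "x \<in> \<sigma> ` {..<s}" "y \<in> \<sigma> ` {s..<s + t}"
      using xy(2,3) bij_betw_imp_surj_on[OF b1] bij_betw_imp_surj_on[OF b2] by simp_all
    then obtain i j where ij: "x = \<sigma> i" "i < s" "y = \<sigma> j" "s \<le> j" "j < s + t" by auto
    then have "e = \<sigma> ` {i, j}" using xy by simp
    then show "e \<in> (\<lambda>e. \<sigma> ` e) ` {{i, j} |i j. i < s \<and> s \<le> j \<and> j < s + t}" using ij by blast
  qed
  with b cS show "card S = s + t \<and> isomorphic (complete_bipartite s t) (induced_subgraph G S)"
    by (auto simp: isomorphic_def complete_bipartite_def induced_subgraph_def)
qed

text \<open>On S the relation is the cut by X. Any other choice describes the same cut, so it is X
  or its complement in S, and the complement has the right size only for s = t.\<close>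

lemma biclique_sides:
  assumes X: "X \<subseteq> S" "(X, S - X) \<in> bicliques s t E V" and st: "1 \<le> s" "1 \<le> t"
  shows "card {X'. X' \<subseteq> S \<and> (X', S - X') \<in> bicliques s t E V} = (if s = t then 2 else 1)"
proof -
  have cX: "card X = s" "card (S - X) = t"
    and adj: "\<And>u v. u \<in> S \<Longrightarrow> v \<in> S \<Longrightarrow> E u v \<longleftrightarrow> (u \<in> X) \<noteq> (v \<in> X)"
    using X by (auto simp: bicliques_def size_pairs_def)
  obtain x where x: "x \<in> X" using cX st by (metis card.empty ex_in_conv not_one_le_zero)
  have sub: "X' = X \<or> X' = S - X" if "X' \<subseteq> S" "(X', S - X') \<in> bicliques s t E V" for X'
  proof -
    have adj': "\<And>u v. u \<in> S \<Longrightarrow> v \<in> S \<Longrightarrow> E u v \<longleftrightarrow> (u \<in> X') \<noteq> (v \<in> X')"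
      using that by (auto simp: bicliques_def size_pairs_def)
    have "(x \<in> X') \<noteq> (v \<in> X') \<longleftrightarrow> v \<notin> X" if "v \<in> S" for v
      using adj[of x v] adj'[of x v] that x X(1) by auto
    then show ?thesis using that X(1) by (cases "x \<in> X'") blast+
  qed
  have ne: "X \<noteq> S - X" using x by auto
  show ?thesis
  proof (cases "s = t")
    case True
    have "(S - X, X) \<in> bicliques s t E V" using bicliques_swap[of X "S - X" s t E V] X(2) True by simp
    moreover have "S - (S - X) = X" using X(1) by auto
    ultimately have "{X'. X' \<subseteq> S \<and> (X', S - X') \<in> bicliques s t E V} = {X, S - X}"
      using sub X by auto
    then show ?thesis using ne True by simp
  next
    case False
    have "X' \<noteq> S - X" if "(X', S - X') \<in> bicliques s t E V" for X'
      using that cX False by (auto simp: bicliques_def size_pairs_def)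
    then have "{X'. X' \<subseteq> S \<and> (X', S - X') \<in> bicliques s t E V} = {X}"
      using sub X by blast
    then show ?thesis using False by simp
  qed
qed

text \<open>Ordered pairs of sides are grouped by their union, which is the vertex set of the
  copy.\<close>

lemma card_bicliques_eq:
  assumes G: "simple_graph G" and st: "1 \<le> s" "1 \<le> t"
  shows "card (bicliques s t (adj G) (verts G)) =
    (if s = t then 2 else 1) * induced_count (complete_bipartite s t) G"
proof -
  define C where "C = {S. S \<subseteq> verts G \<and> card S = order (complete_bipartite s t) \<and>
    isomorphic (complete_bipartite s t) (induced_subgraph G S)}"
  define F where "F S = {X. X \<subseteq> S \<and> (X, S - X) \<in> bicliques s t (adj G) (verts G)}" for S
  have fin: "finite (verts G)" using G by (simp add: simple_graph_def)
  have C: "S \<in> C \<longleftrightarrow> S \<subseteq> verts G \<and> F S \<noteq> {}" for S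
    using isomorphic_complete_bipartite_iff[OF G _ st, of S] by (auto simp: C_def F_def)
  have finC: "finite C" by (rule finite_subset[of _ "Pow (verts G)"]) (use fin in \<open>auto simp: C_def\<close>)
  have finF: "finite (F S)" if "S \<in> C" for S
    using that fin by (auto simp: F_def C intro: finite_subset)
  have "bij_betw (\<lambda>(S, X). (X, S - X)) (SIGMA S:C. F S) (bicliques s t (adj G) (verts G))"
  proof (rule bij_betw_byWitness[where f' = "\<lambda>(X, Y). (X \<union> Y, X)"])
    show "\<forall>a\<in>SIGMA S:C. F S. (case case a of (S, X) \<Rightarrow> (X, S - X) of (X, Y) \<Rightarrow> (X \<union> Y, X)) = a"
      by (auto simp: F_def)
    have d: "X \<union> Y - X = Y" "X \<subseteq> verts G" "Y \<subseteq> verts G" if "(X, Y) \<in> bicliques s t (adj G) (verts G)" for X Y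
      using that by (auto simp: bicliques_def size_pairs_def)
    then show "\<forall>a'\<in>bicliques s t (adj G) (verts G).
       (case case a' of (X, Y) \<Rightarrow> (X \<union> Y, X) of (S, X) \<Rightarrow> (X, S - X)) = a'" by auto
    show "(\<lambda>(S, X). (X, S - X)) ` (SIGMA S:C. F S) \<subseteq> bicliques s t (adj G) (verts G)"
      by (auto simp: F_def)
    show "(\<lambda>(X, Y). (X \<union> Y, X)) ` bicliques s t (adj G) (verts G) \<subseteq> (SIGMA S:C. F S)"
    proof (rule image_subsetI)
      fix p assume p: "p \<in> bicliques s t (adj G) (verts G)"
      obtain X Y where XY: "p = (X, Y)" by (cases p)
      have "X \<in> F (X \<union> Y)" using p d[of X Y] by (simp add: F_def XY)
      moreover have "X \<union> Y \<subseteq> verts G" using d p XY by auto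
      ultimately show "(case p of (X, Y) \<Rightarrow> (X \<union> Y, X)) \<in> (SIGMA S:C. F S)" by (auto simp: C XY)
    qed
  qed
  then have "card (bicliques s t (adj G) (verts G)) = card (SIGMA S:C. F S)"
    by (simp add: bij_betw_same_card)
  also have "\<dots> = (\<Sum>S\<in>C. card (F S))" using finC finF by (intro card_SigmaI) auto
  also have "\<dots> = (\<Sum>S\<in>C. if s = t then 2 else 1)"
  proof (intro sum.cong refl)
    fix S assume "S \<in> C"
    then obtain X where "X \<subseteq> S" "(X, S - X) \<in> bicliques s t (adj G) (verts G)" by (auto simp: C F_def)
    then show "card (F S) = (if s = t then 2 else 1)" unfolding F_def by (rule biclique_sides[OF _ _ st])
  qed
  finally show ?thesis by (simp add: C_def induced_count_def)
qed

section \<open>Maximum counts and densities\<close>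

lemma finite_counts: "finite {induced_count F G |G. simple_graph G \<and> order G = n}"
proof (rule finite_subset)
  \<comment> \<open>There are infinitely many graphs of order n on natural numbers, but the counts
    are bounded; this makes \<open>Max\<close> meaningful.\<close>
  show "{induced_count F G |G. simple_graph G \<and> order G = n} \<subseteq> {..2 ^ n}"
  proof clarify
    fix G assume G: "simple_graph G" "n = order G"
    have "induced_count F G \<le> card (Pow (verts G))"
      unfolding induced_count_def using G by (intro card_mono) (auto simp: simple_graph_def)
    then show "induced_count F G \<le> 2 ^ order G" using G by (simp add: card_Pow simple_graph_def)
  qed
qed simp

lemma counts_nonempty: "{induced_count F G |G. simple_graph G \<and> order G = n} \<noteq> {}"
proof -
  have "simple_graph (graph_of {..<n} (\<lambda>_ _. False))" by (rule simple_graph_of) (auto simp: irreflp_def)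
  then have "induced_count F (graph_of {..<n} (\<lambda>_ _. False)) \<in> {induced_count F G |G. simple_graph G \<and> order G = n}"
    by (intro CollectI exI[of _ "graph_of {..<n} (\<lambda>_ _. False)"]) simp
  then show ?thesis by blast
qed

lemma induced_count_le_max_count:
  assumes "simple_graph G"
  shows "induced_count F G \<le> max_count F (order G)"
  unfolding max_count_def
  by (rule Max_ge[OF finite_counts]) (intro CollectI exI[of _ G] conjI refl assms)

lemma max_count_attained:
  obtains G where "simple_graph G" "order G = n" "induced_count F G = max_count F n"
proof -
  have "max_count F n \<in> {induced_count F G |G. simple_graph G \<and> order G = n}"
    unfolding max_count_def by (rule Max_in[OF finite_counts counts_nonempty])
  then show ?thesis using that unfolding mem_Collect_eq by metis
qed

lemma max_value_eq: "max_value (induced_density F) n = real (max_count F n) / real (n choose order F)"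
  unfolding max_value_def
proof (rule Max_eqI)
  have eq: "{induced_density F G |G. simple_graph G \<and> order G = n} =
    (\<lambda>c. real c / real (n choose order F)) ` {induced_count F G |G. simple_graph G \<and> order G = n}"
    unfolding induced_density_def setcompr_eq_image image_image by (intro image_cong refl) simp
  show "finite {induced_density F G |G. simple_graph G \<and> order G = n}"
    unfolding eq by (intro finite_imageI finite_counts)
  show "y \<le> real (max_count F n) / real (n choose order F)"
    if y: "y \<in> {induced_density F G |G. simple_graph G \<and> order G = n}" for y
  proof -
    from y[unfolded eq] obtain c where c: "y = real c / real (n choose order F)"
      "c \<in> {induced_count F G |G. simple_graph G \<and> order G = n}" by (rule imageE)
    have "c \<le> max_count F n" unfolding max_count_def by (rule Max_ge[OF finite_counts c(2)])
    then show ?thesis unfolding c by (intro divide_right_mono) auto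
  qed
  have "max_count F n \<in> {induced_count F G |G. simple_graph G \<and> order G = n}"
    unfolding max_count_def by (rule Max_in[OF finite_counts counts_nonempty])
  then show "real (max_count F n) / real (n choose order F) \<in> {induced_density F G |G. simple_graph G \<and> order G = n}"
    unfolding eq by (rule imageI)
qed

section \<open>Complete multipartite graphs, edit distance and largest parts\<close>

lemma complete_partite_with_adj:
  assumes "complete_partite_with G P" "u \<in> verts G" "v \<in> verts G"
  shows "adj G u v \<longleftrightarrow> \<not> (\<exists>A\<in>P. u \<in> A \<and> v \<in> A)"
proof -
  have P: "partition_on (verts G) P" and ed: "edges G = {{u, v} |u v. \<exists>A\<in>P. \<exists>B\<in>P. A \<noteq> B \<and> u \<in> A \<and> v \<in> B}"
    using assms by (auto simp: complete_partite_with_def)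
  have uniq: "C = D" if "C \<in> P" "D \<in> P" "x \<in> C" "x \<in> D" for C D x
    using that P by (auto simp: partition_on_def disjoint_def)
  obtain A B where AB: "A \<in> P" "u \<in> A" "B \<in> P" "v \<in> B"
    using assms(2,3) P unfolding partition_on_def by blast
  have "adj G u v \<longleftrightarrow> A \<noteq> B"
  proof
    assume "adj G u v"
    then obtain u' v' C D where "{u, v} = {u', v'}" "C \<in> P" "D \<in> P" "C \<noteq> D" "u' \<in> C" "v' \<in> D"
      by (auto simp: adj_def ed)
    then show "A \<noteq> B" using AB uniq by (metis doubleton_eq_iff)
  next
    assume "A \<noteq> B"
    then show "adj G u v" unfolding adj_def ed using AB by blast
  qed
  also have "A \<noteq> B \<longleftrightarrow> \<not> (\<exists>A\<in>P. u \<in> A \<and> v \<in> A)" using AB uniq by blast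
  finally show ?thesis .
qed

lemma complete_partite_cut:
  assumes "finite V" "A \<subseteq> V"
  shows "complete_partite_with (graph_of V (cut A)) ({A, V - A} - {{}})"
  unfolding complete_partite_with_def
proof (intro conjI)
  show "simple_graph (graph_of V (cut A))" using assms by (intro simple_graph_of) auto
  show "partition_on (verts (graph_of V (cut A))) ({A, V - A} - {{}})"
    using assms by (auto simp: partition_on_def disjoint_def)
  show "edges (graph_of V (cut A)) =
      {{u, v} |u v. \<exists>A'\<in>{A, V - A} - {{}}. \<exists>B\<in>{A, V - A} - {{}}. A' \<noteq> B \<and> u \<in> A' \<and> v \<in> B}"
  proof -
    have "u \<in> V \<and> v \<in> V \<and> cut A u v \<longleftrightarrow> (\<exists>A'\<in>{A, V - A} - {{}}. \<exists>B\<in>{A, V - A} - {{}}. A' \<noteq> B \<and> u \<in> A' \<and> v \<in> B)" for u v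
    proof -
      have "u \<in> V \<and> v \<in> V \<and> cut A u v \<longleftrightarrow> u \<in> A \<and> v \<in> V - A \<or> u \<in> V - A \<and> v \<in> A"
        using assms(2) unfolding cut_def by blast
      also have "\<dots> \<longleftrightarrow> (\<exists>A'\<in>{A, V - A} - {{}}. \<exists>B\<in>{A, V - A} - {{}}. A' \<noteq> B \<and> u \<in> A' \<and> v \<in> B)"
        (is "?L \<longleftrightarrow> ?R")
      proof
        assume ?L
        then show ?R
        proof
          assume *: "u \<in> A \<and> v \<in> V - A"
          then have "A \<in> {A, V - A} - {{}}" "V - A \<in> {A, V - A} - {{}}" "A \<noteq> V - A" by auto
          with * show ?R by (intro bexI[of _ A] bexI[of _ "V - A"]) simp_all
        next
          assume *: "u \<in> V - A \<and> v \<in> A"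
          then have "A \<in> {A, V - A} - {{}}" "V - A \<in> {A, V - A} - {{}}" "V - A \<noteq> A" by auto
          with * show ?R by (intro bexI[of _ "V - A"] bexI[of _ A]) simp_all
        qed
      qed auto
      finally show ?thesis .
    qed
    then show ?thesis by (simp add: graph_of_def)
  qed
qed

text \<open>The identity is an admissible bijection, and each edge in the symmetric difference comes
  from an ordered wrong pair.\<close>

lemma edit_distance_cut_le:
  assumes G: "simple_graph G" and A: "A \<subseteq> verts G"
  shows "edit_distance G (graph_of (verts G) (cut A)) \<le> 2 / (real (order G))\<^sup>2 * real (card (defects (adj G) A (verts G)))"
proof -
  let ?V = "verts G"
  let ?H = "graph_of (verts G) (cut A)"
  let ?d = "\<lambda>\<sigma>. card ((edges ?H - (\<lambda>e. \<sigma> ` e) ` edges G) \<union> ((\<lambda>e. \<sigma> ` e) ` edges G - edges ?H))"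
  let ?D = "{?d \<sigma> |\<sigma>. bij_betw \<sigma> (verts G) (verts ?H)}"
  have fin: "finite ?V" using G by (simp add: simple_graph_def)
  have edPow: "edges G \<subseteq> Pow ?V" "edges ?H \<subseteq> Pow ?V"
    using G by (auto simp: simple_graph_def graph_of_def)
  have "?D \<subseteq> {..card (Pow ?V)}"
  proof clarify
    fix \<sigma> assume "bij_betw \<sigma> (verts G) (verts ?H)"
    then have "\<sigma> ` ?V = ?V" by (simp add: bij_betw_def)
    then have "(\<lambda>e. \<sigma> ` e) ` edges G \<subseteq> Pow ?V" using edPow(1) by blast
    then show "?d \<sigma> \<le> card (Pow ?V)" using edPow fin by (intro card_mono) auto
  qed
  then have finD: "finite ?D" by (rule finite_subset) simp
  have "?d id \<in> ?D" by (intro CollectI exI[of _ id]) simp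
  then have "Min ?D \<le> ?d id" by (rule Min_le[OF finD])
  also have "?d id = card ((edges ?H - edges G) \<union> (edges G - edges ?H))" by simp
  also have "\<dots> \<le> card ((\<lambda>(u, v). {u, v}) ` defects (adj G) A ?V)"
  proof (rule card_mono)
    show "finite ((\<lambda>(u, v). {u, v}) ` defects (adj G) A ?V)" using fin by simp
    show "(edges ?H - edges G) \<union> (edges G - edges ?H) \<subseteq> (\<lambda>(u, v). {u, v}) ` defects (adj G) A ?V"
    proof
      fix e assume e: "e \<in> (edges ?H - edges G) \<union> (edges G - edges ?H)"
      have "simple_graph ?H" using fin by (intro simple_graph_of) auto
      then have "card e = 2" "e \<subseteq> ?V" using e G by (auto simp: simple_graph_def)
      then obtain u v where uv: "e = {u, v}" "u \<in> ?V" "v \<in> ?V" by (auto simp: card_2_iff)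
      have "adj G u v \<noteq> adj ?H u v" using e uv by (auto simp: adj_def)
      then have "(u, v) \<in> defects (adj G) A ?V" using uv adj_graph_of[OF symp_cut uv(2,3)] by (simp add: defects_def)
      then show "e \<in> (\<lambda>(u, v). {u, v}) ` defects (adj G) A ?V" using uv by force
    qed
  qed
  also have "\<dots> \<le> card (defects (adj G) A ?V)" using fin by (intro card_image_le) simp
  finally have "Min ?D \<le> card (defects (adj G) A ?V)" .
  then show ?thesis unfolding edit_distance_def by (intro mult_left_mono of_nat_mono) auto
qed

text \<open>Inclusion of multisets rather than membership, to treat a = b correctly. If b does not
  occur behind the first entry, it is that entry, and then a must occur behind it.\<close>

lemma two_largest:
  fixes xs :: "nat list"
  assumes "sorted (rev xs)" "{#a, b#} \<subseteq># mset xs" "b \<le> a"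
  obtains x y r where "xs = x # y # r" "a \<le> x" "b \<le> y"
proof -
  have "size {#a, b#} \<le> length xs" using size_mset_mono[OF assms(2)] by simp
  then obtain x y r where xs: "xs = x # y # r" by (cases xs; cases "tl xs") auto
  have srt: "\<And>z. z \<in> set (y # r) \<Longrightarrow> z \<le> x" "\<And>z. z \<in> set (y # r) \<Longrightarrow> z \<le> y"
    using assms(1) by (auto simp: xs sorted_append)
  have "a \<in># mset xs" using assms(2) by (auto dest: mset_subset_eqD)
  then have "a \<le> x" using srt xs by auto
  moreover have "b \<le> y"
  proof (cases "b \<in> set (y # r)")
    case False
    have "{#b#} + {#a#} \<subseteq># add_mset x (mset (y # r))" using assms(2) by (simp add: xs add_mset_commute)
    moreover have "b = x" using False assms(2) by (auto simp: xs dest: mset_subset_eqD)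
    ultimately have "{#a#} \<subseteq># mset (y # r)" by simp
    then have "a \<in> set (y # r)" by auto
    then show ?thesis using srt(2)[of a] assms(3) by simp
  qed (use srt in auto)
  ultimately show ?thesis using that xs by blast
qed

text \<open>Lower bounds from two given parts and an upper bound for the sum of the two largest
  sizes. Together they pin the sizes down, exactly for two parts and approximately if two parts
  cover almost everything.\<close>

lemma nth_largest_part_bounds:
  assumes fin: "finite V" and P: "partition_on V P"
  shows "nth_largest_part P 0 + nth_largest_part P 1 \<le> card V"
    and "A \<in> P \<Longrightarrow> B \<in> P \<Longrightarrow> A \<noteq> B \<Longrightarrow> card B \<le> card A \<Longrightarrow>
      card A \<le> nth_largest_part P 0 \<and> card B \<le> nth_largest_part P 1"
    and "card P \<le> i \<Longrightarrow> nth_largest_part P i = 0"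
proof -
  have finP: "finite P" using finite_elements[OF fin P] .
  define xs where "xs = rev (sorted_list_of_multiset (image_mset card (mset_set P)))"
  have nth: "nth_largest_part P i = (if i < length xs then xs ! i else 0)" for i
    by (simp add: nth_largest_part_def xs_def Let_def)
  have m: "mset xs = image_mset card (mset_set P)" by (simp add: xs_def)
  have "sum_list xs = (\<Sum>A\<in>P. card A)"
    using m by (metis sum_mset_sum_list sum_unfold_sum_mset)
  then have sum: "sum_list xs = card V" using card_partition_sum[OF fin P] by simp
  show "nth_largest_part P 0 + nth_largest_part P 1 \<le> card V"
    unfolding nth sum[symmetric] by (cases xs; cases "tl xs") auto
  have len: "length xs = card P" using m by (metis size_mset size_image_mset size_mset_set)
  show "nth_largest_part P i = 0" if "card P \<le> i" using that by (simp add: nth len)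
  show "card A \<le> nth_largest_part P 0 \<and> card B \<le> nth_largest_part P 1"
    if AB: "A \<in> P" "B \<in> P" "A \<noteq> B" "card B \<le> card A"
  proof -
    have "mset_set {A, B} \<subseteq># mset_set P" using AB finP by (intro subset_imp_msubset_mset_set) auto
    then have "image_mset card (mset_set {A, B}) \<subseteq># mset xs" unfolding m by (rule image_mset_subseteq_mono)
    then have sub: "{#card A, card B#} \<subseteq># mset xs" using AB(3) by simp
    have "sorted (rev xs)" by (simp add: xs_def)
    then obtain x y r where "xs = x # y # r" "card A \<le> x" "card B \<le> y"
      using two_largest[OF _ sub AB(4)] by blast
    then show ?thesis by (simp add: nth)
  qed
qed

section \<open>Normalisation and the limit density\<close>

context biclique_params
begin

abbreviation F :: ugraph where "F \<equiv> complete_bipartite s t"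
abbreviation L :: "ugraph \<Rightarrow> real" where "L \<equiv> induced_density F"

text \<open>The number of ordered pairs of sides per copy.\<close>

definition \<kappa> :: real where "\<kappa> = (if s = t then 2 else 1)"

definition N :: "ugraph \<Rightarrow> real" where "N G = real (card (bicliques s t (adj G) (verts G)))"

text \<open>The factor between the scaled count S N / n^k, on which the estimates are made, and the
  density.\<close>

definition \<rho> :: "nat \<Rightarrow> real" where "\<rho> n = real n ^ k / (\<kappa> * S * real (n choose k))"

lemma \<kappa>_pos: "\<kappa> > 0" by (simp add: \<kappa>_def)

lemma N_eq: "simple_graph G \<Longrightarrow> N G = \<kappa> * real (induced_count F G)"
  using card_bicliques_eq[of G s t] s_pos t_ge2 by (simp add: N_def \<kappa>_def)

lemma N_le_max_count: "simple_graph G \<Longrightarrow> N G \<le> \<kappa> * real (max_count F (order G))"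
  using induced_count_le_max_count[of G F] \<kappa>_pos by (simp add: N_eq)

lemma bicliques_le_max_count:
  fixes V :: "nat set" and E :: "nat \<Rightarrow> nat \<Rightarrow> bool"
  assumes "finite V" "symp E" "irreflp E"
  shows "real (card (bicliques s t E V)) \<le> \<kappa> * real (max_count F (card V))"
  using N_le_max_count[OF simple_graph_of[OF assms(1,3)]] assms(2) by (simp add: N_def bicliques_graph_of)

lemma N_upper: "simple_graph G \<Longrightarrow> S * N G \<le> M * real (order G) ^ k"
  unfolding N_def by (rule count_le) (auto simp: simple_graph_def symp_adj irreflp_adj)

lemma max_count_upper: "S * (\<kappa> * real (max_count F n)) \<le> M * real n ^ k"
proof -
  obtain G where "simple_graph G" "order G = n" "induced_count F G = max_count F n" by (rule max_count_attained)
  then show ?thesis using N_upper[of G] N_eq[of G] by simp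
qed

lemma density_eq:
  assumes "n > 0"
  shows "c / real (n choose k) = (S * (\<kappa> * c) / real n ^ k) * \<rho> n"
  using assms S_pos \<kappa>_pos by (simp add: \<rho>_def)

lemma L_eq: "simple_graph G \<Longrightarrow> order G > 0 \<Longrightarrow> L G = (S * N G / real (order G) ^ k) * \<rho> (order G)"
  unfolding induced_density_def N_eq by (subst density_eq[symmetric]) simp_all

lemma binomial_ratio_tendsto: "(\<lambda>n. fact k * real (n choose k) / real n ^ k) \<longlonglongrightarrow> 1"
proof (rule tendsto_sandwich)
  show "\<forall>\<^sub>F n in sequentially. 1 - real (k * (k + 1)) / real n \<le> fact k * real (n choose k) / real n ^ k"
    using eventually_gt_at_top[of 0]
  proof eventually_elim
    case (elim n)
    have "real n ^ k \<le> fact k * real ((n - 1) choose k) + real (k * (k + 1)) * real n ^ k / real n"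
      using elim by (intro power_le_binomial_fact) auto
    also have "fact k * real ((n - 1) choose k) \<le> fact k * real (n choose k)"
      by (intro mult_left_mono of_nat_mono binomial_right_mono) auto
    finally have "(1 - real (k * (k + 1)) / real n) * real n ^ k \<le> fact k * real (n choose k)"
      by (simp only: left_diff_distrib) simp
    then show ?case using elim by (simp only: pos_le_divide_eq zero_less_power of_nat_0_less_iff)
  qed
  show "\<forall>\<^sub>F n in sequentially. fact k * real (n choose k) / real n ^ k \<le> 1"
    using eventually_gt_at_top[of 0]
  proof eventually_elim
    case (elim n)
    then show ?case using binomial_fact_le_power[of k n] by simp
  qed
  show "(\<lambda>n. 1 - real (k * (k + 1)) / real n) \<longlonglongrightarrow> 1"
    using tendsto_diff[OF tendsto_const lim_const_over_n] by (metis diff_zero)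
qed simp

lemma \<rho>_tendsto: "\<rho> \<longlonglongrightarrow> fact k / (\<kappa> * S)"
proof -
  have "(\<lambda>n. fact k / (\<kappa> * S) / (fact k * real (n choose k) / real n ^ k)) \<longlonglongrightarrow> fact k / (\<kappa> * S) / 1"
    by (intro tendsto_divide tendsto_const binomial_ratio_tendsto) simp
  moreover have "(\<lambda>n. fact k / (\<kappa> * S) / (fact k * real (n choose k) / real n ^ k)) = \<rho>"
    by (auto simp: \<rho>_def fun_eq_iff)
  ultimately show ?thesis by simp
qed

lemma \<rho>_limit_pos: "fact k / (\<kappa> * S) > 0"
  using \<kappa>_pos S_pos by simp

text \<open>Squeezed between the cut with proportion close to \<alpha> and the upper bound for all
  graphs.\<close>

lemma max_count_tendsto: "(\<lambda>n. S * (\<kappa> * real (max_count F n)) / real n ^ k) \<longlonglongrightarrow> M"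
proof (rule tendsto_sandwich[OF _ _ cut_count_lower_tendsto tendsto_const])
  show "\<forall>\<^sub>F n in sequentially. f (real (nat \<lceil>\<alpha> * real n\<rceil>) / real n) - 4 * real (k * (k + 1)) / real n
      \<le> S * (\<kappa> * real (max_count F n)) / real n ^ k"
    using eventually_gt_at_top[of 0]
  proof eventually_elim
    case (elim n)
    define A where "A = {..<nat \<lceil>\<alpha> * real n\<rceil>}"
    have A: "A \<subseteq> {..<n}" "card A = nat \<lceil>\<alpha> * real n\<rceil>" using cut_fraction_le[of n] by (auto simp: A_def)
    have "(f (real (nat \<lceil>\<alpha> * real n\<rceil>) / real n) - 4 * real (k * (k + 1)) / real n) * real n ^ k
      \<le> S * real (card (bicliques s t (cut A) {..<n}))"
      using cut_count_ge[OF _ A(1)] elim by (simp add: A(2) lessThan_empty_iff)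
    also have "\<dots> \<le> S * (\<kappa> * real (max_count F n))"
      using bicliques_le_max_count[of "{..<n}" "cut A"] S_pos by (intro mult_left_mono) auto
    finally show ?case using elim by (simp only: pos_le_divide_eq zero_less_power of_nat_0_less_iff)
  qed
  show "\<forall>\<^sub>F n in sequentially. S * (\<kappa> * real (max_count F n)) / real n ^ k \<le> M"
    using eventually_gt_at_top[of 0]
  proof eventually_elim
    case (elim n)
    then show ?case using max_count_upper[of n] by (simp add: pos_divide_le_eq)
  qed
qed

definition \<Lambda> :: real where "\<Lambda> = M * (fact k / (\<kappa> * S))"

lemma max_density_tendsto: "(\<lambda>n. real (max_count F n) / real (n choose order F)) \<longlonglongrightarrow> \<Lambda>"
proof (rule Lim_transform_eventually)
  show "(\<lambda>n. (S * (\<kappa> * real (max_count F n)) / real n ^ k) * \<rho> n) \<longlonglongrightarrow> \<Lambda>"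
    unfolding \<Lambda>_def by (intro tendsto_mult max_count_tendsto \<rho>_tendsto)
  show "\<forall>\<^sub>F n in sequentially. (S * (\<kappa> * real (max_count F n)) / real n ^ k) * \<rho> n = real (max_count F n) / real (n choose order F)"
    using eventually_gt_at_top[of 0]
  proof eventually_elim
    case (elim n)
    show ?case using density_eq[OF elim, of "real (max_count F n)"] by simp
  qed
qed

lemma inducibility_eq: "inducibility F = \<Lambda>"
  unfolding inducibility_def by (rule limI[OF max_density_tendsto])

lemma limit_max_eq: "limit_max L = \<Lambda>"
proof -
  have "max_value L = (\<lambda>n. real (max_count F n) / real (n choose order F))" by (rule ext) (rule max_value_eq)
  then show ?thesis unfolding limit_max_def using limI[OF max_density_tendsto] by metis
qed

lemma \<Lambda>_eq: "\<Lambda> = real (k choose s) * M_st s t"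
proof -
  have "M_st s t = M / \<kappa>" by (simp add: M_st_def M_def \<kappa>_def)
  moreover have "real (k choose s) = fact k / S" by (simp add: binomial_fact S_def)
  ultimately show ?thesis by (simp add: \<Lambda>_def mult_ac)
qed

text \<open>The limit of \<rho> is positive, so it is possible to divide by this factor as well as
  to multiply by it.\<close>

lemma L_tendsto_iff:
  assumes "\<And>n. simple_graph (H n)" "filterlim (\<lambda>n. order (H n)) at_top sequentially"
  shows "(\<lambda>n. L (H n)) \<longlonglongrightarrow> \<Lambda> \<longleftrightarrow> (\<lambda>n. S * N (H n) / real (order (H n)) ^ k) \<longlonglongrightarrow> M"
proof -
  have \<rho>: "(\<lambda>n. \<rho> (order (H n))) \<longlonglongrightarrow> fact k / (\<kappa> * S)"
    by (rule filterlim_compose[OF \<rho>_tendsto assms(2)])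
  have "\<forall>\<^sub>F n in sequentially. order (H n) > 0" by (rule eventually_compose_filterlim[OF eventually_gt_at_top assms(2)])
  then have eq: "\<forall>\<^sub>F n in sequentially. (S * N (H n) / real (order (H n)) ^ k) * \<rho> (order (H n)) = L (H n)"
    by eventually_elim (rule L_eq[symmetric], rule assms(1))
  have "\<forall>\<^sub>F n in sequentially. \<rho> (order (H n)) > 0" using order_tendstoD(1)[OF \<rho> \<rho>_limit_pos] .
  with eq have eq': "\<forall>\<^sub>F n in sequentially. L (H n) / \<rho> (order (H n)) = S * N (H n) / real (order (H n)) ^ k"
    by eventually_elim (metis less_irrefl nonzero_mult_div_cancel_right)
  show ?thesis
  proof
    assume "(\<lambda>n. L (H n)) \<longlonglongrightarrow> \<Lambda>"
    then have "(\<lambda>n. L (H n) / \<rho> (order (H n))) \<longlonglongrightarrow> \<Lambda> / (fact k / (\<kappa> * S))"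
      using \<rho> \<rho>_limit_pos by (intro tendsto_divide) auto
    moreover have "\<Lambda> / (fact k / (\<kappa> * S)) = M"
      unfolding \<Lambda>_def
      by (rule nonzero_mult_div_cancel_right) (rule less_imp_neq[OF \<rho>_limit_pos, symmetric])
    ultimately show "(\<lambda>n. S * N (H n) / real (order (H n)) ^ k) \<longlonglongrightarrow> M"
      using Lim_transform_eventually[OF _ eq'] by simp
  next
    assume "(\<lambda>n. S * N (H n) / real (order (H n)) ^ k) \<longlonglongrightarrow> M"
    then have "(\<lambda>n. (S * N (H n) / real (order (H n)) ^ k) * \<rho> (order (H n))) \<longlonglongrightarrow> \<Lambda>"
      unfolding \<Lambda>_def by (intro tendsto_mult \<rho>)
    then show "(\<lambda>n. L (H n)) \<longlonglongrightarrow> \<Lambda>" by (rule Lim_transform_eventually[OF _ eq])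
  qed
qed

section \<open>Perfect stability\<close>

lemma perfectly_stable_L: "perfectly_stable L"
proof -
  obtain \<gamma> n\<^sub>0 where \<gamma>: "\<gamma> > 0" and gs:
    "\<And>(V :: nat set) E m. finite V \<Longrightarrow> real (card V) \<ge> n\<^sub>0 \<Longrightarrow> symp E \<Longrightarrow> irreflp E \<Longrightarrow>
      (\<And>E. symp E \<Longrightarrow> irreflp E \<Longrightarrow> real (card (bicliques s t E V)) \<le> m) \<Longrightarrow>
      \<exists>A\<subseteq>V. real (card (bicliques s t E V)) + \<gamma> * real (card V) ^ (k - 2) * real (card (defects E A V)) \<le> m"
    by (rule global_stability[where 'a=nat]) blast
  \<comment> \<open>The first entry turns the loss per wrong pair into a constant for the edit
    distance, whose normalisation contributes the 2. The bound \<open>n\<^sub>0\<close> is the range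
    of \<open>global_stability\<close>, and k keeps the binomial coefficient positive.\<close>
  define C where "C = max (2 * \<kappa> / \<gamma>) (max n\<^sub>0 (real k))"
  have k2: "k \<ge> 2" using s_pos t_ge2 by simp
  have "real k > 0" using k2 by simp
  then have C: "C > 0" "2 * \<kappa> / \<gamma> \<le> C" "n\<^sub>0 \<le> C" "real k \<le> C" by (auto simp: C_def less_max_iff_disj)
  show ?thesis unfolding perfectly_stable_def
  proof (intro exI[of _ C] conjI allI impI C(1))
    fix G assume "simple_graph G \<and> C \<le> real (order G)"
    then have G: "simple_graph G" and n: "C \<le> real (order G)" by auto
    define n where "n = order G"
    have nk: "k \<le> n" "n\<^sub>0 \<le> n" using n C by (auto simp: n_def)
    then have npos: "n > 0" using k2 by simp
    have fin: "finite (verts G)" using G by (simp add: simple_graph_def)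
    obtain A where A: "A \<subseteq> verts G"
      "N G + \<gamma> * real n ^ (k - 2) * real (card (defects (adj G) A (verts G))) \<le> \<kappa> * real (max_count F n)"
      using gs[OF fin _ symp_adj irreflp_adj[OF G] bicliques_le_max_count[OF fin]] nk(2)
      unfolding n_def N_def by blast
    let ?H = "graph_of (verts G) (cut A)" and ?d = "real (card (defects (adj G) A (verts G)))"
    have Cn: "real (n choose k) > 0" using nk by simp
    have "2 * \<kappa> \<le> C * \<gamma>" using C(2) \<gamma> by (simp add: field_simps)
    then have "2 * \<kappa> * (real n ^ (k - 2) * ?d) \<le> C * \<gamma> * (real n ^ (k - 2) * ?d)"
      by (intro mult_right_mono) auto
    also have "\<dots> = C * (\<gamma> * real n ^ (k - 2) * ?d)" by simp
    also have "\<dots> \<le> C * (\<kappa> * real (max_count F n) - N G)"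
      using A(2) C(1) by (intro mult_left_mono) auto
    also have "\<dots> = \<kappa> * (C * (real (max_count F n) - real (induced_count F G)))"
      by (simp add: N_eq[OF G] algebra_simps)
    finally have "\<kappa> * (2 * (real n ^ (k - 2) * ?d)) \<le> \<kappa> * (C * (real (max_count F n) - real (induced_count F G)))"
      by (simp add: mult_ac)
    then have main: "2 * (real n ^ (k - 2) * ?d) \<le> C * (real (max_count F n) - real (induced_count F G))"
      using \<kappa>_pos by (simp only: mult_le_cancel_left_pos)
    have nn: "real n ^ k = real n ^ (k - 2) * (real n)\<^sup>2"
    proof -
      have "k = (k - 2) + 2" using k2 by simp
      then show ?thesis by (metis power_add)
    qed
    have "2 / (real n)\<^sup>2 * ?d = 2 * (real n ^ (k - 2) * ?d) / real n ^ k"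
      using npos by (simp add: nn)
    \<comment> \<open>The binomial coefficient is at most n^k, so replacing n^k by it only weakens
      the bound.\<close>
    also have "\<dots> \<le> 2 * (real n ^ (k - 2) * ?d) / real (n choose k)"
    proof (rule divide_left_mono)
      show "real (n choose k) \<le> real n ^ k" using of_nat_mono[OF binomial_le_power[of n k], where 'a=real] by simp
    qed (use npos Cn in auto)
    also have "\<dots> \<le> C * (real (max_count F n) - real (induced_count F G)) / real (n choose k)"
      using main Cn by (intro divide_right_mono) auto
    also have "\<dots> = C * (max_value L n - L G)"
      unfolding max_value_eq induced_density_def by (simp add: n_def diff_divide_distrib right_diff_distrib)
    finally have "edit_distance G ?H \<le> C * (max_value L (order G) - L G)"
      using edit_distance_cut_le[OF G A(1)] by (simp add: n_def)
    moreover have "complete_partite ?H"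
      using complete_partite_cut[OF fin A(1)] by (auto simp: complete_partite_def)
    ultimately show "\<exists>H. complete_partite H \<and> order H = order G \<and> edit_distance G H \<le> C * (max_value L (order G) - L G)"
      by (intro exI[of _ ?H]) simp
  qed
qed

section \<open>The unique maximiser\<close>

lemma maximiser_two_part: "maximiser L (two_part_seq \<alpha>)"
proof -
  have \<alpha>01: "1/2 \<le> \<alpha>" "\<alpha> < 1" using \<alpha> \<alpha>_less_1 by auto
  \<comment> \<open>Rounding up keeps the first part the larger one, as \<alpha> >= 1/2. The
    sequence is shifted by m below, so that the second part is never empty.\<close>
  define a where "a n = nat \<lceil>\<alpha> * real n\<rceil>" for n
  have lim: "(\<lambda>n. real (a n) / real n) \<longlonglongrightarrow> \<alpha>" using cut_fraction_tendsto by (simp add: a_def)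
  have "\<forall>\<^sub>F n in sequentially. real (a n) / real n < 1" using order_tendstoD(2)[OF lim \<alpha>01(2)] .
  moreover have "\<forall>\<^sub>F n in sequentially. n > (0 :: nat)" by (rule eventually_gt_at_top)
  ultimately have "\<forall>\<^sub>F n in sequentially. n > 0 \<and> a n < n" by eventually_elim simp
  then obtain m where m: "\<And>n. n \<ge> m \<Longrightarrow> n > 0 \<and> a n < n" unfolding eventually_sequentially by blast
  define H where "H n = graph_of {..<n + m} (cut {..<a (n + m)})" for n
  define P where "P n = {{..<a (n + m)}, {..<n + m} - {..<a (n + m)}} - {{}}" for n
  have am: "a (n + m) < n + m" "n + m \<le> 2 * a (n + m)" for n
  proof -
    show "a (n + m) < n + m" using m[of "n + m"] by simp
    have "1/2 * real (n + m) \<le> \<alpha> * real (n + m)" using \<alpha>01 by (intro mult_right_mono) auto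
    also have "\<dots> \<le> real (a (n + m))" unfolding a_def by linarith
    finally have "real (n + m) \<le> real (2 * a (n + m))" by simp
    then show "n + m \<le> 2 * a (n + m)" by (simp only: of_nat_le_iff)
  qed
  have CP: "complete_partite_with (H n) (P n)" for n
    unfolding H_def P_def using am[of n] by (intro complete_partite_cut) auto
  have ord [simp]: "order (H n) = n + m" for n by (simp add: H_def)
  have flim: "filterlim (\<lambda>n. n + m) at_top sequentially" by (rule filterlim_add_const_nat_at_top)
  have a_pos: "a (n + m) > 0" for n using am[of n] by linarith
  have parts: "nth_largest_part (P n) i = (if i = 0 then a (n + m) else if i = 1 then n + m - a (n + m) else 0)" for n i
  proof -
    let ?A = "{..<a (n + m)}" and ?B = "{..<n + m} - {..<a (n + m)}"
    have part: "partition_on {..<n + m} (P n)" using CP[of n] by (simp add: complete_partite_with_def H_def)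
    have cB: "card ?B = n + m - a (n + m)" using am[of n] by (subst card_Diff_subset) auto
    have AB: "?A \<in> P n" "?B \<in> P n" "?A \<noteq> ?B" 
    proof -
      have "0 \<in> ?A" "0 \<notin> ?B" using a_pos[of n] by simp_all
      moreover have "a (n + m) \<in> ?B" using am[of n] by simp
      ultimately show "?A \<in> P n" "?B \<in> P n" "?A \<noteq> ?B" unfolding P_def by blast+
    qed
    have le: "card ?B \<le> card ?A" using cB am[of n] by simp
    have "card (P n) \<le> card {?A, ?B}" unfolding P_def by (intro card_mono) auto
    then have c2: "card (P n) \<le> 2" using card_insert_le_m1[of 2 "{?B}" ?A] by simp
    have "a (n + m) \<le> nth_largest_part (P n) 0" "n + m - a (n + m) \<le> nth_largest_part (P n) 1"
      using nth_largest_part_bounds(2)[OF _ part AB le] cB by simp_all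
    moreover have "nth_largest_part (P n) 0 + nth_largest_part (P n) 1 \<le> n + m"
      using nth_largest_part_bounds(1)[OF _ part] by simp
    ultimately have "nth_largest_part (P n) 0 = a (n + m)" "nth_largest_part (P n) 1 = n + m - a (n + m)"
      using am[of n] by linarith+
    moreover have "nth_largest_part (P n) i = 0" if "i \<ge> 2"
      using nth_largest_part_bounds(3)[OF _ part] c2 that by simp
    moreover consider "i = 0" | "i = 1" | "i \<ge> 2" by linarith
    ultimately show ?thesis by cases simp_all
  qed
  have lim': "(\<lambda>n. real (a (n + m)) / real (n + m)) \<longlonglongrightarrow> \<alpha>"
    using LIMSEQ_ignore_initial_segment[OF lim, of m] .
  have pos: "n + m > 0" for n using am[of n] by linarith
  have lims: "(\<lambda>n. real (nth_largest_part (P n) i) / real (order (H n))) \<longlonglongrightarrow> two_part_seq \<alpha> i" for i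
  proof -
    have "(\<lambda>n. 1 - real (a (n + m)) / real (n + m)) \<longlonglongrightarrow> 1 - \<alpha>" by (intro tendsto_intros lim')
    moreover have "1 - real (a (n + m)) / real (n + m) = real (n + m - a (n + m)) / real (n + m)" for n
      using am[of n] pos[of n] by (simp add: of_nat_diff less_imp_le diff_divide_distrib del: of_nat_add)
    ultimately have "(\<lambda>n. real (n + m - a (n + m)) / real (n + m)) \<longlonglongrightarrow> 1 - \<alpha>" by simp
    with lim' show ?thesis unfolding parts ord two_part_seq_def by (cases "i = 0"; cases "i = 1") simp_all
  qed
  have sg: "simple_graph (H n)" for n using CP by (simp add: complete_partite_with_def)
  have "(\<lambda>n. S * N (H n) / real (order (H n)) ^ k) \<longlonglongrightarrow> M"
  proof (rule tendsto_sandwich[OF _ _ LIMSEQ_ignore_initial_segment[OF cut_count_lower_tendsto, of m] tendsto_const])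
    show "\<forall>\<^sub>F n in sequentially. f (real (nat \<lceil>\<alpha> * real (n + m)\<rceil>) / real (n + m)) - 4 * real (k * (k + 1)) / real (n + m)
      \<le> S * N (H n) / real (order (H n)) ^ k"
    proof (intro always_eventually allI)
      fix n
      have "(f (real (a (n + m)) / real (n + m)) - 4 * real (k * (k + 1)) / real (n + m)) * real (n + m) ^ k
        \<le> S * real (card (bicliques s t (cut {..<a (n + m)}) {..<n + m}))"
        using cut_count_ge[of "{..<n + m}" "{..<a (n + m)}"] am[of n] pos[of n] by (simp add: lessThan_empty_iff)
      also have "\<dots> = S * N (H n)" by (simp add: N_def H_def bicliques_graph_of)
      finally show "f (real (nat \<lceil>\<alpha> * real (n + m)\<rceil>) / real (n + m)) - 4 * real (k * (k + 1)) / real (n + m)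
        \<le> S * N (H n) / real (order (H n)) ^ k"
        using pos[of n] unfolding ord a_def by (simp only: pos_le_divide_eq zero_less_power of_nat_0_less_iff)
    qed
    show "\<forall>\<^sub>F n in sequentially. S * N (H n) / real (order (H n)) ^ k \<le> M"
    proof (intro always_eventually allI)
      fix n
      show "S * N (H n) / real (order (H n)) ^ k \<le> M"
        using N_upper[OF sg[of n]] pos[of n] unfolding ord
        by (simp only: pos_divide_le_eq zero_less_power of_nat_0_less_iff)
    qed
  qed
  then have L: "(\<lambda>n. L (H n)) \<longlonglongrightarrow> limit_max L"
    unfolding limit_max_eq using flim by (subst L_tendsto_iff[OF sg]) simp_all
  have zero: "two_part_seq \<alpha> i = 0" if "i \<notin> {0, 1}" for i using that by (simp add: two_part_seq_def)
  have sums: "two_part_seq \<alpha> sums (\<Sum>i\<in>{0, 1}. two_part_seq \<alpha> i)"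
    using zero by (intro sums_finite) auto
  have "decseq (two_part_seq \<alpha>)"
    unfolding decseq_Suc_iff using \<alpha>01 by (auto simp: two_part_seq_def)
  moreover have "\<forall>i. two_part_seq \<alpha> i \<ge> 0" using \<alpha>01 by (simp add: two_part_seq_def)
  moreover have "summable (two_part_seq \<alpha>)" "suminf (two_part_seq \<alpha>) \<le> 1"
    using sums_summable[OF sums] sums_unique[OF sums] by (auto simp: two_part_seq_def)
  moreover have "filterlim (\<lambda>n. order (H n)) at_top sequentially" using flim by simp
  ultimately show ?thesis unfolding maximiser_def using CP L lims by blast
qed

lemma maximiser_unique:
  assumes "maximiser L x"
  shows "x = two_part_seq \<alpha>"
proof -
  from assms obtain H P where x: "decseq x" "\<And>i. x i \<ge> 0" "summable x" "suminf x \<le> 1"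
    and CP: "\<And>n. complete_partite_with (H n) (P n)" and flim: "filterlim (\<lambda>n. order (H n)) at_top sequentially"
    and lL: "(\<lambda>n. L (H n)) \<longlonglongrightarrow> \<Lambda>"
    and parts: "\<And>i. (\<lambda>n. real (nth_largest_part (P n) i) / real (order (H n))) \<longlonglongrightarrow> x i"
    unfolding maximiser_def limit_max_eq by blast
  have sg: "simple_graph (H n)" and part: "partition_on (verts (H n)) (P n)" for n
    using CP by (auto simp: complete_partite_with_def)
  have fin: "finite (verts (H n))" for n using sg by (simp add: simple_graph_def)
  have lN: "(\<lambda>n. S * N (H n) / real (order (H n)) ^ k) \<longlonglongrightarrow> M"
    using lL L_tendsto_iff[OF sg flim] by simp
  have pos: "\<forall>\<^sub>F n in sequentially. order (H n) > 0" by (rule eventually_compose_filterlim[OF eventually_gt_at_top flim])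
  \<comment> \<open>For small \<eta> two parts cover all but a proportion \<eta>. The proportion y
    of the larger of them is close to x 0, and f is nearly M at y.\<close>
  have key: "\<forall>\<^sub>F n in sequentially. \<exists>y. 0 \<le> y \<and> y \<le> 1 \<and> \<bar>y - x 0\<bar> < 2 * \<eta> \<and>
      1 - \<eta> \<le> real (nth_largest_part (P n) 0) / real (order (H n)) + real (nth_largest_part (P n) 1) / real (order (H n)) \<and>
      real (nth_largest_part (P n) 0) / real (order (H n)) + real (nth_largest_part (P n) 1) / real (order (H n)) \<le> 1 \<and>
      M - \<eta> < f y + S * (2 * \<eta> * 2 ^ k)" if \<eta>: "\<eta> > 0" for \<eta>
  proof -
    obtain \<epsilon> where \<epsilon>: "\<epsilon> > 0"
      "\<And>(V :: nat set) P E. finite V \<Longrightarrow> V \<noteq> {} \<Longrightarrow> partition_on V P \<Longrightarrow>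
      (\<And>u v. u \<in> V \<Longrightarrow> v \<in> V \<Longrightarrow> E u v \<longleftrightarrow> \<not> (\<exists>A\<in>P. u \<in> A \<and> v \<in> A)) \<Longrightarrow>
      (M - \<epsilon>) * real (card V) ^ k < S * real (card (bicliques s t E V)) \<Longrightarrow>
      \<exists>A\<in>P. \<exists>B\<in>P. A \<noteq> B \<and> real (card A + card B) > (1 - \<eta>) * card V"
      by (rule multipartite_near_max[OF \<eta>, where 'a=nat]) blast
    have "\<forall>\<^sub>F n in sequentially. S * N (H n) / real (order (H n)) ^ k > M - min \<epsilon> \<eta>"
      using \<epsilon>(1) \<eta> by (intro order_tendstoD(1)[OF lN]) simp
    moreover have "\<forall>\<^sub>F n in sequentially. dist (real (nth_largest_part (P n) 0) / real (order (H n))) (x 0) < \<eta>"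
      by (rule tendstoD[OF parts \<eta>])
    ultimately show ?thesis using pos
    proof eventually_elim
      case (elim n)
      let ?V = "verts (H n)" and ?E = "adj (H n)"
      define m where "m = order (H n)"
      have m: "m > 0" using elim by (simp add: m_def)
      have Vne: "?V \<noteq> {}" using elim by auto
      have E: "\<And>u v. u \<in> ?V \<Longrightarrow> v \<in> ?V \<Longrightarrow> ?E u v \<longleftrightarrow> \<not> (\<exists>A\<in>P n. u \<in> A \<and> v \<in> A)"
        by (rule complete_partite_with_adj[OF CP])
      have "(M - min \<epsilon> \<eta>) * real m ^ k < S * N (H n)"
        using elim(1) m by (simp add: m_def pos_less_divide_eq)
      moreover have "(M - \<epsilon>) * real m ^ k \<le> (M - min \<epsilon> \<eta>) * real m ^ k" "(M - \<eta>) * real m ^ k \<le> (M - min \<epsilon> \<eta>) * real m ^ k"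
        by (intro mult_right_mono; simp)+
      ultimately have big: "(M - \<epsilon>) * real m ^ k < S * N (H n)" "(M - \<eta>) * real m ^ k < S * N (H n)" by linarith+
      obtain A' B' where AB': "A' \<in> P n" "B' \<in> P n" "A' \<noteq> B'" "real (card A' + card B') > (1 - \<eta>) * m"
        using \<epsilon>(2)[OF fin Vne part E] big(1) unfolding m_def N_def by blast
      obtain A B where AB: "A \<in> P n" "B \<in> P n" "A \<noteq> B" "real (card A + card B) > (1 - \<eta>) * m" "card B \<le> card A"
      proof (cases "card B' \<le> card A'")
        case True
        then show ?thesis using AB' that by blast
      next
        case False
        then show ?thesis using AB' that[of B' A'] by (simp add: add.commute)
      qed
      define p q where "p = nth_largest_part (P n) 0" and "q = nth_largest_part (P n) 1"
      have pq: "p + q \<le> m" "card A \<le> p" "card B \<le> q"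
        using nth_largest_part_bounds(1)[OF fin part] nth_largest_part_bounds(2)[OF fin part AB(1-3,5)]
        unfolding p_def q_def m_def by auto
      define y where "y = real (card A) / real m"
      have cA: "card A \<le> m" using pq by linarith
      have y01: "0 \<le> y" "y \<le> 1" using cA m by (auto simp: y_def)
      \<comment> \<open>B is at most the second largest part, so the largest part exceeds A by no
        more than what A and B leave uncovered.\<close>
      have "real p \<le> real (card A) + \<eta> * m" using pq AB(4) by (simp add: algebra_simps)
      then have "\<bar>real (card A) - real p\<bar> \<le> \<eta> * m" using pq(2) by simp
      then have "\<bar>real (card A) - real p\<bar> / m \<le> \<eta>" using m by (simp add: pos_divide_le_eq)
      then have "\<bar>y - real p / m\<bar> \<le> \<eta>" by (simp add: y_def diff_divide_distrib[symmetric])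
      moreover have "\<bar>real p / m - x 0\<bar> < \<eta>" using elim(2) by (simp add: p_def m_def dist_real_def)
      ultimately have yx: "\<bar>y - x 0\<bar> < 2 * \<eta>" by linarith
      have "(1 - \<eta>) * m \<le> real (p + q)" using AB(4) pq by linarith
      then have s1: "1 - \<eta> \<le> real p / m + real q / m" using m by (simp add: add_divide_distrib[symmetric] pos_le_divide_eq)
      have s2: "real p / m + real q / m \<le> 1" using pq(1) m by (simp add: add_divide_distrib[symmetric])
      have AV: "A \<subseteq> ?V" using part[of n] AB(1) by (auto simp: partition_on_def)
      have "card (defects ?E A ?V) \<le> 2 * (m - (card A + card B)) * m"
        unfolding m_def by (rule defects_two_parts[OF fin part AB(1-3) E])
      then have "real (card (defects ?E A ?V)) \<le> real (2 * (m - (card A + card B)) * m)" by (rule of_nat_mono)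
      also have "\<dots> = 2 * (real m - real (card A + card B)) * m" using pq by (simp add: of_nat_diff)
      also have "\<dots> \<le> 2 * (\<eta> * m) * m" using AB(4) by (intro mult_right_mono mult_left_mono) (auto simp: algebra_simps)
      finally have d: "real (card (defects ?E A ?V)) \<le> 2 * \<eta> * (real m)\<^sup>2" by (simp add: power2_eq_square)
      obtain r where r: "r * card ?V ^ 2 \<le> card (defects ?E A ?V) * (2 ^ (s + t) * card ?V ^ (s + t))"
        "card (bicliques s t ?E ?V) \<le> card (bicliques s t (cut A) ?V) + r"
        by (rule card_bicliques_le_cut[OF fin[of n] symp_adj irreflp_adj[OF sg[of n]], of A s t])
      have "real r * (real m)\<^sup>2 \<le> real (card (defects ?E A ?V)) * (2 ^ k * real m ^ k)"
        using of_nat_mono[OF r(1), where 'a=real] by (simp add: m_def)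
      also have "\<dots> \<le> 2 * \<eta> * (real m)\<^sup>2 * (2 ^ k * real m ^ k)" using d by (intro mult_right_mono) auto
      also have "\<dots> = (2 * \<eta> * 2 ^ k * real m ^ k) * (real m)\<^sup>2" by simp
      finally have rr: "real r \<le> 2 * \<eta> * 2 ^ k * real m ^ k" using m by (simp add: mult_le_cancel_right)
      have "(M - \<eta>) * real m ^ k < S * N (H n)" by (rule big)
      also have "\<dots> \<le> S * (real (card (bicliques s t (cut A) ?V)) + real r)"
        unfolding N_def using of_nat_mono[OF r(2), where 'a=real] S_pos by (intro mult_left_mono) auto
      also have "\<dots> = S * real (card (bicliques s t (cut A) ?V)) + S * real r" by (simp add: distrib_left)
      also have "\<dots> \<le> f y * real m ^ k + S * (2 * \<eta> * 2 ^ k * real m ^ k)"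
        using cut_count_le[OF fin AV Vne] rr S_pos by (intro add_mono mult_left_mono) (auto simp: y_def m_def)
      also have "\<dots> = (f y + S * (2 * \<eta> * 2 ^ k)) * real m ^ k" by (simp add: algebra_simps)
      finally have "M - \<eta> < f y + S * (2 * \<eta> * 2 ^ k)" using m by (simp add: mult_less_cancel_right)
      with y01 yx s1 s2 show ?case unfolding p_def q_def m_def by blast
    qed
  qed
  have lsum: "(\<lambda>n. real (nth_largest_part (P n) 0) / real (order (H n)) + real (nth_largest_part (P n) 1) / real (order (H n)))
     \<longlonglongrightarrow> x 0 + x 1" by (intro tendsto_add parts)
  have "x 0 + x 1 \<le> 1"
    by (rule tendsto_upperbound[OF lsum]) (use key[of 1] in \<open>auto elim: eventually_mono\<close>)
  moreover have "x 0 + x 1 \<ge> 1"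
  proof (rule field_le_epsilon)
    fix \<eta> :: real assume "\<eta> > 0"
    have "1 - \<eta> \<le> x 0 + x 1"
      by (rule tendsto_lowerbound[OF lsum]) (use key[OF \<open>\<eta> > 0\<close>] in \<open>auto elim: eventually_mono\<close>)
    then show "1 \<le> x 0 + x 1 + \<eta>" by simp
  qed
  ultimately have x01: "x 1 = 1 - x 0" by simp
  have "x 1 \<le> x 0" using x(1) by (simp add: decseq_Suc_iff)
  then have x0: "1/2 \<le> x 0" "x 0 \<le> 1" using x01 x(2)[of 1] by auto
  have "M \<le> f (x 0)"
  proof (rule field_le_epsilon)
    fix \<epsilon> :: real assume \<epsilon>: "\<epsilon> > 0"
    have "isCont f (x 0)" using continuous_f[of UNIV] by (simp add: continuous_on_eq_continuous_at)
    then obtain d where d: "d > 0" "\<And>y. \<bar>y - x 0\<bar> < d \<Longrightarrow> \<bar>f y - f (x 0)\<bar> < \<epsilon> / 2"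
      unfolding isCont_def LIM_eq using \<epsilon> by (metis abs_zero diff_self half_gt_zero real_norm_def)
    define K where "K = 1 + S * (2 * 2 ^ k)"
    have K: "K > 0" using S_pos by (simp add: K_def add_pos_pos)
    \<comment> \<open>Half of \<epsilon> is for the continuity of f at x 0, the other half for the
      error in \<open>key\<close>, which is \<eta> K.\<close>
    define \<eta> where "\<eta> = min (d / 2) (\<epsilon> / (2 * K))"
    have \<eta>: "\<eta> > 0" "2 * \<eta> \<le> d" using d(1) \<epsilon> K by (auto simp: \<eta>_def)
    have "\<eta> \<le> \<epsilon> / (2 * K)" by (simp add: \<eta>_def)
    then have "\<eta> * K \<le> \<epsilon> / 2" using K by (simp add: field_simps)
    then have e2: "\<eta> + S * (2 * \<eta> * 2 ^ k) \<le> \<epsilon> / 2" by (simp add: K_def algebra_simps)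
    obtain y where y: "\<bar>y - x 0\<bar> < 2 * \<eta>" "M - \<eta> < f y + S * (2 * \<eta> * 2 ^ k)"
      using eventually_happens[OF key[OF \<eta>(1)]] by auto
    have "\<bar>f y - f (x 0)\<bar> < \<epsilon> / 2" using y(1) \<eta>(2) by (intro d(2)) linarith
    then show "M \<le> f (x 0) + \<epsilon>" using y(2) e2 by linarith
  qed
  then have "f (x 0) = M" using f_le_M[of "x 0"] x0 by linarith
  then have xa: "x 0 = \<alpha>" using argmax_unique x0 by blast
  show ?thesis
  proof
    fix i :: nat
    consider "i = 0" | "i = 1" | "i \<ge> 2" by linarith
    then show "x i = two_part_seq \<alpha> i"
    proof cases
      case 3
      \<comment> \<open>The first two entries already sum to 1, and the total is at most 1.\<close>
      have "(\<Sum>j\<in>{0, 1, i}. x j) \<le> suminf x" using x by (intro sum_le_suminf) auto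
      then have "x 0 + x 1 + x i \<le> 1" using 3 x(4) by simp
      then have "x i = 0" using x01 x(2)[of i] by simp
      then show ?thesis using 3 by (simp add: two_part_seq_def)
    qed (use xa x01 in \<open>auto simp: two_part_seq_def\<close>)
  qed
qed

lemma stability_and_unique_maximiser:
  "perfectly_stable (induced_density (complete_bipartite s t)) \<and>
    inducibility (complete_bipartite s t) = real ((s + t) choose s) * M_st s t \<and>
    (\<exists>\<alpha>\<in>{1/2..1}. (\<forall>x\<in>{1/2..1}. f_st s t x \<le> f_st s t \<alpha>) \<and>
       {x. maximiser (induced_density (complete_bipartite s t)) x} = {two_part_seq \<alpha>})"
proof (intro conjI bexI[of _ \<alpha>] ballI)
  show "perfectly_stable L" by (rule perfectly_stable_L)
  show "inducibility F = real (k choose s) * M_st s t" by (simp only: inducibility_eq \<Lambda>_eq)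
  show "f x \<le> f \<alpha>" if "x \<in> {1/2..1}" for x using f_le_M[of x] that \<alpha>(2) by auto
  show "{x. maximiser L x} = {two_part_seq \<alpha>}" using maximiser_two_part maximiser_unique by blast
qed (rule \<alpha>(1))

end

theorem theorem1p6:
  fixes s t :: nat
  assumes "s * t \<ge> 2"
  shows "perfectly_stable (induced_density (complete_bipartite s t)) \<and>
    inducibility (complete_bipartite s t) = real ((s + t) choose s) * M_st s t \<and>
    (\<exists>\<alpha>\<in>{1/2..1}. (\<forall>x\<in>{1/2..1}. f_st s t x \<le> f_st s t \<alpha>) \<and>
       {x. maximiser (induced_density (complete_bipartite s t)) x} = {two_part_seq \<alpha>})"
proof -
  have params: "biclique_params a b" if "a * b \<ge> 2" "a \<le> b" for a b :: nat
  proof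
    show "1 \<le> a" using that(1) by (cases a) auto
    show "a \<le> b" by (rule that(2))
    show "2 \<le> b"
    proof (rule ccontr)
      assume "\<not> 2 \<le> b"
      then have "a * b \<le> 1 * 1" using that(2) by (intro mult_le_mono) auto
      then show False using that(1) by simp
    qed
  qed
  show ?thesis
  proof (cases "s \<le> t")
    case True
    have "biclique_params s t" using params assms True by blast
    then show ?thesis by (rule biclique_params.stability_and_unique_maximiser)
  next
    case False
    \<comment> \<open>Every notion in the claim is invariant under exchanging s and t, so the
      swapped parameters are used.\<close>
    have params: "biclique_params t s" using params[of t s] assms False by (simp add: mult.commute)
    have f: "f_st t s = f_st s t" by (simp add: f_st_def fun_eq_iff add.commute)
    have M: "M_st t s = M_st s t" by (simp add: M_st_def f)
    have c: "induced_count (complete_bipartite t s) = induced_count (complete_bipartite s t)"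
      by (rule induced_count_swap)
    have d: "induced_density (complete_bipartite t s) = induced_density (complete_bipartite s t)"
      by (simp add: induced_density_def fun_eq_iff c add.commute)
    have i: "inducibility (complete_bipartite t s) = inducibility (complete_bipartite s t)"
      by (simp add: inducibility_def max_count_def c add.commute)
    have b: "((t + s) choose t) = ((s + t) choose s)"
      using binomial_symmetric[of t "t + s"] by (simp add: add.commute)
    show ?thesis using biclique_params.stability_and_unique_maximiser[OF params] unfolding f M d i b .
  qed
qed

end
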